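(* Let $\nu>0$ and $0<R_1<R_2$. There exist constants $C_1=C_1(\nu,R_1,R_2)>0$ and $C_2=C_2(\nu,R_1,R_2)>0$, depending only on $\nu,R_1,R_2$, with the properties (P1) and (P2) stated in the context respectively, such that, with $C_\ast:=\min\{C_1,C_2\}$, the following holds. Let $\omega_1,\omega_2\in\mathbb{R}$ and let $(v,p)$, $v=v^r\bm{e}_r+v^\theta\bm{e}_\theta+v^z\bm{e}_z$, be a smooth solution (smooth up to the boundary, not assumed axially symmetric) in $\Omega$ of $$\left\{\begin{aligned} (v\cdot\nabla)v^r-\frac{(v^\theta)^2}{r}+\partial_r p&=\nu\Big(\Delta-\frac1{r^2}\Big)v^r-\nu\frac{2}{r^2}\partial_\theta v^\theta,\\ (v\cdot\nabla)v^\theta+\frac{v^rv^\theta}{r}+\frac1r\partial_\theta p&=\nu\Big(\Delta-\frac1{r^2}\Big)v^\theta+\nu\frac{2}{r^2}\partial_\theta v^r,\\ (v\cdot\nabla)v^z+\partial_z p&=\nu\Delta v^z,\\ \frac1r\partial_r(rv^r)+\frac1r\partial_\theta v^\theta+\partial_z v^z&=0, \end{aligned}\right.$$ with the boundary conditions $$v^r(R_j,\theta,z)=v^z(R_j,\theta,z)=0\ (j=1,2),\qquad v^\theta(R_1,\theta,z)=R_1\omega_1,\qquad v^\theta(R_2,\theta,z)=R_2\omega_2$$ for all $\theta,z$. If $$\max\{R_1|\omega_1|,R_2|\omega_2|\}<C_\ast\quad\text{and}\quad\|v\|_{L^\infty(\Omega)}<C_\ast,$$ then $(v,p)$ is axially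 symmetric (i.e. $v^r,v^\theta,v^z,p$ do not depend on $\theta$) and is a generalized Taylor--Couette flow: there exist constants $a,b\in\mathbb{R}$ such that $$\begin{aligned} v^r&\equiv0,\\ v^\theta&=Ar+B\frac1r,\\ v^z&=\frac{a}{4\nu}R_1^2\left[\Big(\frac{r}{R_1}\Big)^2-1+\frac{1-\eta^2}{\eta^2\log\eta}\log\Big(\frac{r}{R_1}\Big)\right],\\ p&=az+b+\frac{A^2}{2}r^2+2AB\log r-\frac{B^2}{2}\frac1{r^2}. \end{aligned}$$ In particular, if moreover $p$ is bounded or periodic in $z$, then $v$ is the canonical Taylor--Couette flow $v^r\equiv0$, $v^\theta=Ar+B\frac1r$, $v^z\equiv0$.
   Context: $\Omega=\{(x_1,x_2,x_3)\in\mathbb{R}^3: R_1<\sqrt{x_1^2+x_2^2}<R_2\}$ is the region between two concentric cylinders. Cylindrical coordinates $(r,\theta,z)$ are used, with $\bm{e}_r=(\cos\theta,\sin\theta,0)$, $\bm{e}_\theta=(-\sin\theta,\cos\theta,0)$, $\bm{e}_z=(0,0,1)$; the components $v^r,v^\theta,v^z$ and $p$ are functions of $(r,\theta,z)$ that are $2\pi$-periodic in $\theta$. Notation: $$v\cdot\nabla=v^r\partial_r+\frac{v^\theta}{r}\partial_\theta+v^z\partial_z,\qquad \Delta=\partial_r^2+\frac1r\partial_r+\frac1{r^2}\partial_\theta^2+\partial_z^2.$$ Constants: $\eta=R_1/R_2$ and, if $\omega_1\neq0$, $\mu=\omega_2/\omega_1$. Then $$A=\begin{cases}\dfrac{\mu-\eta^2}{1-\eta^2}\,\omega_1,&\omega_1\ne0,\\[2mm]\dfrac{1}{1-\eta^2}\,\omega_2,&\omega_1=0,\end{cases}\qquad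 B=\begin{cases}\dfrac{1-\mu}{1-\eta^2}\,\omega_1R_1^2,&\omega_1\ne0,\\[2mm]-\dfrac{1}{1-\eta^2}\,\omega_2R_1^2,&\omega_1=0.\end{cases}$$ Properties of the constants: (P1) For all $\omega_1,\omega_2\in\mathbb{R}$ and every axially symmetric smooth solution $(v,p)$ (components and pressure depending on $(r,z)$ only) of the system and boundary conditions in the claim, if $\max\{R_1|\omega_1|,R_2|\omega_2|\}<C_1$ and $\|v\|_{L^\infty(\Omega)}<C_1$, then $(v,p)$ is of the generalized Taylor--Couette form displayed in the claim for some $a,b\in\mathbb{R}$; and if in addition $p$ is bounded or periodic in $z$, then $a=0$ and $v^z\equiv0$. (P2) For all $\omega_1,\omega_2\in\mathbb{R}$ and every smooth solution $(v,p)$ of the system and boundary conditions in the claim, if $\max\{R_1|\omega_1|,R_2|\omega_2|\}<C_2$ and $\|v\|_{L^\infty(\Omega)}<C_2$, then $\partial_\theta v^r=\partial_\theta v^\theta=\partial_\theta v^z\equiv0$ and $\partial_\theta p\equiv0$ in $\Omega$. *)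

theory Defs
  imports "HOL-Probability.Essential_Supremum"
begin

text \<open>Scalar quantities are functions of the cylindrical coordinates \<open>(r, \<theta>, z)\<close>, encoded as
  nested triples. In these coordinates the region between the cylinders is the slab
  \<open>R1 < r < R2\<close>.\<close>

type_synonym cyl = "real \<times> real \<times> real"

definition slab :: "real \<Rightarrow> real \<Rightarrow> cyl set" where
  "slab R1 R2 = {R1<..<R2} \<times> UNIV"

definition closed_slab :: "real \<Rightarrow> real \<Rightarrow> cyl set" where
  "closed_slab R1 R2 = {R1..R2} \<times> UNIV"

text \<open>On the closure \<open>S\<close> of an open set, derivatives at boundary points are taken
  within \<open>S\<close>; on the slab this is the same as requiring that all partial derivatives up to order
  \<open>k\<close> exist inside and extend continuously to the closure. The function \<open>g b\<close> is the partial
  derivative in the coordinate direction \<open>b\<close>.\<close>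

primrec Ck_on :: "nat \<Rightarrow> 'a::euclidean_space set \<Rightarrow> ('a \<Rightarrow> real) \<Rightarrow> bool" where
  "Ck_on 0 S f \<longleftrightarrow> continuous_on S f"
| "Ck_on (Suc k) S f \<longleftrightarrow>
     (\<exists>g. (\<forall>x\<in>S. (f has_derivative (\<lambda>h. \<Sum>b\<in>Basis. (h \<bullet> b) * g b x)) (at x within S)) \<and>
          (\<forall>b\<in>Basis. Ck_on k S (g b)))"

definition smooth_on :: "'a::euclidean_space set \<Rightarrow> ('a \<Rightarrow> real) \<Rightarrow> bool" where
  "smooth_on S f \<longleftrightarrow> (\<forall>k. Ck_on k S f)"

text \<open>The partial derivatives below are only ever evaluated in the open slab, where they are
  genuine derivatives for functions that are smooth on the closed slab.\<close>

definition d_r :: "(cyl \<Rightarrow> real) \<Rightarrow> cyl \<Rightarrow> real" where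
  "d_r f = (\<lambda>(r, \<theta>, z). deriv (\<lambda>s. f (s, \<theta>, z)) r)"

definition d_theta :: "(cyl \<Rightarrow> real) \<Rightarrow> cyl \<Rightarrow> real" where
  "d_theta f = (\<lambda>(r, \<theta>, z). deriv (\<lambda>s. f (r, s, z)) \<theta>)"

definition d_z :: "(cyl \<Rightarrow> real) \<Rightarrow> cyl \<Rightarrow> real" where
  "d_z f = (\<lambda>(r, \<theta>, z). deriv (\<lambda>s. f (r, \<theta>, s)) z)"

definition advect :: "(cyl \<Rightarrow> real) \<Rightarrow> (cyl \<Rightarrow> real) \<Rightarrow> (cyl \<Rightarrow> real) \<Rightarrow> (cyl \<Rightarrow> real) \<Rightarrow> cyl \<Rightarrow> real" where
  "advect vr vt vz f = (\<lambda>(r, \<theta>, z).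
     vr (r, \<theta>, z) * d_r f (r, \<theta>, z) + vt (r, \<theta>, z) / r * d_theta f (r, \<theta>, z)
     + vz (r, \<theta>, z) * d_z f (r, \<theta>, z))"

definition cyl_laplacian :: "(cyl \<Rightarrow> real) \<Rightarrow> cyl \<Rightarrow> real" where
  "cyl_laplacian f = (\<lambda>(r, \<theta>, z).
     d_r (d_r f) (r, \<theta>, z) + 1 / r * d_r f (r, \<theta>, z)
     + 1 / r\<^sup>2 * d_theta (d_theta f) (r, \<theta>, z) + d_z (d_z f) (r, \<theta>, z))"

definition theta_periodic :: "real \<Rightarrow> real \<Rightarrow> (cyl \<Rightarrow> real) \<Rightarrow> bool" where
  "theta_periodic R1 R2 f \<longleftrightarrow>
     (\<forall>r \<theta> z. R1 \<le> r \<and> r \<le> R2 \<longrightarrow> f (r, \<theta> + 2 * pi, z) = f (r, \<theta>, z))"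

definition navier_stokes_cyl ::
  "real \<Rightarrow> real \<Rightarrow> real \<Rightarrow> (cyl \<Rightarrow> real) \<Rightarrow> (cyl \<Rightarrow> real) \<Rightarrow> (cyl \<Rightarrow> real) \<Rightarrow> (cyl \<Rightarrow> real) \<Rightarrow> bool" where
  "navier_stokes_cyl \<nu> R1 R2 vr vt vz p \<longleftrightarrow>
     (\<forall>r \<theta> z. R1 < r \<and> r < R2 \<longrightarrow> (let x = (r, \<theta>, z) in
        advect vr vt vz vr x - (vt x)\<^sup>2 / r + d_r p x
          = \<nu> * (cyl_laplacian vr x - 1 / r\<^sup>2 * vr x) - \<nu> * (2 / r\<^sup>2) * d_theta vt x \<and>
        advect vr vt vz vt x + vr x * vt x / r + 1 / r * d_theta p x
          = \<nu> * (cyl_laplacian vt x - 1 / r\<^sup>2 * vt x) + \<nu> * (2 / r\<^sup>2) * d_theta vr x \<and>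
        advect vr vt vz vz x + d_z p x = \<nu> * cyl_laplacian vz x \<and>
        1 / r * d_r (\<lambda>(s, \<phi>, \<zeta>). s * vr (s, \<phi>, \<zeta>)) x + 1 / r * d_theta vt x + d_z vz x = 0))"

definition rotating_bc ::
  "real \<Rightarrow> real \<Rightarrow> real \<Rightarrow> real \<Rightarrow> (cyl \<Rightarrow> real) \<Rightarrow> (cyl \<Rightarrow> real) \<Rightarrow> (cyl \<Rightarrow> real) \<Rightarrow> bool" where
  "rotating_bc R1 R2 \<omega>1 \<omega>2 vr vt vz \<longleftrightarrow>
     (\<forall>\<theta> z. vr (R1, \<theta>, z) = 0 \<and> vr (R2, \<theta>, z) = 0 \<and>
            vz (R1, \<theta>, z) = 0 \<and> vz (R2, \<theta>, z) = 0 \<and>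
            vt (R1, \<theta>, z) = R1 * \<omega>1 \<and> vt (R2, \<theta>, z) = R2 * \<omega>2)"

definition smooth_solution ::
  "real \<Rightarrow> real \<Rightarrow> real \<Rightarrow> real \<Rightarrow> real \<Rightarrow>
   (cyl \<Rightarrow> real) \<Rightarrow> (cyl \<Rightarrow> real) \<Rightarrow> (cyl \<Rightarrow> real) \<Rightarrow> (cyl \<Rightarrow> real) \<Rightarrow> bool" where
  "smooth_solution \<nu> R1 R2 \<omega>1 \<omega>2 vr vt vz p \<longleftrightarrow>
     (\<forall>f\<in>{vr, vt, vz, p}. smooth_on (closed_slab R1 R2) f \<and> theta_periodic R1 R2 f) \<and>
     navier_stokes_cyl \<nu> R1 R2 vr vt vz p \<and> rotating_bc R1 R2 \<omega>1 \<omega>2 vr vt vz"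

definition axisymmetric :: "real \<Rightarrow> real \<Rightarrow> (cyl \<Rightarrow> real) \<Rightarrow> bool" where
  "axisymmetric R1 R2 f \<longleftrightarrow>
     (\<forall>r \<theta> \<theta>' z. R1 < r \<and> r < R2 \<longrightarrow> f (r, \<theta>, z) = f (r, \<theta>', z))"

definition Omega :: "real \<Rightarrow> real \<Rightarrow> (real^3) set" where
  "Omega R1 R2 = {x. R1 < sqrt ((x$1)\<^sup>2 + (x$2)\<^sup>2) \<and> sqrt ((x$1)\<^sup>2 + (x$2)\<^sup>2) < R2}"

text \<open>The angle is \<^const>\<open>Arg\<close>, with values in \<open>]-\<pi>, \<pi>]\<close>; for components that are
  \<open>2\<pi>\<close>-periodic in \<open>\<theta>\<close> the field does not depend on this choice of branch.\<close>

definition velocity_field ::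
  "(cyl \<Rightarrow> real) \<Rightarrow> (cyl \<Rightarrow> real) \<Rightarrow> (cyl \<Rightarrow> real) \<Rightarrow> real^3 \<Rightarrow> real^3" where
  "velocity_field vr vt vz x =
     (let r = sqrt ((x$1)\<^sup>2 + (x$2)\<^sup>2); \<theta> = Arg (Complex (x$1) (x$2)); z = x$3 in
        vr (r, \<theta>, z) *\<^sub>R vector [cos \<theta>, sin \<theta>, 0]
        + vt (r, \<theta>, z) *\<^sub>R vector [- sin \<theta>, cos \<theta>, 0]
        + vz (r, \<theta>, z) *\<^sub>R vector [0, 0, 1])"

definition Linf_norm :: "(real^3) set \<Rightarrow> (real^3 \<Rightarrow> real^3) \<Rightarrow> ereal" where
  "Linf_norm D v = esssup (lebesgue_on D) (\<lambda>x. ereal (norm (v x)))"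

definition small_data ::
  "real \<Rightarrow> real \<Rightarrow> real \<Rightarrow> real \<Rightarrow> real \<Rightarrow> (cyl \<Rightarrow> real) \<Rightarrow> (cyl \<Rightarrow> real) \<Rightarrow> (cyl \<Rightarrow> real) \<Rightarrow> bool" where
  "small_data C R1 R2 \<omega>1 \<omega>2 vr vt vz \<longleftrightarrow>
     max (R1 * \<bar>\<omega>1\<bar>) (R2 * \<bar>\<omega>2\<bar>) < C \<and>
     Linf_norm (Omega R1 R2) (velocity_field vr vt vz) < ereal C"

definition couette_A :: "real \<Rightarrow> real \<Rightarrow> real \<Rightarrow> real \<Rightarrow> real" where
  "couette_A R1 R2 \<omega>1 \<omega>2 = (let \<eta> = R1 / R2; \<mu> = \<omega>2 / \<omega>1 in
     if \<omega>1 \<noteq> 0 then (\<mu> - \<eta>\<^sup>2) / (1 - \<eta>\<^sup>2) * \<omega>1 else 1 / (1 - \<eta>\<^sup>2) * \<omega>2)"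

definition couette_B :: "real \<Rightarrow> real \<Rightarrow> real \<Rightarrow> real \<Rightarrow> real" where
  "couette_B R1 R2 \<omega>1 \<omega>2 = (let \<eta> = R1 / R2; \<mu> = \<omega>2 / \<omega>1 in
     if \<omega>1 \<noteq> 0 then (1 - \<mu>) / (1 - \<eta>\<^sup>2) * \<omega>1 * R1\<^sup>2 else - (1 / (1 - \<eta>\<^sup>2)) * \<omega>2 * R1\<^sup>2)"

definition generalized_taylor_couette ::
  "real \<Rightarrow> real \<Rightarrow> real \<Rightarrow> real \<Rightarrow> real \<Rightarrow>
   (cyl \<Rightarrow> real) \<Rightarrow> (cyl \<Rightarrow> real) \<Rightarrow> (cyl \<Rightarrow> real) \<Rightarrow> (cyl \<Rightarrow> real) \<Rightarrow> real \<Rightarrow> real \<Rightarrow> bool" where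
  "generalized_taylor_couette \<nu> R1 R2 \<omega>1 \<omega>2 vr vt vz p a b \<longleftrightarrow>
     (let \<eta> = R1 / R2; A = couette_A R1 R2 \<omega>1 \<omega>2; B = couette_B R1 R2 \<omega>1 \<omega>2 in
      \<forall>r \<theta> z. R1 < r \<and> r < R2 \<longrightarrow>
        vr (r, \<theta>, z) = 0 \<and>
        vt (r, \<theta>, z) = A * r + B * (1 / r) \<and>
        vz (r, \<theta>, z) = a / (4 * \<nu>) * R1\<^sup>2 *
          ((r / R1)\<^sup>2 - 1 + (1 - \<eta>\<^sup>2) / (\<eta>\<^sup>2 * ln \<eta>) * ln (r / R1)) \<and>
        p (r, \<theta>, z) = a * z + b + A\<^sup>2 / 2 * r\<^sup>2 + 2 * A * B * ln r - B\<^sup>2 / 2 * (1 / r\<^sup>2))"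

definition canonical_taylor_couette ::
  "real \<Rightarrow> real \<Rightarrow> real \<Rightarrow> real \<Rightarrow> (cyl \<Rightarrow> real) \<Rightarrow> (cyl \<Rightarrow> real) \<Rightarrow> (cyl \<Rightarrow> real) \<Rightarrow> bool" where
  "canonical_taylor_couette R1 R2 \<omega>1 \<omega>2 vr vt vz \<longleftrightarrow>
     (\<forall>r \<theta> z. R1 < r \<and> r < R2 \<longrightarrow>
        vr (r, \<theta>, z) = 0 \<and>
        vt (r, \<theta>, z) = couette_A R1 R2 \<omega>1 \<omega>2 * r + couette_B R1 R2 \<omega>1 \<omega>2 * (1 / r) \<and>
        vz (r, \<theta>, z) = 0)"

definition bounded_or_z_periodic :: "real \<Rightarrow> real \<Rightarrow> (cyl \<Rightarrow> real) \<Rightarrow> bool" where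
  "bounded_or_z_periodic R1 R2 p \<longleftrightarrow>
     bounded (p ` slab R1 R2) \<or>
     (\<exists>T>0. \<forall>r \<theta> z. R1 < r \<and> r < R2 \<longrightarrow> p (r, \<theta>, z + T) = p (r, \<theta>, z))"

definition property_P1 :: "real \<Rightarrow> real \<Rightarrow> real \<Rightarrow> real \<Rightarrow> bool" where
  "property_P1 \<nu> R1 R2 C \<longleftrightarrow>
     (\<forall>\<omega>1 \<omega>2 vr vt vz p.
        smooth_solution \<nu> R1 R2 \<omega>1 \<omega>2 vr vt vz p \<and>
        (\<forall>f\<in>{vr, vt, vz, p}. axisymmetric R1 R2 f) \<and>
        small_data C R1 R2 \<omega>1 \<omega>2 vr vt vz \<longrightarrow>
        (\<exists>a b. generalized_taylor_couette \<nu> R1 R2 \<omega>1 \<omega>2 vr vt vz p a b \<and>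
           (bounded_or_z_periodic R1 R2 p \<longrightarrow> a = 0 \<and> (\<forall>x\<in>slab R1 R2. vz x = 0))))"

definition property_P2 :: "real \<Rightarrow> real \<Rightarrow> real \<Rightarrow> real \<Rightarrow> bool" where
  "property_P2 \<nu> R1 R2 C \<longleftrightarrow>
     (\<forall>\<omega>1 \<omega>2 vr vt vz p.
        smooth_solution \<nu> R1 R2 \<omega>1 \<omega>2 vr vt vz p \<and>
        small_data C R1 R2 \<omega>1 \<omega>2 vr vt vz \<longrightarrow>
        (\<forall>f\<in>{vr, vt, vz, p}. \<forall>x\<in>slab R1 R2. d_theta f x = 0))"

end

theory Submission
  imports Defs
begin

text \<open>
  Let \<open>U\<close> be the Taylor--Couette flow with the boundary velocities of \<open>v\<close> plus the Poiseuille
  flow with the axial flux of \<open>v\<close>, and let \<open>u = v - U\<close>. Then \<open>u\<close> is solenoidal, vanishes on the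
  cylinders, has zero flux through every cross section, and satisfies \<open>\<nu> \<Delta>u - \<nabla>q = div F\<close> with
  \<open>F = v \<otimes> v - U \<otimes> U\<close>, so that \<open>\<bar>F\<bar> \<le> \<delta> \<bar>u\<bar>\<close> for small data.

  The pressure disappears when the equation is tested with the solenoidal field
  \<open>\<phi>(z) w - \<phi>'(z) W\<close>, where the horizontal field \<open>W\<close> solves \<open>div W = w\<^sub>z\<close> on every cross section; this
  is possible because the flux of \<open>w\<close> vanishes. As nothing is known about the growth of \<open>\<nabla>u\<close>, one
  does not take \<open>w = u\<close> but averages the equation against a sawtooth kernel in \<open>\<theta>\<close>: then
  \<open>\<partial>\<^sub>\<theta> w = 2\<pi> u - \<integral> u d\<theta>\<close> is bounded, which is all that bounding \<open>W\<close> requires. With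
  \<open>\<phi> = (\<omega> - \<omega>(N))\<^sup>4\<close>, \<open>\<omega>(z) = 1 / (1 + \<kappa>\<^sup>2 z\<^sup>2)\<close> and \<open>\<kappa>\<close> small, the cutoff terms are absorbed up to \<open>O(1/N)\<close>,
  and since \<open>u\<close> is recovered from \<open>w\<close> and \<open>\<partial>\<^sub>\<theta> w\<close> one gets
  \<open>\<integral> \<omega>\<^sup>4 \<bar>u\<bar>\<^sup>2 \<le> K \<delta>\<^sup>2 \<integral> \<omega>\<^sup>4 \<bar>u\<bar>\<^sup>2\<close> in the limit. Hence \<open>u = 0\<close> for small data.
\<close>

section \<open>Functions on the slab\<close>

text \<open>What rules out \<open>w = u\<close> is the gradient of \<open>W\<close>: it costs
  angular derivatives of \<open>w\<close>, and a bound on \<open>u\<close> does not control those of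
  \<open>u\<close>. The sawtooth average is linear and commutes with the equations, and the weight
  depends on z alone, so averages in r and \<theta> pass under the weighted integral; the smallness
  of \<open>F\<close> is used only afterwards, through Cauchy-Schwarz. The kernel has nonzero mean,
  so the angular mean of \<open>u\<close>, which the angular derivative of \<open>w\<close> loses,
  is still visible in the mean of \<open>w\<close>.

  The weight serves two competing needs. Its derivative is at most \<kappa> times itself, so every
  cutoff error carries a factor \<kappa>, and the Poincare inequality across the gap absorbs it for
  a \<kappa> that depends on \<nu>, R1 and R2 only. It decays like the inverse square of z, so
  subtracting its value at N, which makes the cutoff vanish at the ends, costs that value times a
  volume of order N and disappears in the limit. The sup bound on \<open>u\<close> enters only this
  remainder and does not affect the threshold \<delta>.\<close>

type_synonym field = "nat \<Rightarrow> cyl \<Rightarrow> real"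

locale annulus =
  fixes R1 R2 :: real
  assumes R1_pos: "0 < R1" and R1_less_R2: "R1 < R2"
begin

abbreviation S :: "cyl set" where "S \<equiv> closed_slab R1 R2"

definition cont :: "(cyl \<Rightarrow> real) \<Rightarrow> bool" where
  "cont f \<longleftrightarrow> continuous_on S f"

definition per :: "(cyl \<Rightarrow> real) \<Rightarrow> bool" where
  "per f \<longleftrightarrow> theta_periodic R1 R2 f"

text \<open>Only interior r are required, because a two-sided radial difference quotient at a wall
  would leave the slab. Angular and axial lines stay inside the closed slab, so
  \<open>has_dt\<close> and \<open>has_dz\<close> include the walls.\<close>

definition has_dr :: "(cyl \<Rightarrow> real) \<Rightarrow> (cyl \<Rightarrow> real) \<Rightarrow> bool" where
  "has_dr f f' \<longleftrightarrow> (\<forall>r \<theta> z. R1 < r \<and> r < R2 \<longrightarrow>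
     ((\<lambda>s. f (s, \<theta>, z)) has_real_derivative f' (r, \<theta>, z)) (at r))"

definition has_dt :: "(cyl \<Rightarrow> real) \<Rightarrow> (cyl \<Rightarrow> real) \<Rightarrow> bool" where
  "has_dt f f' \<longleftrightarrow> (\<forall>r \<theta> z. R1 \<le> r \<and> r \<le> R2 \<longrightarrow>
     ((\<lambda>s. f (r, s, z)) has_real_derivative f' (r, \<theta>, z)) (at \<theta>))"

definition has_dz :: "(cyl \<Rightarrow> real) \<Rightarrow> (cyl \<Rightarrow> real) \<Rightarrow> bool" where
  "has_dz f f' \<longleftrightarrow> (\<forall>r \<theta> z. R1 \<le> r \<and> r \<le> R2 \<longrightarrow>
     ((\<lambda>s. f (r, \<theta>, s)) has_real_derivative f' (r, \<theta>, z)) (at z))"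

text \<open>The integrated coordinate is kept as an ignored argument. Radial and angular integrals
  are then scalar fields on the slab like any other: they can be nested, differentiated and
  integrated over boxes, where the ignored argument contributes the length of its interval.\<close>

definition rad_int :: "(cyl \<Rightarrow> real) \<Rightarrow> cyl \<Rightarrow> real" where
  "rad_int f = (\<lambda>(r, \<theta>, z). integral {R1..R2} (\<lambda>s. f (s, \<theta>, z)))"

definition rad_prim :: "(cyl \<Rightarrow> real) \<Rightarrow> cyl \<Rightarrow> real" where
  "rad_prim f = (\<lambda>(r, \<theta>, z). integral {R1..r} (\<lambda>s. f (s, \<theta>, z)))"

definition ang_int :: "(cyl \<Rightarrow> real) \<Rightarrow> cyl \<Rightarrow> real" where
  "ang_int f = (\<lambda>(r, \<theta>, z). integral {0..2*pi} (\<lambda>s. f (r, s, z)))"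

text \<open>The kernel \<open>s\<close> jumps by \<open>2\<pi>\<close> at the period, hence \<open>\<partial>\<^sub>\<theta> (saw f) = 2\<pi> f - ang_int f\<close>: the angular
  derivative of the average is controlled by \<open>f\<close> itself.\<close>

definition saw :: "(cyl \<Rightarrow> real) \<Rightarrow> cyl \<Rightarrow> real" where
  "saw f = (\<lambda>(r, \<theta>, z). integral {0..2*pi} (\<lambda>s. s * f (r, \<theta> + s, z)))"

lemma S_iff: "(r, \<theta>, z) \<in> S \<longleftrightarrow> R1 \<le> r \<and> r \<le> R2"
  by (auto simp: closed_slab_def)

section \<open>Continuity on the closed slab under algebra, averages and primitives\<close>

lemma cont_compose:
  assumes "cont f" "continuous_on A a" "continuous_on A b" "continuous_on A c"
    and "\<And>x. x \<in> A \<Longrightarrow> R1 \<le> a x \<and> a x \<le> R2"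
  shows "continuous_on A (\<lambda>x. f (a x, b x, c x))"
proof (rule continuous_on_compose2[of S f A "\<lambda>x. (a x, b x, c x)"])
  show "continuous_on S f" using assms by (simp add: cont_def)
  show "continuous_on A (\<lambda>x. (a x, b x, c x))"
    using assms by (intro continuous_intros)
qed (use assms in \<open>auto simp: closed_slab_def\<close>)

lemma cont_const [intro!]: "cont (\<lambda>x. c)"
  by (simp add: cont_def)

lemma cont_add [intro!]: "cont f \<Longrightarrow> cont g \<Longrightarrow> cont (\<lambda>x. f x + g x)"
  by (auto simp: cont_def intro!: continuous_intros)

lemma cont_diff [intro!]: "cont f \<Longrightarrow> cont g \<Longrightarrow> cont (\<lambda>x. f x - g x)"
  by (auto simp: cont_def intro!: continuous_intros)

lemma cont_mult [intro!]: "cont f \<Longrightarrow> cont g \<Longrightarrow> cont (\<lambda>x. f x * g x)"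
  by (auto simp: cont_def intro!: continuous_intros)

lemma cont_uminus [intro!]: "cont f \<Longrightarrow> cont (\<lambda>x. - f x)"
  by (auto simp: cont_def intro!: continuous_intros)

lemma cont_power [intro!]: "cont f \<Longrightarrow> cont (\<lambda>x. f x ^ n)"
  by (auto simp: cont_def intro!: continuous_intros)

lemma cont_sum [intro!]: "(\<And>i. i \<in> I \<Longrightarrow> cont (f i)) \<Longrightarrow> cont (\<lambda>x. \<Sum>i\<in>I. f i x)"
  by (auto simp: cont_def intro!: continuous_intros)

lemma cont_fst [intro!]: "continuous_on {R1..R2} g \<Longrightarrow> cont (\<lambda>x. g (fst x))"
  unfolding cont_def closed_slab_def
  by (rule continuous_on_compose2[of "{R1..R2}" g]) (auto intro!: continuous_intros)

lemma cont_zz [intro!]: "continuous_on UNIV g \<Longrightarrow> cont (\<lambda>x. g (snd (snd x)))"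
  unfolding cont_def by (rule continuous_on_compose2[of UNIV g]) (auto intro!: continuous_intros)

lemma cont_r [intro!]: "cont (\<lambda>x. fst x)"
  by (auto simp: cont_def intro!: continuous_intros)

lemma cont_divide_r [intro!]:
  assumes "cont f" shows "cont (\<lambda>x. f x / fst x)"
proof -
  have "cont (\<lambda>x. f x * (1 / fst x))"
    by (intro cont_mult assms cont_fst continuous_intros) (use R1_pos in auto)
  then show ?thesis by simp
qed

lemma cont_cong:
  assumes "cont f" "\<And>r \<theta> z. R1 \<le> r \<Longrightarrow> r \<le> R2 \<Longrightarrow> f (r, \<theta>, z) = g (r, \<theta>, z)"
  shows "cont g"
proof -
  have "continuous_on S f \<longleftrightarrow> continuous_on S g"
    by (rule continuous_on_cong) (use assms in \<open>auto simp: closed_slab_def\<close>)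
  then show ?thesis using assms by (simp add: cont_def)
qed

lemma cont_integral:
  fixes g :: "cyl \<Rightarrow> real \<Rightarrow> real"
  assumes "continuous_on (S \<times> {a..b}) (\<lambda>(x, s). g x s)"
  shows "cont (\<lambda>x. integral {a..b} (g x))"
  unfolding cont_def using integral_continuous_on_param[of S a b g] assms by simp

lemma cont_rad_int [intro!]:
  assumes "cont f" shows "cont (rad_int f)"
proof -
  have "cont (\<lambda>x. integral {R1..R2} (\<lambda>s. f (s, fst (snd x), snd (snd x))))"
    by (rule cont_integral, unfold case_prod_beta, rule cont_compose[OF assms])
      (auto intro!: continuous_intros)
  then show ?thesis by (simp only: rad_int_def case_prod_unfold)
qed

lemma cont_ang_int [intro!]:
  assumes "cont f" shows "cont (ang_int f)"
proof -
  have "cont (\<lambda>x. integral {0..2*pi} (\<lambda>s. f (fst x, s, snd (snd x))))"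
    by (rule cont_integral, unfold case_prod_beta, rule cont_compose[OF assms])
      (auto simp: closed_slab_def intro!: continuous_intros)
  then show ?thesis by (simp only: ang_int_def case_prod_unfold)
qed

lemma cont_saw [intro!]:
  assumes "cont f" shows "cont (saw f)"
proof -
  have "cont (\<lambda>x. integral {0..2*pi} (\<lambda>s. s * f (fst x, fst (snd x) + s, snd (snd x))))"
    by (rule cont_integral, unfold case_prod_beta,
        rule continuous_on_mult, (intro continuous_intros), rule cont_compose[OF assms])
      (auto simp: closed_slab_def intro!: continuous_intros)
  then show ?thesis by (simp only: saw_def case_prod_unfold)
qed

text \<open>Rescaling moves the variable endpoint into the integrand. Joint continuity of the
  primitive, \<open>cont_rad_prim\<close>, then becomes continuity of an integral over the fixed
  interval from 0 to 1.\<close>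

lemma rad_prim_rescaled:
  assumes "cont f" "R1 \<le> r" "r \<le> R2"
  shows "rad_prim f (r, \<theta>, z) = (r - R1) * integral {0..1} (\<lambda>x. f (R1 + x * (r - R1), \<theta>, z))"
proof (cases "r = R1")
  case True then show ?thesis by (simp add: rad_prim_def)
next
  case False
  then have r: "R1 < r" using assms by simp
  let ?h = "\<lambda>s. f (s, \<theta>, z)"
  have c: "continuous_on {R1..r} ?h"
    by (rule cont_compose[OF assms(1)]) (use assms in \<open>auto intro!: continuous_intros\<close>)
  have "(?h has_integral integral {R1..r} ?h) {R1..r}"
    using c by (intro integrable_integral integrable_continuous_real)
  then have "((\<lambda>x. ?h ((r - R1) *\<^sub>R x + R1)) has_integral (1 / (r - R1)) *\<^sub>R integral {R1..r} ?h)
      {0..1}"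
    using has_integral_affinity'[of ?h "integral {R1..r} ?h" R1 r "r - R1" R1] r
    by (simp add: image_affinity_atLeastAtMost_div_diff image_affinity_atLeastAtMost divide_simps)
  then have "integral {0..1} (\<lambda>x. ?h (R1 + x * (r - R1))) = (1 / (r - R1)) * integral {R1..r} ?h"
    by (auto intro!: integral_unique simp: algebra_simps)
  then show ?thesis using r by (simp add: rad_prim_def)
qed

lemma cont_rad_prim [intro!]:
  assumes "cont f" shows "cont (rad_prim f)"
proof -
  have "cont (\<lambda>x. (fst x - R1) * integral {0..1} (\<lambda>t. f (R1 + t * (fst x - R1), fst (snd x), snd (snd x))))"
  proof (intro cont_mult cont_diff cont_r cont_const cont_integral)
    show "continuous_on (S \<times> {0..1}) (\<lambda>(x, t). f (R1 + t * (fst x - R1), fst (snd x), snd (snd x)))"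
      unfolding case_prod_beta
    proof (rule cont_compose[OF assms])
      fix x :: "cyl \<times> real" assume x: "x \<in> S \<times> {0..1}"
      then have a: "0 \<le> snd x" "snd x \<le> 1" "0 \<le> fst (fst x) - R1" "fst (fst x) \<le> R2"
        by (auto simp: closed_slab_def)
      then have "snd x * (fst (fst x) - R1) \<le> fst (fst x) - R1"
        by (simp add: mult_left_le_one_le)
      then show "R1 \<le> R1 + snd x * (fst (fst x) - R1) \<and> R1 + snd x * (fst (fst x) - R1) \<le> R2"
        using a by simp
    qed (auto intro!: continuous_intros)
  qed
  then show ?thesis
    by (rule cont_cong) (simp add: rad_prim_rescaled[OF assms])
qed

section \<open>First derivatives as named functions, and their sawtooth averages\<close>

lemma has_drD: "has_dr f f' \<Longrightarrow> R1 < r \<Longrightarrow> r < R2 \<Longrightarrow>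
     ((\<lambda>s. f (s, \<theta>, z)) has_real_derivative f' (r, \<theta>, z)) (at r)"
  by (simp add: has_dr_def)

lemma has_dtD: "has_dt f f' \<Longrightarrow> R1 \<le> r \<Longrightarrow> r \<le> R2 \<Longrightarrow>
     ((\<lambda>s. f (r, s, z)) has_real_derivative f' (r, \<theta>, z)) (at \<theta>)"
  by (simp add: has_dt_def)

lemma has_dzD: "has_dz f f' \<Longrightarrow> R1 \<le> r \<Longrightarrow> r \<le> R2 \<Longrightarrow>
     ((\<lambda>s. f (r, \<theta>, s)) has_real_derivative f' (r, \<theta>, z)) (at z)"
  by (simp add: has_dz_def)

text \<open>The partial derivatives are arguments, not values of \<open>deriv\<close>: products,
  primitives and averages can then state theirs in closed form, and their continuity up to the walls
  is part of the notion although the radial one is a derivative in the interior only.\<close>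

definition C1 :: "(cyl \<Rightarrow> real) \<Rightarrow> (cyl \<Rightarrow> real) \<Rightarrow> (cyl \<Rightarrow> real) \<Rightarrow> (cyl \<Rightarrow> real) \<Rightarrow> bool" where
  "C1 f fr ft fz \<longleftrightarrow> cont f \<and> cont fr \<and> cont ft \<and> cont fz \<and> has_dr f fr \<and> has_dt f ft \<and> has_dz f fz"

lemma C1_I:
  assumes "cont f" "cont fr" "cont ft" "cont fz"
    and "\<And>r \<theta> z. R1 < r \<Longrightarrow> r < R2 \<Longrightarrow>
      ((\<lambda>s. f (s, \<theta>, z)) has_real_derivative fr (r, \<theta>, z)) (at r)"
    and "\<And>r \<theta> z. R1 \<le> r \<Longrightarrow> r \<le> R2 \<Longrightarrow>
      ((\<lambda>s. f (r, s, z)) has_real_derivative ft (r, \<theta>, z)) (at \<theta>)"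
    and "\<And>r \<theta> z. R1 \<le> r \<Longrightarrow> r \<le> R2 \<Longrightarrow>
      ((\<lambda>s. f (r, \<theta>, s)) has_real_derivative fz (r, \<theta>, z)) (at z)"
  shows "C1 f fr ft fz"
  using assms by (simp add: C1_def has_dr_def has_dt_def has_dz_def)

lemma C1_D:
  assumes "C1 f fr ft fz"
  shows "cont f" "cont fr" "cont ft" "cont fz" "has_dr f fr" "has_dt f ft" "has_dz f fz"
  using assms by (simp_all add: C1_def)

lemma C1_add:
  assumes "C1 f fr ft fz" "C1 g gr gt gz"
  shows "C1 (\<lambda>x. f x + g x) (\<lambda>x. fr x + gr x) (\<lambda>x. ft x + gt x) (\<lambda>x. fz x + gz x)"
  by (intro C1_I cont_add DERIV_add has_drD has_dtD has_dzD C1_D[OF assms(1)] C1_D[OF assms(2)])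

lemma C1_diff:
  assumes "C1 f fr ft fz" "C1 g gr gt gz"
  shows "C1 (\<lambda>x. f x - g x) (\<lambda>x. fr x - gr x) (\<lambda>x. ft x - gt x) (\<lambda>x. fz x - gz x)"
  by (intro C1_I cont_diff DERIV_diff has_drD has_dtD has_dzD C1_D[OF assms(1)] C1_D[OF assms(2)])

lemma C1_mult:
  assumes "C1 f fr ft fz" "C1 g gr gt gz"
  shows "C1 (\<lambda>x. f x * g x) (\<lambda>x. f x * gr x + fr x * g x) (\<lambda>x. f x * gt x + ft x * g x)
     (\<lambda>x. f x * gz x + fz x * g x)"
  by (intro C1_I cont_add cont_mult DERIV_mult' has_drD has_dtD has_dzD
    C1_D[OF assms(1)] C1_D[OF assms(2)])

lemma C1_const: "C1 (\<lambda>x. c) (\<lambda>x. 0) (\<lambda>x. 0) (\<lambda>x. 0)"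
  unfolding C1_def has_dr_def has_dt_def has_dz_def by auto

lemma C1_radial:
  assumes "continuous_on {R1..R2} g" "continuous_on {R1..R2} g'"
    and "\<And>r. R1 < r \<Longrightarrow> r < R2 \<Longrightarrow> (g has_real_derivative g' r) (at r)"
  shows "C1 (\<lambda>x. g (fst x)) (\<lambda>x. g' (fst x)) (\<lambda>x. 0) (\<lambda>x. 0)"
  unfolding C1_def has_dr_def has_dt_def has_dz_def using assms by auto

lemma C1_axial:
  assumes "continuous_on UNIV g'" "\<And>z. (g has_real_derivative g' z) (at z)"
  shows "C1 (\<lambda>x. g (snd (snd x))) (\<lambda>x. 0) (\<lambda>x. 0) (\<lambda>x. g' (snd (snd x)))"
proof -
  have "continuous_on UNIV g"
    using assms(2) DERIV_continuous_on[of UNIV g g'] by blast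
  then show ?thesis
  unfolding C1_def has_dr_def has_dt_def has_dz_def using assms by auto
qed

lemma C1_cong:
  assumes "C1 f fr ft fz"
    and "\<And>r \<theta> z. R1 \<le> r \<Longrightarrow> r \<le> R2 \<Longrightarrow> fr (r, \<theta>, z) = gr (r, \<theta>, z)"
    and "\<And>r \<theta> z. R1 \<le> r \<Longrightarrow> r \<le> R2 \<Longrightarrow> ft (r, \<theta>, z) = gt (r, \<theta>, z)"
    and "\<And>r \<theta> z. R1 \<le> r \<Longrightarrow> r \<le> R2 \<Longrightarrow> fz (r, \<theta>, z) = gz (r, \<theta>, z)"
  shows "C1 f gr gt gz"
  using assms unfolding C1_def has_dr_def has_dt_def has_dz_def
  by (auto intro: cont_cong)

text \<open>Differentiation under the integral sign, on the open radial interval. In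
  \<open>has_dt_saw\<close> the variable enters through \<theta> + s, so the derivative again falls
  on \<open>f\<close> and never on the kernel.\<close>

lemma has_dr_saw:
  assumes "cont f" "cont fr" "has_dr f fr"
  shows "has_dr (saw f) (saw fr)"
  unfolding has_dr_def
proof (intro allI impI)
  fix r \<theta> z assume r: "R1 < r \<and> r < R2"
  have "((\<lambda>r. integral (cbox 0 (2*pi)) (\<lambda>s. s * f (r, \<theta> + s, z))) has_real_derivative
      integral (cbox 0 (2*pi)) (\<lambda>s. s * fr (r, \<theta> + s, z))) (at r within {R1<..<R2})"
  proof (rule leibniz_rule_field_derivative)
    show "((\<lambda>x. t * f (x, \<theta> + t, z)) has_real_derivative t * fr (x, \<theta> + t, z)) (at x within {R1<..<R2})"
      if "x \<in> {R1<..<R2}" for x t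
      using that by (intro DERIV_cmult has_field_derivative_at_within[OF has_drD[OF assms(3)]]) auto
    show "(\<lambda>s. s * f (x, \<theta> + s, z)) integrable_on cbox 0 (2 * pi)" if "x \<in> {R1<..<R2}" for x
      by (rule integrable_continuous)
        (rule continuous_on_mult[OF _ cont_compose[OF assms(1)]],
          use that in \<open>auto intro!: continuous_intros\<close>)
    show "continuous_on ({R1<..<R2} \<times> cbox 0 (2 * pi)) (\<lambda>(x, t). t * fr (x, \<theta> + t, z))"
      unfolding case_prod_beta
      by (rule continuous_on_mult[OF _ cont_compose[OF assms(2)]])
        (use r in \<open>auto intro!: continuous_intros\<close>)
  qed (use r in auto)
  then show "((\<lambda>s. saw f (s, \<theta>, z)) has_real_derivative saw fr (r, \<theta>, z)) (at r)"
    using r by (simp add: saw_def at_within_open[of r "{R1<..<R2}"])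
qed

lemma has_dt_saw:
  assumes "cont f" "cont ft" "has_dt f ft"
  shows "has_dt (saw f) (saw ft)"
  unfolding has_dt_def
proof (intro allI impI)
  fix r \<theta> z assume r: "R1 \<le> r \<and> r \<le> R2"
  have "((\<lambda>\<theta>. integral (cbox 0 (2*pi)) (\<lambda>s. s * f (r, \<theta> + s, z))) has_real_derivative
      integral (cbox 0 (2*pi)) (\<lambda>s. s * ft (r, \<theta> + s, z))) (at \<theta> within UNIV)"
  proof (rule leibniz_rule_field_derivative)
    show "((\<lambda>x. t * f (r, x + t, z)) has_real_derivative t * ft (r, x + t, z)) (at x within UNIV)"
      for x t
    proof -
      have "((\<lambda>x. f (r, x, z)) has_real_derivative ft (r, x + t, z)) (at (x + t))"
        using r by (intro has_dtD[OF assms(3)]) auto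
      then have "((\<lambda>x. f (r, x + t, z)) has_real_derivative ft (r, x + t, z)) (at x)"
        by (simp add: DERIV_shift)
      then show ?thesis by (intro DERIV_cmult) simp
    qed
    show "(\<lambda>s. s * f (r, x + s, z)) integrable_on cbox 0 (2 * pi)" for x
      by (rule integrable_continuous)
        (rule continuous_on_mult[OF _ cont_compose[OF assms(1)]],
          use r in \<open>auto intro!: continuous_intros\<close>)
    show "continuous_on (UNIV \<times> cbox 0 (2 * pi)) (\<lambda>(x, t). t * ft (r, x + t, z))"
      unfolding case_prod_beta
      by (rule continuous_on_mult[OF _ cont_compose[OF assms(2)]])
        (use r in \<open>auto intro!: continuous_intros\<close>)
  qed auto
  then show "((\<lambda>s. saw f (r, s, z)) has_real_derivative saw ft (r, \<theta>, z)) (at \<theta>)"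
    by (simp add: saw_def)
qed

lemma has_dz_saw:
  assumes "cont f" "cont fz" "has_dz f fz"
  shows "has_dz (saw f) (saw fz)"
  unfolding has_dz_def
proof (intro allI impI)
  fix r \<theta> z assume r: "R1 \<le> r \<and> r \<le> R2"
  have "((\<lambda>z. integral (cbox 0 (2*pi)) (\<lambda>s. s * f (r, \<theta> + s, z))) has_real_derivative
      integral (cbox 0 (2*pi)) (\<lambda>s. s * fz (r, \<theta> + s, z))) (at z within UNIV)"
  proof (rule leibniz_rule_field_derivative)
    show "((\<lambda>x. t * f (r, \<theta> + t, x)) has_real_derivative t * fz (r, \<theta> + t, x)) (at x within UNIV)"
      for x t
      using r by (intro DERIV_cmult has_dzD[OF assms(3)]) auto
    show "(\<lambda>s. s * f (r, \<theta> + s, x)) integrable_on cbox 0 (2 * pi)" for x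
      by (rule integrable_continuous)
        (rule continuous_on_mult[OF _ cont_compose[OF assms(1)]],
          use r in \<open>auto intro!: continuous_intros\<close>)
    show "continuous_on (UNIV \<times> cbox 0 (2 * pi)) (\<lambda>(x, t). t * fz (r, \<theta> + t, x))"
      unfolding case_prod_beta
      by (rule continuous_on_mult[OF _ cont_compose[OF assms(2)]])
        (use r in \<open>auto intro!: continuous_intros\<close>)
  qed auto
  then show "((\<lambda>s. saw f (r, \<theta>, s)) has_real_derivative saw fz (r, \<theta>, z)) (at z)"
    by (simp add: saw_def)
qed

lemma C1_saw:
  assumes f: "C1 f fr ft fz"
  shows "C1 (saw f) (saw fr) (saw ft) (saw fz)"
  unfolding C1_def using C1_D[OF f] by (auto intro: has_dr_saw has_dt_saw has_dz_saw)

end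

section \<open>Integrals along coordinate lines\<close>

text \<open>Cauchy-Schwarz against the constant function 1, read off from a variance: with the mean
  \<open>c\<close>, expand the nonnegative integral of the square of \<open>f - c\<close> and
  multiply by \<open>b - a\<close>.\<close>

lemma integral_square_le:
  fixes f :: "real \<Rightarrow> real"
  assumes "continuous_on {a..b} f" "a \<le> b"
  shows "(integral {a..b} f)\<^sup>2 \<le> (b - a) * integral {a..b} (\<lambda>x. (f x)\<^sup>2)"
proof (cases "a = b")
  case True then show ?thesis by simp
next
  case False
  then have ab: "a < b" using assms by simp
  define c where "c = integral {a..b} f / (b - a)"
  have i: "f integrable_on {a..b}" "(\<lambda>x. (f x)\<^sup>2) integrable_on {a..b}"
    using assms by (auto intro!: integrable_continuous_real continuous_intros)
  have "0 \<le> integral {a..b} (\<lambda>x. (f x - c)\<^sup>2)"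
    by (rule integral_nonneg) (use assms in \<open>auto intro!: integrable_continuous_real continuous_intros\<close>)
  also have "(\<lambda>x. (f x - c)\<^sup>2) = (\<lambda>x. ((f x)\<^sup>2 - 2 * c * f x) + c\<^sup>2)"
    by (auto simp: power2_eq_square algebra_simps)
  also have "integral {a..b} \<dots> = integral {a..b} (\<lambda>x. (f x)\<^sup>2) - 2 * c * integral {a..b} f + c\<^sup>2 * (b - a)"
  proof (rule integral_unique)
    have "((\<lambda>x. c\<^sup>2) has_integral c\<^sup>2 * (b - a)) {a..b}"
      using has_integral_const_real[of "c\<^sup>2" a b] assms(2) by (simp add: mult.commute)
    then show "((\<lambda>x. ((f x)\<^sup>2 - 2 * c * f x) + c\<^sup>2) has_integral
        integral {a..b} (\<lambda>x. (f x)\<^sup>2) - 2 * c * integral {a..b} f + c\<^sup>2 * (b - a)) {a..b}"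
      by (intro has_integral_add has_integral_diff has_integral_mult_right integrable_integral i)
  qed
  finally have "0 \<le> (b - a) * (integral {a..b} (\<lambda>x. (f x)\<^sup>2) - 2 * c * integral {a..b} f + c\<^sup>2 * (b - a))"
    using ab by simp
  also have "\<dots> = (b - a) * integral {a..b} (\<lambda>x. (f x)\<^sup>2) - 2 * (c * (b - a)) * integral {a..b} f + (c * (b - a))\<^sup>2"
    by (simp add: algebra_simps power2_eq_square)
  also have "c * (b - a) = integral {a..b} f" using ab by (simp add: c_def)
  finally show ?thesis by (simp add: power2_eq_square)
qed

text \<open>For a primitive \<open>F\<close> the integral over the shifted period is F(t + p) -
  F(t), and its derivative in t is f(t + p) - f(t) = 0.\<close>

lemma integral_periodic_shift:
  fixes f :: "real \<Rightarrow> real"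
  assumes c: "continuous_on UNIV f" and per: "\<And>x. f (x + p) = f x" and p: "0 \<le> p"
  shows "integral {0..p} (\<lambda>s. f (t + s)) = integral {0..p} f"
proof -
  \<comment> \<open>Large enough that x and x + p lie in the open interval whenever \<bar>x\<bar> <
    \<bar>t\<bar> + 1; there the primitive has a two-sided derivative.\<close>
  define X where "X = \<bar>t\<bar> + p + 1"
  obtain F where F: "\<And>x. x \<in> {-X..X} \<Longrightarrow> (F has_vector_derivative f x) (at x within {-X..X})"
    using antiderivative_continuous[OF continuous_on_subset[OF c subset_UNIV], of "-X" X] by blast
  have FD: "(F has_real_derivative f x) (at x)" if "-X < x" "x < X" for x
    using F[of x] that at_within_Icc_at[of "-X" x X]
    by (simp add: has_real_derivative_iff_has_vector_derivative)
  define h where "h = (\<lambda>x. F (x + p) - F x)"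
  have hD: "(h has_real_derivative 0) (at x)" if "\<bar>x\<bar> < \<bar>t\<bar> + 1" for x
  proof -
    have "((\<lambda>x. F (x + p)) has_real_derivative f (x + p)) (at x)"
      using FD[of "x + p"] that p unfolding X_def by (subst DERIV_shift[symmetric, of F]) (auto simp: add.commute)
    moreover have "(F has_real_derivative f x) (at x)"
      using FD[of x] that p unfolding X_def by auto
    ultimately have "(h has_real_derivative f (x + p) - f x) (at x)"
      unfolding h_def by (rule DERIV_diff)
    then show ?thesis by (simp add: per)
  qed
  have "h t = h 0"
    by (rule DERIV_isconst3[of "-(\<bar>t\<bar>+1)" "\<bar>t\<bar>+1" t 0 h]) (auto intro!: hD)
  have h: "integral {0..p} (\<lambda>s. f (x + s)) = h x" if "\<bar>x\<bar> \<le> \<bar>t\<bar>" for x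
  proof (rule integral_unique)
    have "((\<lambda>s. f (x + s)) has_integral (F (x + p) - F (x + 0))) {0..p}"
    proof (rule fundamental_theorem_of_calculus[OF p, of "\<lambda>s. F (x + s)"])
      fix s assume "s \<in> {0..p}"
      then have "(F has_real_derivative f (x + s)) (at (x + s))"
        using that by (intro FD) (auto simp: X_def)
      then have "((\<lambda>s. F (s + x)) has_real_derivative f (x + s)) (at s)"
        using DERIV_shift[of F "f (x + s)" s x] by (simp add: add.commute)
      then show "((\<lambda>s. F (x + s)) has_vector_derivative f (x + s)) (at s within {0..p})"
        by (simp add: add.commute has_field_derivative_at_within
            has_real_derivative_iff_has_vector_derivative[symmetric])
    qed
    then show "((\<lambda>s. f (x + s)) has_integral h x) {0..p}" by (simp add: h_def)
  qed
  show ?thesis using h[of t] h[of 0] \<open>h t = h 0\<close> by simp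
qed

section \<open>Averages in one variable: shift invariance, square bounds, Poincare
  inequality\<close>

context annulus begin

lemma ang_int_shift:
  assumes "cont f" "per f" "R1 \<le> r" "r \<le> R2"
  shows "integral {0..2*pi} (\<lambda>s. f (r, \<theta> + s, z)) = ang_int f (r, \<theta>', z)"
proof -
  have "integral {0..2*pi} (\<lambda>s. (\<lambda>s. f (r, s, z)) (\<theta> + s)) = integral {0..2*pi} (\<lambda>s. f (r, s, z))"
  proof (rule integral_periodic_shift)
    show "continuous_on UNIV (\<lambda>s. f (r, s, z))"
      by (rule cont_compose[OF assms(1)]) (use assms in \<open>auto intro!: continuous_intros\<close>)
  qed (use assms in \<open>auto simp: per_def theta_periodic_def\<close>)
  then show ?thesis by (simp add: ang_int_def)
qed

lemma line_integrable:
  assumes "cont f"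
  shows "R1 \<le> r \<Longrightarrow> r \<le> R2 \<Longrightarrow> continuous_on A (\<lambda>s. f (r, \<theta> + s, z))"
    and "R1 \<le> r \<Longrightarrow> r \<le> R2 \<Longrightarrow> continuous_on A (\<lambda>s. f (r, s, z))"
    and "R1 \<le> r \<Longrightarrow> r \<le> R2 \<Longrightarrow> continuous_on A (\<lambda>s. f (r, \<theta>, s))"
    and "continuous_on {R1..R2} (\<lambda>s. f (s, \<theta>, z))"
    and "r \<le> R2 \<Longrightarrow> continuous_on {R1..r} (\<lambda>s. f (s, \<theta>, z))"
  by ((rule cont_compose[OF assms(1)]; use assms in \<open>auto intro!: continuous_intros\<close>)+)

text \<open>Integration by parts in the kernel variable s. The boundary value at s = 2\<pi> is
  2\<pi> f by periodicity, the one at s = 0 vanishes, and the remaining integral of \<open>f\<close>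
  over a shifted period does not depend on the shift.\<close>

lemma saw_dt:
  assumes f: "C1 f fr ft fz" and p: "per f" and r: "R1 \<le> r" "r \<le> R2"
  shows "saw ft (r, \<theta>, z) = 2 * pi * f (r, \<theta>, z) - ang_int f (r, \<theta>, z)"
proof -
  note D = C1_D[OF f]
  have "((\<lambda>s. f (r, \<theta> + s, z) + s * ft (r, \<theta> + s, z)) has_integral
      2 * pi * f (r, \<theta> + 2 * pi, z) - 0 * f (r, \<theta> + 0, z)) {0..2*pi}"
  proof (rule fundamental_theorem_of_calculus)
    fix s
    have "((\<lambda>x. f (r, x, z)) has_real_derivative ft (r, \<theta> + s, z)) (at (s + \<theta>))"
      using has_dtD[OF D(6), of r z "\<theta> + s"] r by (simp add: add.commute)
    then have "((\<lambda>s. f (r, \<theta> + s, z)) has_real_derivative ft (r, \<theta> + s, z)) (at s)"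
      by (subst (asm) DERIV_shift) (simp add: add.commute)
    then have "((\<lambda>s. s * f (r, \<theta> + s, z)) has_real_derivative s * ft (r, \<theta> + s, z) + 1 * f (r, \<theta> + s, z)) (at s)"
      by (intro DERIV_mult' DERIV_ident)
    then show "((\<lambda>s. s * f (r, \<theta> + s, z)) has_vector_derivative f (r, \<theta> + s, z) + s * ft (r, \<theta> + s, z)) (at s within {0..2*pi})"
      by (simp add: add.commute has_field_derivative_at_within
            has_real_derivative_iff_has_vector_derivative[symmetric])
  qed simp
  then have "integral {0..2*pi} (\<lambda>s. f (r, \<theta> + s, z) + s * ft (r, \<theta> + s, z)) = 2 * pi * f (r, \<theta>, z)"
    using p r by (simp add: integral_unique per_def theta_periodic_def)
  also have "integral {0..2*pi} (\<lambda>s. f (r, \<theta> + s, z) + s * ft (r, \<theta> + s, z)) =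
     integral {0..2*pi} (\<lambda>s. f (r, \<theta> + s, z)) + integral {0..2*pi} (\<lambda>s. s * ft (r, \<theta> + s, z))"
    by (rule integral_add) (auto intro!: integrable_continuous_real continuous_on_mult continuous_on_id
      line_integrable[OF D(1)] line_integrable[OF D(3)] r)
  also have "integral {0..2*pi} (\<lambda>s. f (r, \<theta> + s, z)) = ang_int f (r, \<theta>, z)"
    by (rule ang_int_shift[OF D(1) p r])
  finally show ?thesis by (simp add: saw_def)
qed

lemma per_saw [intro!]: "per f \<Longrightarrow> per (saw f)"
  unfolding per_def theta_periodic_def saw_def
proof (intro allI impI)
  fix r \<theta> z
  assume *: "\<forall>r \<theta> z. R1 \<le> r \<and> r \<le> R2 \<longrightarrow> f (r, \<theta> + 2 * pi, z) = f (r, \<theta>, z)" "R1 \<le> r \<and> r \<le> R2"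
  have "f (r, \<theta> + 2 * pi + s, z) = f (r, \<theta> + s, z)" for s
    using *(1)[rule_format, of r "\<theta> + s" z] *(2) by (simp add: algebra_simps)
  then show "(case (r, \<theta> + 2 * pi, z) of (r, \<theta>, z) \<Rightarrow> integral {0..2 * pi} (\<lambda>s. s * f (r, \<theta> + s, z))) =
     (case (r, \<theta>, z) of (r, \<theta>, z) \<Rightarrow> integral {0..2 * pi} (\<lambda>s. s * f (r, \<theta> + s, z)))"
    by simp
qed

text \<open>After exchanging the integrals only the mass of the kernel is left, the integral of s
  from 0 to 2\<pi>. Because it is not zero, the angular mean of \<open>f\<close> can be recovered
  from that of its average.\<close>

lemma ang_int_saw:
  assumes f: "cont f" and p: "per f" and r: "R1 \<le> r" "r \<le> R2"
  shows "ang_int (saw f) (r, \<theta>, z) = 2 * pi\<^sup>2 * ang_int f (r, \<theta>, z)"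
proof -
  have "ang_int (saw f) (r, \<theta>, z) =
      integral (cbox 0 (2*pi)) (\<lambda>t. integral (cbox 0 (2*pi)) (\<lambda>s. s * f (r, t + s, z)))"
    by (simp add: ang_int_def saw_def)
  also have "\<dots> = integral (cbox 0 (2*pi)) (\<lambda>s. integral (cbox 0 (2*pi)) (\<lambda>t. s * f (r, t + s, z)))"
  proof (rule integral_swap_continuous)
    show "continuous_on (cbox (0, 0) (2 * pi, 2 * pi)) (\<lambda>(t, s). s * f (r, t + s, z))"
      unfolding case_prod_unfold
      by (rule continuous_on_mult[OF _ cont_compose[OF f]]) (use r in \<open>auto intro!: continuous_intros\<close>)
  qed
  also have "\<dots> = integral {0..2*pi} (\<lambda>s. s * ang_int f (r, \<theta>, z))"
  proof -
    have "integral {0..2*pi} (\<lambda>t. f (r, t + s, z)) = ang_int f (r, \<theta>, z)" for s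
      using ang_int_shift[OF f p r, of s z \<theta>] by (simp add: add.commute)
    then show ?thesis by simp
  qed
  also have "\<dots> = 2 * pi\<^sup>2 * ang_int f (r, \<theta>, z)"
    by (simp add: ident_has_integral[THEN integral_unique] power2_eq_square)
  finally show ?thesis .
qed

lemma rad_int_square_le:
  assumes "cont f" shows "(rad_int f x)\<^sup>2 \<le> (R2 - R1) * rad_int (\<lambda>x. (f x)\<^sup>2) x"
  using integral_square_le[OF line_integrable(4)[OF assms]] R1_less_R2
  by (cases x) (simp add: rad_int_def)

lemma rad_int_nonneg:
  assumes "cont f" "\<And>x. 0 \<le> f x" shows "0 \<le> rad_int f x"
  by (cases x) (auto simp: rad_int_def intro!: integral_nonneg integrable_continuous_real
      line_integrable assms)

lemma ang_int_nonneg: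
  assumes "cont f" "\<And>x. 0 \<le> f x" "x \<in> S" shows "0 \<le> ang_int f x"
  using assms(3)
  by (cases x) (auto simp: ang_int_def S_iff intro!: integral_nonneg integrable_continuous_real
      line_integrable(2)[OF assms(1)] assms(2))

lemma ang_int_mono:
  assumes "cont f" "cont g" "\<And>x. x \<in> S \<Longrightarrow> f x \<le> g x" "x \<in> S" shows "ang_int f x \<le> ang_int g x"
  using assms(4)
  by (cases x) (auto simp: ang_int_def S_iff intro!: integral_le integrable_continuous_real
      line_integrable(2)[OF assms(1)] line_integrable(2)[OF assms(2)] assms(3))

lemma ang_int_cmult: "ang_int (\<lambda>x. c * f x) x = c * ang_int f x"
  by (cases x) (simp add: ang_int_def)

lemma rad_int_cmult: "rad_int (\<lambda>x. c * f x) x = c * rad_int f x"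
  by (cases x) (simp add: rad_int_def)

lemma rad_int_mono:
  assumes "cont f" "cont g" "\<And>x. x \<in> S \<Longrightarrow> f x \<le> g x" shows "rad_int f x \<le> rad_int g x"
  by (cases x) (auto simp: rad_int_def S_iff intro!: integral_le integrable_continuous_real
      line_integrable(4)[OF assms(1)] line_integrable(4)[OF assms(2)] assms(3))

lemma ang_int_square_le:
  assumes "cont f" "x \<in> S" shows "(ang_int f x)\<^sup>2 \<le> 2 * pi * ang_int (\<lambda>x. (f x)\<^sup>2) x"
  using integral_square_le[OF line_integrable(2)[OF assms(1)], of _ 0 "2 * pi"] assms(2)
  by (cases x) (auto simp: ang_int_def S_iff)

lemma rad_prim_square_le:
  assumes f: "cont f" and "x \<in> S"
  shows "(rad_prim f x)\<^sup>2 \<le> (R2 - R1) * rad_int (\<lambda>x. (f x)\<^sup>2) x"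
proof -
  obtain r \<theta> z where x: "x = (r, \<theta>, z)" by (cases x)
  with assms have r: "R1 \<le> r" "r \<le> R2" by (auto simp: S_iff)
  let ?g = "\<lambda>s. (f (s, \<theta>, z))\<^sup>2"
  have c: "continuous_on {R1..R2} ?g" by (intro continuous_intros line_integrable f)
  then have i: "?g integrable_on {R1..R2}" by (rule integrable_continuous_real)
  have "(rad_prim f x)\<^sup>2 \<le> (r - R1) * integral {R1..r} ?g"
    using integral_square_le[OF line_integrable(5)[OF f r(2)]] r by (simp add: rad_prim_def x)
  also have "\<dots> \<le> (R2 - R1) * integral {R1..R2} ?g"
  proof (intro mult_mono integral_subset_le)
    show "?g integrable_on {R1..r}" using i r by (auto intro: integrable_on_subinterval)
    then show "0 \<le> integral {R1..r} ?g" by (rule integral_nonneg) simp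
  qed (use r i R1_less_R2 in auto)
  finally show ?thesis by (simp add: rad_int_def x)
qed

text \<open>Since \<open>f\<close> vanishes at the inner wall it is the radial primitive of
  \<open>fr\<close>, and Cauchy-Schwarz applies. Integrating over the whole gap on the right makes
  the bound uniform in r.\<close>

lemma poincare:
  assumes f: "C1 f fr ft fz" and 0: "\<And>\<theta> z. f (R1, \<theta>, z) = 0" and "x \<in> S"
  shows "(f x)\<^sup>2 \<le> (R2 - R1) * rad_int (\<lambda>x. (fr x)\<^sup>2) x"
proof -
  note D = C1_D[OF f]
  obtain r \<theta> z where x: "x = (r, \<theta>, z)" by (cases x)
  with assms have r: "R1 \<le> r" "r \<le> R2" by (auto simp: S_iff)
  have "((\<lambda>s. fr (s, \<theta>, z)) has_integral f (r, \<theta>, z) - f (R1, \<theta>, z)) {R1..r}"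
    by (rule fundamental_theorem_of_calculus_interior)
      (use r has_drD[OF D(5)] in \<open>auto intro!: line_integrable(5) D
        simp: has_real_derivative_iff_has_vector_derivative[symmetric]\<close>)
  then have "rad_prim fr x = f x"
    by (simp add: rad_prim_def x 0 integral_unique)
  then show ?thesis using rad_prim_square_le[OF D(2) assms(3)] by simp
qed

text \<open>The constant is 2\<pi> from Cauchy-Schwarz times the square of 2\<pi>, the maximum of
  the kernel.\<close>

lemma saw_square_le:
  assumes f: "cont f" and p: "per f" and "x \<in> S"
  shows "(saw f x)\<^sup>2 \<le> 8 * pi ^ 3 * ang_int (\<lambda>x. (f x)\<^sup>2) x"
proof -
  obtain r \<theta> z where x: "x = (r, \<theta>, z)" by (cases x)
  with assms have r: "R1 \<le> r" "r \<le> R2" by (auto simp: S_iff)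
  have c: "continuous_on {0..2*pi} (\<lambda>s. f (r, \<theta> + s, z))" by (intro line_integrable f r)
  have "(saw f x)\<^sup>2 \<le> (2 * pi - 0) * integral {0..2*pi} (\<lambda>s. (s * f (r, \<theta> + s, z))\<^sup>2)"
    unfolding saw_def x prod.case
    by (rule integral_square_le) (auto intro!: continuous_intros c)
  also have "\<dots> \<le> 2 * pi * integral {0..2*pi} (\<lambda>s. (2 * pi)\<^sup>2 * (f (r, \<theta> + s, z))\<^sup>2)"
  proof -
    have "integral {0..2*pi} (\<lambda>s. (s * f (r, \<theta> + s, z))\<^sup>2) \<le> integral {0..2*pi} (\<lambda>s. (2 * pi)\<^sup>2 * (f (r, \<theta> + s, z))\<^sup>2)"
    proof (rule integral_le)
      fix s assume "s \<in> {0..2*pi}"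
      then show "(s * f (r, \<theta> + s, z))\<^sup>2 \<le> (2 * pi)\<^sup>2 * (f (r, \<theta> + s, z))\<^sup>2"
        by (subst power_mult_distrib, intro mult_right_mono power_mono) auto
    qed (auto intro!: continuous_intros integrable_continuous_real c)
    then show ?thesis by simp
  qed
  also have "\<dots> = 8 * pi ^ 3 * integral {0..2*pi} (\<lambda>s. (f (r, \<theta> + s, z))\<^sup>2)"
    by (simp add: power2_eq_square power3_eq_cube)
  also have "integral {0..2*pi} (\<lambda>s. (f (r, \<theta> + s, z))\<^sup>2) = ang_int (\<lambda>x. (f x)\<^sup>2) x"
    unfolding x by (rule ang_int_shift[of "\<lambda>x. (f x)\<^sup>2"])
      (use f p r in \<open>auto simp: per_def theta_periodic_def\<close>)
  finally show ?thesis .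
qed

lemma C1_rad_prim:
  assumes f: "C1 f fr ft fz"
  shows "C1 (rad_prim f) f (rad_prim ft) (rad_prim fz)"
proof (rule C1_I)
  note D = C1_D[OF f]
  show "cont (rad_prim f)" "cont f" "cont (rad_prim ft)" "cont (rad_prim fz)"
    using D by auto
  fix r \<theta> z
  {
    assume r: "R1 < r" "r < R2"
    have "((\<lambda>u. integral {R1..u} (\<lambda>s. f (s, \<theta>, z))) has_real_derivative f (r, \<theta>, z)) (at r within {R1..R2})"
      by (rule integral_has_real_derivative[OF line_integrable(4)[OF D(1)]]) (use r in auto)
    then show "((\<lambda>s. rad_prim f (s, \<theta>, z)) has_real_derivative f (r, \<theta>, z)) (at r)"
      using r by (simp add: rad_prim_def at_within_Icc_at)
  }
  assume r: "R1 \<le> r" "r \<le> R2"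
  have "((\<lambda>\<theta>. integral (cbox R1 r) (\<lambda>s. f (s, \<theta>, z))) has_real_derivative
      integral (cbox R1 r) (\<lambda>s. ft (s, \<theta>, z))) (at \<theta> within UNIV)"
  proof (rule leibniz_rule_field_derivative)
    show "((\<lambda>x. f (t, x, z)) has_real_derivative ft (t, x, z)) (at x within UNIV)"
      if "t \<in> cbox R1 r" for x t
      using has_dtD[OF D(6), of t z x] that r by simp
    show "(\<lambda>s. f (s, x, z)) integrable_on cbox R1 r" for x
      unfolding box_real by (intro integrable_continuous_real line_integrable D r)
    show "continuous_on (UNIV \<times> cbox R1 r) (\<lambda>(x, t). ft (t, x, z))"
      unfolding case_prod_unfold by (rule cont_compose[OF D(3)]) (use r in \<open>auto intro!: continuous_intros\<close>)
  qed auto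
  then show "((\<lambda>s. rad_prim f (r, s, z)) has_real_derivative rad_prim ft (r, \<theta>, z)) (at \<theta>)"
    by (simp add: rad_prim_def)
  have "((\<lambda>z. integral (cbox R1 r) (\<lambda>s. f (s, \<theta>, z))) has_real_derivative
      integral (cbox R1 r) (\<lambda>s. fz (s, \<theta>, z))) (at z within UNIV)"
  proof (rule leibniz_rule_field_derivative)
    show "((\<lambda>x. f (t, \<theta>, x)) has_real_derivative fz (t, \<theta>, x)) (at x within UNIV)"
      if "t \<in> cbox R1 r" for x t
      using has_dzD[OF D(7), of t \<theta> x] that r by simp
    show "(\<lambda>s. f (s, \<theta>, x)) integrable_on cbox R1 r" for x
      unfolding box_real by (intro integrable_continuous_real line_integrable D r)
    show "continuous_on (UNIV \<times> cbox R1 r) (\<lambda>(x, t). fz (t, \<theta>, x))"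
      unfolding case_prod_unfold by (rule cont_compose[OF D(4)]) (use r in \<open>auto intro!: continuous_intros\<close>)
  qed auto
  then show "((\<lambda>s. rad_prim f (r, \<theta>, s)) has_real_derivative rad_prim fz (r, \<theta>, z)) (at z)"
    by (simp add: rad_prim_def)
qed

lemma rad_int_eq: "rad_int f (r, \<theta>, z) = rad_prim f (R2, \<theta>, z)"
  by (simp add: rad_int_def rad_prim_def)

lemma C1_rad_int:
  assumes f: "C1 f fr ft fz"
  shows "C1 (rad_int f) (\<lambda>x. 0) (rad_int ft) (rad_int fz)"
proof (rule C1_I)
  note D = C1_D[OF f] and P = C1_D[OF C1_rad_prim[OF f]]
  show "cont (rad_int f)" "cont (\<lambda>x. 0)" "cont (rad_int ft)" "cont (rad_int fz)"
    using D by auto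
  fix r \<theta> z
  show "((\<lambda>s. rad_int f (s, \<theta>, z)) has_real_derivative 0) (at r)"
    by (simp add: rad_int_def)
  show "((\<lambda>s. rad_int f (r, s, z)) has_real_derivative rad_int ft (r, \<theta>, z)) (at \<theta>)"
    using has_dtD[OF P(6), of R2] R1_less_R2 by (simp add: rad_int_eq)
  show "((\<lambda>s. rad_int f (r, \<theta>, s)) has_real_derivative rad_int fz (r, \<theta>, z)) (at z)"
    using has_dzD[OF P(7), of R2] R1_less_R2 by (simp add: rad_int_eq)
qed

lemma ang_int_has_dz:
  assumes f: "C1 f fr ft fz"
  shows "has_dz (ang_int f) (ang_int fz)"
  unfolding has_dz_def
proof (intro allI impI)
  note D = C1_D[OF f]
  fix r \<theta> z assume r: "R1 \<le> r \<and> r \<le> R2"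
  have "((\<lambda>z. integral (cbox 0 (2*pi)) (\<lambda>s. f (r, s, z))) has_real_derivative
      integral (cbox 0 (2*pi)) (\<lambda>s. fz (r, s, z))) (at z within UNIV)"
  proof (rule leibniz_rule_field_derivative)
    show "((\<lambda>x. f (r, t, x)) has_real_derivative fz (r, t, x)) (at x within UNIV)" for x t
      using has_dzD[OF D(7), of r t x] r by simp
    show "(\<lambda>s. f (r, s, x)) integrable_on cbox 0 (2*pi)" for x
      unfolding box_real using r by (intro integrable_continuous_real line_integrable D) auto
    show "continuous_on (UNIV \<times> cbox 0 (2*pi)) (\<lambda>(x, t). fz (r, t, x))"
      unfolding case_prod_unfold by (rule cont_compose[OF D(4)]) (use r in \<open>auto intro!: continuous_intros\<close>)
  qed auto
  then show "((\<lambda>s. ang_int f (r, \<theta>, s)) has_real_derivative ang_int fz (r, \<theta>, z)) (at z)"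
    by (simp add: ang_int_def)
qed

lemma ang_int_dt_zero:
  assumes f: "has_dt f ft" and p: "per f" and r: "R1 \<le> r" "r \<le> R2"
  shows "ang_int ft (r, \<theta>, z) = 0"
proof -
  have "((\<lambda>s. ft (r, s, z)) has_integral f (r, 2 * pi, z) - f (r, 0, z)) {0..2*pi}"
  proof (rule fundamental_theorem_of_calculus)
    show "((\<lambda>s. f (r, s, z)) has_vector_derivative ft (r, s, z)) (at s within {0..2*pi})" for s
      using has_dtD[OF f r, of z s]
      by (simp add: has_field_derivative_at_within has_real_derivative_iff_has_vector_derivative[symmetric])
  qed simp
  moreover have "f (r, 2 * pi, z) = f (r, 0, z)"
    using p r unfolding per_def theta_periodic_def by (metis add_0)
  ultimately show ?thesis by (simp add: ang_int_def integral_unique)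
qed


section \<open>Integration by parts\<close>

text \<open>The measure is dr d\<theta> dz: the factor r of the volume element is written into the
  integrands where it is wanted. \<open>N\<close> is the axial half-length, eventually sent to
  infinity.\<close>

definition bint :: "real \<Rightarrow> (cyl \<Rightarrow> real) \<Rightarrow> real" where
  "bint N f = integral (cbox (R1, 0, -N) (R2, 2*pi, N)) f"

lemma cbox_subset_S: "cbox (R1, 0, -N) (R2, 2*pi, N) \<subseteq> S"
  by (auto simp: closed_slab_def cbox_Pair_eq)

lemma cont_integrable: "cont f \<Longrightarrow> f integrable_on cbox (R1, 0, -N) (R2, 2*pi, N)"
  unfolding cont_def by (intro integrable_continuous continuous_on_subset[OF _ cbox_subset_S])

lemma bint_iter:
  assumes "cont f"
  shows "bint N f = integral {R1..R2} (\<lambda>r. integral (cbox (0, -N) (2*pi, N)) (\<lambda>y. f (r, y)))"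
  using integral_prod_continuous[of R1 "(0, -N)" R2 "(2*pi, N)" f]
    continuous_on_subset[OF assms[unfolded cont_def] cbox_subset_S]
  by (simp add: bint_def)

text \<open>There is one iterated form for each variable (\<open>bint_rad\<close>,
  \<open>bint_ang\<close>, \<open>bint_axial\<close>), with that variable innermost, so that an
  exact derivative integrates to boundary values in \<open>bint_dr_zero\<close>,
  \<open>bint_dt_zero\<close> and \<open>bint_dz_zero\<close>.\<close>

lemma bint_rad:
  assumes f: "cont f"
  shows "bint N f = integral (cbox (0, -N) (2*pi, N)) (\<lambda>y. rad_int f (r, y))"
proof -
  have "bint N f = integral (cbox R1 R2) (\<lambda>r. integral (cbox (0, -N) (2*pi, N)) (\<lambda>y. f (r, y)))"
    using bint_iter[OF f] by simp
  also have "\<dots> = integral (cbox (0, -N) (2*pi, N)) (\<lambda>y. integral (cbox R1 R2) (\<lambda>r. f (r, y)))"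
    by (rule integral_swap_continuous)
      (use continuous_on_subset[OF f[unfolded cont_def] cbox_subset_S] in simp)
  finally show ?thesis by (simp add: rad_int_def case_prod_unfold)
qed

lemma continuous_section:
  assumes "cont f" "R1 \<le> r" "r \<le> R2"
  shows "continuous_on A (\<lambda>y. f (r, y))"
proof -
  have "continuous_on A (\<lambda>y. f (r, fst y, snd y))"
    by (rule cont_compose[OF assms(1)]) (use assms in \<open>auto intro!: continuous_intros\<close>)
  then show ?thesis by simp
qed

lemma bint_ang:
  assumes f: "cont f"
  shows "bint N f = integral {R1..R2} (\<lambda>r. integral {-N..N} (\<lambda>z. ang_int f (r, \<theta>, z)))"
  unfolding bint_iter[OF f]
proof (rule integral_cong)
  fix r assume r: "r \<in> {R1..R2}"
  have c: "continuous_on (cbox (0, -N) (2 * pi, N)) (\<lambda>y. f (r, y))"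
    by (rule continuous_section[OF f]) (use r in auto)
  have "integral (cbox (0, -N) (2*pi, N)) (\<lambda>y. f (r, y)) =
      integral (cbox 0 (2*pi)) (\<lambda>t. integral (cbox (-N) N) (\<lambda>z. f (r, t, z)))"
    using integral_prod_continuous[OF c] by simp
  also have "\<dots> = integral (cbox (-N) N) (\<lambda>z. integral (cbox 0 (2*pi)) (\<lambda>t. f (r, t, z)))"
    by (rule integral_swap_continuous) (use c in simp)
  finally show "integral (cbox (0, -N) (2*pi, N)) (\<lambda>y. f (r, y)) = integral {-N..N} (\<lambda>z. ang_int f (r, \<theta>, z))"
    by (simp add: ang_int_def)
qed

lemma bint_axial:
  assumes f: "cont f"
  shows "bint N f = integral {R1..R2} (\<lambda>r. integral {0..2*pi} (\<lambda>\<theta>. integral {-N..N} (\<lambda>z. f (r, \<theta>, z))))"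
  unfolding bint_iter[OF f]
proof (rule integral_cong)
  fix r assume r: "r \<in> {R1..R2}"
  have c: "continuous_on (cbox (0, -N) (2 * pi, N)) (\<lambda>y. f (r, y))"
    by (rule continuous_section[OF f]) (use r in auto)
  show "integral (cbox (0, -N) (2*pi, N)) (\<lambda>y. f (r, y)) =
      integral {0..2*pi} (\<lambda>t. integral {-N..N} (\<lambda>z. f (r, t, z)))"
    using integral_prod_continuous[OF c] by simp
qed

lemma bint_add: "cont f \<Longrightarrow> cont g \<Longrightarrow> bint N (\<lambda>x. f x + g x) = bint N f + bint N g"
  unfolding bint_def by (intro integral_add cont_integrable)

lemma bint_diff: "cont f \<Longrightarrow> cont g \<Longrightarrow> bint N (\<lambda>x. f x - g x) = bint N f - bint N g"
  unfolding bint_def by (intro integral_diff cont_integrable)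

lemma bint_cmult: "bint N (\<lambda>x. c * f x) = c * bint N f"
  by (simp add: bint_def)

lemma bint_mono:
  "cont f \<Longrightarrow> cont g \<Longrightarrow>
   (\<And>r \<theta> z. R1 \<le> r \<Longrightarrow> r \<le> R2 \<Longrightarrow> -N \<le> z \<Longrightarrow> z \<le> N \<Longrightarrow> f (r, \<theta>, z) \<le> g (r, \<theta>, z)) \<Longrightarrow>
   bint N f \<le> bint N g"
  unfolding bint_def by (intro integral_le cont_integrable) (auto simp: cbox_Pair_eq)

lemma bint_cong:
  "(\<And>r \<theta> z. R1 \<le> r \<Longrightarrow> r \<le> R2 \<Longrightarrow> f (r, \<theta>, z) = g (r, \<theta>, z)) \<Longrightarrow> bint N f = bint N g"
  unfolding bint_def by (intro integral_cong) (auto simp: cbox_Pair_eq)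

lemma bint_nonneg:
  "cont f \<Longrightarrow> (\<And>x. 0 \<le> f x) \<Longrightarrow> 0 \<le> bint N f"
  unfolding bint_def by (intro integral_nonneg cont_integrable) auto

lemma bint_mono_domain:
  assumes "cont f" "\<And>x. 0 \<le> f x" "M \<le> N" shows "bint M f \<le> bint N f"
  unfolding bint_def using assms
  by (intro integral_subset_le cont_integrable) (auto simp: cbox_Pair_eq)

lemma bint_const: "0 \<le> N \<Longrightarrow> bint N (\<lambda>x. c) = 4 * pi * (R2 - R1) * N * c"
  using R1_less_R2 by (simp add: bint_def content_Pair)

lemma bint_eq_0D:
  assumes "cont f" "\<And>x. 0 \<le> f x" "bint N f = 0" "0 < N"
    and "R1 \<le> r" "r \<le> R2" "0 \<le> \<theta>" "\<theta> \<le> 2*pi" "-N \<le> z" "z \<le> N"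
  shows "f (r, \<theta>, z) = 0"
proof -
  have "\<forall>x\<in>cbox (R1, 0, -N) (R2, 2*pi, N). f x = 0"
  proof (subst integral_cbox_eq_0_iff[symmetric])
    show "continuous_on (cbox (R1, 0, -N) (R2, 2*pi, N)) f"
      using assms(1) continuous_on_subset[OF _ cbox_subset_S] by (auto simp: cont_def)
    have "((R1+R2)/2, pi, 0) \<in> box (R1, 0, -N) (R2, 2*pi, N)"
      using R1_less_R2 assms(4) by (auto simp: mem_box Basis_prod_def)
    then show "box (R1, 0, -N) (R2, 2*pi, N) \<noteq> {}" by blast
  qed (use assms in \<open>auto simp: bint_def\<close>)
  then show ?thesis using assms by (auto simp: cbox_Pair_eq)
qed

lemma bint_rad_int:
  assumes f: "cont f" shows "bint N (rad_int f) = (R2 - R1) * bint N f"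
proof -
  have "bint N (rad_int f) = integral {R1..R2} (\<lambda>r. integral (cbox (0, -N) (2*pi, N)) (\<lambda>y. rad_int f (r, y)))"
    by (rule bint_iter) (use f in auto)
  also have "\<dots> = integral {R1..R2} (\<lambda>r. bint N f)"
    using bint_rad[OF f] by simp
  finally show ?thesis using R1_less_R2 by simp
qed

lemma bint_ang_int:
  assumes f: "cont f" shows "bint N (ang_int f) = 2 * pi * bint N f"
proof -
  have a: "ang_int (ang_int f) = (\<lambda>x. 2 * pi * ang_int f x)"
    by (auto simp: ang_int_def fun_eq_iff)
  have "bint N (ang_int f) = integral {R1..R2} (\<lambda>r. integral {-N..N} (\<lambda>z. ang_int (ang_int f) (r, 0, z)))"
    by (rule bint_ang) (use f in auto)
  also have "\<dots> = 2 * pi * bint N f"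
    using bint_ang[OF f, of N 0] by (simp add: a)
  finally show ?thesis .
qed

lemma bint_dr_zero:
  assumes "cont X" "cont X'" "has_dr X X'" "\<And>\<theta> z. X (R1, \<theta>, z) = 0" "\<And>\<theta> z. X (R2, \<theta>, z) = 0"
  shows "bint N X' = 0"
proof -
  have "rad_int X' (r, \<theta>, z) = 0" for r \<theta> z
  proof -
    have "((\<lambda>s. X' (s, \<theta>, z)) has_integral X (R2, \<theta>, z) - X (R1, \<theta>, z)) {R1..R2}"
      by (rule fundamental_theorem_of_calculus_interior)
        (use R1_less_R2 has_drD[OF assms(3)] in \<open>auto intro!: line_integrable(4) assms
          simp: has_real_derivative_iff_has_vector_derivative[symmetric]\<close>)
    then show ?thesis using assms by (simp add: rad_int_def integral_unique)
  qed
  then have "rad_int X' (0, y) = 0" for y by (cases y) simp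
  then show ?thesis using bint_rad[OF assms(2), of N 0] by simp
qed

lemma bint_dt_zero:
  assumes "cont X'" "has_dt X X'" "per X"
  shows "bint N X' = 0"
proof -
  have "bint N X' = integral {R1..R2} (\<lambda>r. integral {-N..N} (\<lambda>z. ang_int X' (r, 0, z)))"
    by (rule bint_ang[OF assms(1)])
  also have "\<dots> = integral {R1..R2} (\<lambda>r. 0)"
    by (rule integral_cong) (simp add: ang_int_dt_zero[OF assms(2,3)])
  finally show ?thesis by simp
qed

lemma bint_dz_zero:
  assumes "cont X'" "has_dz X X'" "0 \<le> N"
    and "\<And>r \<theta>. X (r, \<theta>, N) = 0" "\<And>r \<theta>. X (r, \<theta>, - N) = 0"
  shows "bint N X' = 0"
proof -
  have "bint N X' = integral {R1..R2} (\<lambda>r. integral {0..2*pi} (\<lambda>\<theta>. integral {-N..N} (\<lambda>z. X' (r, \<theta>, z))))"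
    by (rule bint_axial[OF assms(1)])
  also have "\<dots> = integral {R1..R2} (\<lambda>r. 0)"
  proof (rule integral_cong)
    fix r assume r: "r \<in> {R1..R2}"
    have "((\<lambda>s. X' (r, \<theta>, s)) has_integral X (r, \<theta>, N) - X (r, \<theta>, -N)) {-N..N}" for \<theta>
    proof (rule fundamental_theorem_of_calculus)
      show "((\<lambda>s. X (r, \<theta>, s)) has_vector_derivative X' (r, \<theta>, s)) (at s within {-N..N})" for s
        using has_dzD[OF assms(2), of r \<theta> s] r
        by (simp add: has_field_derivative_at_within has_real_derivative_iff_has_vector_derivative[symmetric])
    qed (use assms in simp)
    then have "integral {-N..N} (\<lambda>z. X' (r, \<theta>, z)) = 0" for \<theta>
      using assms(4,5) integral_unique by fastforce
    then show "integral {0..2*pi} (\<lambda>\<theta>. integral {-N..N} (\<lambda>z. X' (r, \<theta>, z))) = 0"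
      by simp
  qed
  finally show ?thesis by simp
qed

lemma rad_int_axial_mult: "rad_int (\<lambda>x. g (snd (snd x)) * f x) x = g (snd (snd x)) * rad_int f x"
  by (cases x) (simp add: rad_int_def)

lemma ang_int_axial_mult: "ang_int (\<lambda>x. g (snd (snd x)) * f x) x = g (snd (snd x)) * ang_int f x"
  by (cases x) (simp add: ang_int_def)

text \<open>The components of a field refer to the frame \<open>e\<^sub>r, e\<^sub>\<theta>, e\<^sub>z\<close>. Entry \<open>3 j + i\<close> of a tensor is the
  \<open>i\<close>-th component in direction \<open>j\<close>; the undifferentiated terms for \<open>j = 1\<close> come from the rotation of
  the frame.\<close>

definition grad :: "field \<Rightarrow> field \<Rightarrow> field \<Rightarrow> field \<Rightarrow> nat \<Rightarrow> cyl \<Rightarrow> real" where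
  "grad w wr wt wz k x =
     (if k < 3 then wr k x
      else if k = 3 then (wt 0 x - w 1 x) / fst x
      else if k = 4 then (wt 1 x + w 0 x) / fst x
      else if k = 5 then wt 2 x / fst x
      else wz (k - 6) x)"

text \<open>\<open>DM k\<close> is the derivative of entry \<open>k\<close> in its own direction
  \<open>k div 3\<close>, the only derivative of it that a divergence contains. The three equations
  are r times the components of the divergence: the summands \<open>M 0\<close>, \<open>M 1\<close>,
  \<open>M 2\<close> come from differentiating r M, and \<open>- M 4\<close>, \<open>M 3\<close>
  from the rotation of the frame.\<close>

definition divfree :: "field \<Rightarrow> field \<Rightarrow> bool" where
  "divfree M DM \<longleftrightarrow>
     (\<forall>k<9. cont (M k) \<and> cont (DM k) \<and> per (M k)) \<and>
     (\<forall>k<3. has_dr (M k) (DM k)) \<and>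
     (\<forall>k\<in>{3,4,5}. has_dt (M k) (DM k)) \<and>
     (\<forall>k\<in>{6,7,8}. has_dz (M k) (DM k)) \<and>
     (\<forall>r \<theta> z. R1 \<le> r \<and> r \<le> R2 \<longrightarrow> (let x = (r, \<theta>, z) in
        r * DM 0 x + M 0 x + DM 3 x - M 4 x + r * DM 6 x = 0 \<and>
        r * DM 1 x + M 1 x + DM 4 x + M 3 x + r * DM 7 x = 0 \<and>
        r * DM 2 x + M 2 x + DM 5 x + r * DM 8 x = 0))"

definition vfield :: "field \<Rightarrow> field \<Rightarrow> field \<Rightarrow> field \<Rightarrow> bool" where
  "vfield w wr wt wz \<longleftrightarrow>
     (\<forall>i<3. C1 (w i) (wr i) (wt i) (wz i) \<and> per (w i) \<and>
       (\<forall>\<theta> z. w i (R1, \<theta>, z) = 0 \<and> w i (R2, \<theta>, z) = 0))"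

definition solenoidal :: "field \<Rightarrow> field \<Rightarrow> field \<Rightarrow> field \<Rightarrow> bool" where
  "solenoidal w wr wt wz \<longleftrightarrow>
     (\<forall>r \<theta> z. R1 \<le> r \<and> r \<le> R2 \<longrightarrow> (let x = (r, \<theta>, z) in wr 0 x + (wt 1 x + w 0 x) / r + wz 2 x = 0))"

section \<open>Divergence theorem for tensors in the moving frame\<close>

lemma sum_lt_9: "(\<Sum>k<9. f k) = f 0 + f 1 + f 2 + f 3 + f 4 + f 5 + f 6 + f 7 + (f (8::nat) :: real)"
  by (simp add: eval_nat_numeral)

lemma sum_lt_3: "(\<Sum>k<3. f k) = f 0 + f 1 + (f (2::nat) :: real)"
  by (simp add: eval_nat_numeral)

lemma per_mult: "per f \<Longrightarrow> per g \<Longrightarrow> per (\<lambda>x. f x * g x)"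
  by (simp add: per_def theta_periodic_def)

lemma cont_grad:
  assumes "vfield w wr wt wz" "k < 9" shows "cont (grad w wr wt wz k)"
proof -
  have v: "cont (w i)" "cont (wr i)" "cont (wt i)" "cont (wz i)" if "i < 3" for i
    using assms that by (auto simp: vfield_def C1_def)
  consider "k < 3" | "k = 3" | "k = 4" | "k = 5" | "k \<ge> 6" by linarith
  then show ?thesis
  proof cases
    case 1
    then have "grad w wr wt wz k = wr k" by (auto simp: grad_def)
    then show ?thesis using v 1 by simp
  next
    case 2
    then have "grad w wr wt wz k = (\<lambda>x. (wt 0 x - w 1 x) / fst x)" by (auto simp: grad_def)
    then show ?thesis using v by auto
  next
    case 3
    then have "grad w wr wt wz k = (\<lambda>x. (wt 1 x + w 0 x) / fst x)" by (auto simp: grad_def)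
    then show ?thesis using v by auto
  next
    case 4
    then have "grad w wr wt wz k = (\<lambda>x. wt 2 x / fst x)" by (auto simp: grad_def)
    then show ?thesis using v by auto
  next
    case 5
    then have "grad w wr wt wz k = wz (k - 6)" by (auto simp: grad_def)
    then show ?thesis using v[of "k - 6"] assms 5 by simp
  qed
qed

text \<open>The frame terms in the divergence of \<open>M\<close> are adjoint to those in
  \<open>grad \<psi>\<close>, so r times the contraction of the two is a sum of exact derivatives.
  Their boundary terms vanish at the walls, by periodicity in \<theta>, and at z =
  \<plusminus>N.\<close>

lemma weak_form:
  assumes M: "divfree M DM" and \<psi>: "vfield \<psi> \<psi>r \<psi>t \<psi>z" and N: "0 \<le> N"
    and ends: "\<And>i r \<theta>. i < 3 \<Longrightarrow> \<psi> i (r, \<theta>, N) = 0 \<and> \<psi> i (r, \<theta>, -N) = 0"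
  shows "bint N (\<lambda>x. fst x * (\<Sum>k<9. M k x * grad \<psi> \<psi>r \<psi>t \<psi>z k x)) = 0"
proof -
  have cM: "cont (M k)" "cont (DM k)" "per (M k)" if "k < 9" for k
    using M that by (auto simp: divfree_def)
  have c\<psi>: "cont (\<psi> i)" "cont (\<psi>r i)" "cont (\<psi>t i)" "cont (\<psi>z i)"
      "has_dr (\<psi> i) (\<psi>r i)" "has_dt (\<psi> i) (\<psi>t i)" "has_dz (\<psi> i) (\<psi>z i)" "per (\<psi> i)" if "i < 3" for i
    using \<psi> that by (auto simp: vfield_def C1_def)
  have bc: "\<psi> i (R1, \<theta>, z) = 0" "\<psi> i (R2, \<theta>, z) = 0" if "i < 3" for i \<theta> z
    using \<psi> that by (auto simp: vfield_def)
  have Mr: "has_dr (M k) (DM k)" if "k < 3" for k using M that by (auto simp: divfree_def)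
  have Mt: "has_dt (M (k + 3)) (DM (k + 3))" if "k < 3" for k
  proof -
    have "k + 3 = 3 \<or> k + 3 = 4 \<or> k + 3 = 5" using that by auto
    then show ?thesis using M unfolding divfree_def by blast
  qed
  have Mz: "has_dz (M (k + 6)) (DM (k + 6))" if "k < 3" for k
  proof -
    have "k + 6 = 6 \<or> k + 6 = 7 \<or> k + 6 = 8" using that by auto
    then show ?thesis using M unfolding divfree_def by blast
  qed
  \<comment> \<open>\<open>X'\<close>, \<open>Y'\<close> and \<open>Z'\<close> are the derivatives
    in r, \<theta> and z of the flux of component k. The angular flux carries no factor r, because r
    cancels against the 1 / r in front of the angular derivative; the extra summand in
    \<open>X'\<close> comes from differentiating r.\<close>
  define X where "X = (\<lambda>k x. fst x * (M k x * \<psi> k x))"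
  define X' where "X' = (\<lambda>k x. fst x * (M k x * \<psi>r k x + DM k x * \<psi> k x) + 1 * (M k x * \<psi> k x))"
  define Y' where "Y' = (\<lambda>k x. M (k + 3) x * \<psi>t k x + DM (k + 3) x * \<psi> k x)"
  define Z' where "Z' = (\<lambda>k x. fst x * (M (k + 6) x * \<psi>z k x + DM (k + 6) x * \<psi> k x))"
  have cont': "cont (X k)" "cont (X' k)" "cont (Y' k)" "cont (Z' k)" if "k < 3" for k
  proof -
    have "k < 9" "k + 3 < 9" "k + 6 < 9" using that by auto
    note c = cM(1,2)[OF this(1)] cM(1,2)[OF this(2)] cM(1,2)[OF this(3)] c\<psi>(1-4)[OF that]
    show "cont (X k)" "cont (X' k)" "cont (Y' k)" "cont (Z' k)"
      unfolding X_def X'_def Y'_def Z'_def by (intro cont_add cont_mult cont_r cont_const c)+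
  qed
  have x: "bint N (X' k) = 0" if "k < 3" for k
  proof (rule bint_dr_zero[of "X k"])
    show "has_dr (X k) (X' k)"
      unfolding has_dr_def
    proof (intro allI impI)
      fix r \<theta> z assume r: "R1 < r \<and> r < R2"
      have "((\<lambda>s. M k (s, \<theta>, z)) has_real_derivative DM k (r, \<theta>, z)) (at r)"
        "((\<lambda>s. \<psi> k (s, \<theta>, z)) has_real_derivative \<psi>r k (r, \<theta>, z)) (at r)"
        using has_drD[OF Mr[OF that]] has_drD[OF c\<psi>(5)[OF that]] r by auto
      then show "((\<lambda>s. X k (s, \<theta>, z)) has_real_derivative X' k (r, \<theta>, z)) (at r)"
        unfolding X_def X'_def fst_conv by (intro DERIV_mult' DERIV_ident)
    qed
    show "cont (X k)" "cont (X' k)" by (rule cont'[OF that])+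
  qed (use that in \<open>auto simp: X_def bc\<close>)
  have y: "bint N (Y' k) = 0" if "k < 3" for k
  proof (rule bint_dt_zero[of _ "\<lambda>x. M (k + 3) x * \<psi> k x"])
    show "has_dt (\<lambda>x. M (k + 3) x * \<psi> k x) (Y' k)"
      unfolding has_dt_def
    proof (intro allI impI)
      fix r \<theta> z assume r: "R1 \<le> r \<and> r \<le> R2"
      have "((\<lambda>s. M (k+3) (r, s, z)) has_real_derivative DM (k+3) (r, \<theta>, z)) (at \<theta>)"
        "((\<lambda>s. \<psi> k (r, s, z)) has_real_derivative \<psi>t k (r, \<theta>, z)) (at \<theta>)"
        using has_dtD[OF Mt[OF that]] has_dtD[OF c\<psi>(6)[OF that]] r by auto
      then show "((\<lambda>s. M (k + 3) (r, s, z) * \<psi> k (r, s, z)) has_real_derivative Y' k (r, \<theta>, z)) (at \<theta>)"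
        unfolding Y'_def by (rule DERIV_mult')
    qed
    show "per (\<lambda>x. M (k + 3) x * \<psi> k x)"
      using that by (intro per_mult cM c\<psi>) auto
  qed (use that in \<open>auto intro!: cont'\<close>)
  have z: "bint N (Z' k) = 0" if "k < 3" for k
  proof (rule bint_dz_zero[of _ "\<lambda>x. fst x * (M (k + 6) x * \<psi> k x)"])
    show "has_dz (\<lambda>x. fst x * (M (k + 6) x * \<psi> k x)) (Z' k)"
      unfolding has_dz_def
    proof (intro allI impI)
      fix r \<theta> z assume r: "R1 \<le> r \<and> r \<le> R2"
      have "((\<lambda>s. M (k+6) (r, \<theta>, s)) has_real_derivative DM (k+6) (r, \<theta>, z)) (at z)"
        "((\<lambda>s. \<psi> k (r, \<theta>, s)) has_real_derivative \<psi>z k (r, \<theta>, z)) (at z)"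
        using has_dzD[OF Mz[OF that]] has_dzD[OF c\<psi>(7)[OF that]] r by auto
      then show "((\<lambda>s. fst (r, \<theta>, s) * (M (k + 6) (r, \<theta>, s) * \<psi> k (r, \<theta>, s))) has_real_derivative Z' k (r, \<theta>, z)) (at z)"
        unfolding Z'_def fst_conv by (intro DERIV_cmult DERIV_mult')
    qed
  qed (use that N ends in \<open>auto intro!: cont'\<close>)
  have "bint N (\<lambda>x. X' 0 x + X' 1 x + X' 2 x + (Y' 0 x + Y' 1 x + Y' 2 x) + (Z' 0 x + Z' 1 x + Z' 2 x)) = 0"
    using x[of 0] x[of 1] x[of 2] y[of 0] y[of 1] y[of 2] z[of 0] z[of 1] z[of 2]
    by (simp add: bint_add cont' cont_add)
  moreover have "bint N (\<lambda>x. X' 0 x + X' 1 x + X' 2 x + (Y' 0 x + Y' 1 x + Y' 2 x) + (Z' 0 x + Z' 1 x + Z' 2 x)) =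
     bint N (\<lambda>x. fst x * (\<Sum>k<9. M k x * grad \<psi> \<psi>r \<psi>t \<psi>z k x))"
  proof (rule bint_cong)
    fix r \<theta> z :: real assume r: "R1 \<le> r" "r \<le> R2"
    define x where "x = (r, \<theta>, z)"
    have eqs: "r * DM 0 x + M 0 x + DM 3 x - M 4 x + r * DM 6 x = 0"
        "r * DM 1 x + M 1 x + DM 4 x + M 3 x + r * DM 7 x = 0"
        "r * DM 2 x + M 2 x + DM 5 x + r * DM 8 x = 0"
      using M r unfolding divfree_def x_def Let_def by blast+
    have r0: "r \<noteq> 0" using r R1_pos by simp
    have fx: "fst x = r" by (simp add: x_def)
    \<comment> \<open>Regrouping: what remains besides the contraction with the gradient is each
      divergence equation multiplied by the matching component of \<psi>, hence zero.\<close>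
    have "X' 0 x + X' 1 x + X' 2 x + (Y' 0 x + Y' 1 x + Y' 2 x) + (Z' 0 x + Z' 1 x + Z' 2 x) =
      r * (M 0 x * \<psi>r 0 x + M 1 x * \<psi>r 1 x + M 2 x * \<psi>r 2 x) +
      (M 3 x * (\<psi>t 0 x - \<psi> 1 x) + M 4 x * (\<psi>t 1 x + \<psi> 0 x) + M 5 x * \<psi>t 2 x) +
      r * (M 6 x * \<psi>z 0 x + M 7 x * \<psi>z 1 x + M 8 x * \<psi>z 2 x) +
      (r * DM 0 x + M 0 x + DM 3 x - M 4 x + r * DM 6 x) * \<psi> 0 x +
      (r * DM 1 x + M 1 x + DM 4 x + M 3 x + r * DM 7 x) * \<psi> 1 x +
      (r * DM 2 x + M 2 x + DM 5 x + r * DM 8 x) * \<psi> 2 x"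
      unfolding X'_def Y'_def Z'_def fx by (simp add: algebra_simps)
    also have "\<dots> = fst x * (\<Sum>k<9. M k x * grad \<psi> \<psi>r \<psi>t \<psi>z k x)"
      unfolding eqs fx sum_lt_9 using r0 by (simp add: grad_def fx field_simps)
    finally show "X' 0 x + X' 1 x + X' 2 x + (Y' 0 x + Y' 1 x + Y' 2 x) + (Z' 0 x + Z' 1 x + Z' 2 x) =
        fst x * (\<Sum>k<9. M k x * grad \<psi> \<psi>r \<psi>t \<psi>z k x)" .
  qed
  ultimately show ?thesis by simp
qed

section \<open>Sawtooth averages of divergence-free tensors\<close>

lemma saw_add:
  assumes "cont f" "cont g" "x \<in> S" shows "saw (\<lambda>x. f x + g x) x = saw f x + saw g x"
proof -
  obtain r \<theta> z where x: "x = (r, \<theta>, z)" by (cases x)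
  with assms have r: "R1 \<le> r" "r \<le> R2" by (auto simp: S_iff)
  show ?thesis
    unfolding x saw_def prod.case distrib_left
    by (intro integral_add integrable_continuous_real continuous_on_mult continuous_on_id line_integrable assms r)
qed

lemma saw_rmult: "saw (\<lambda>x. g (fst x) * f x) x = g (fst x) * saw f x"
proof (cases x)
  case (fields r \<theta> z)
  have "(\<lambda>s. s * (g r * f (r, \<theta> + s, z))) = (\<lambda>s. g r * (s * f (r, \<theta> + s, z)))"
    by (auto simp: mult_ac)
  then show ?thesis by (simp add: fields saw_def)
qed

lemma saw_uminus: "saw (\<lambda>x. - f x) x = - saw f x"
  using saw_rmult[of "\<lambda>_. -1" f] by simp

lemma saw_cmult: "saw (\<lambda>x. c * f x) x = c * saw f x"
  using saw_rmult[of "\<lambda>_. c" f] by simp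

lemma saw_diff:
  assumes "cont f" "cont g" "x \<in> S" shows "saw (\<lambda>x. f x - g x) x = saw f x - saw g x"
  using saw_add[of f "\<lambda>x. - g x"] assms by (simp add: saw_uminus cont_uminus)

lemma saw_zero:
  assumes "\<And>x. x \<in> S \<Longrightarrow> f x = 0" "x \<in> S" shows "saw f x = 0"
  using assms by (cases x) (simp add: saw_def S_iff)

text \<open>All coefficients of the equations depend on r alone, so they pass through an average in
  \<theta>, as do the derivatives.\<close>

lemma divfree_saw:
  assumes M: "divfree M DM"
  shows "divfree (\<lambda>k. saw (M k)) (\<lambda>k. saw (DM k))"
proof -
  have cM: "cont (M k)" "cont (DM k)" "per (M k)" if "k < 9" for k
    using M that by (auto simp: divfree_def)
  have eqs: "fst x * DM 0 x + M 0 x + DM 3 x - M 4 x + fst x * DM 6 x = 0"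
        "fst x * DM 1 x + M 1 x + DM 4 x + M 3 x + fst x * DM 7 x = 0"
        "fst x * DM 2 x + M 2 x + DM 5 x + fst x * DM 8 x = 0" if "x \<in> S" for x :: cyl
    using M that by (cases x; auto simp: divfree_def S_iff Let_def)+
  have "fst x * saw (DM 0) x + saw (M 0) x + saw (DM 3) x - saw (M 4) x + fst x * saw (DM 6) x = 0"
    "fst x * saw (DM 1) x + saw (M 1) x + saw (DM 4) x + saw (M 3) x + fst x * saw (DM 7) x = 0"
    "fst x * saw (DM 2) x + saw (M 2) x + saw (DM 5) x + fst x * saw (DM 8) x = 0"
    if x: "x \<in> S" for x :: cyl
  proof -
    have "saw (\<lambda>x. fst x * DM 0 x + M 0 x + DM 3 x - M 4 x + fst x * DM 6 x) x = 0"
      "saw (\<lambda>x. fst x * DM 1 x + M 1 x + DM 4 x + M 3 x + fst x * DM 7 x) x = 0"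
      "saw (\<lambda>x. fst x * DM 2 x + M 2 x + DM 5 x + fst x * DM 8 x) x = 0"
      by (rule saw_zero[OF _ x], rule eqs, assumption)+
    then show "fst x * saw (DM 0) x + saw (M 0) x + saw (DM 3) x - saw (M 4) x + fst x * saw (DM 6) x = 0"
      "fst x * saw (DM 1) x + saw (M 1) x + saw (DM 4) x + saw (M 3) x + fst x * saw (DM 7) x = 0"
      "fst x * saw (DM 2) x + saw (M 2) x + saw (DM 5) x + fst x * saw (DM 8) x = 0"
      using cM x
      by (simp_all add: saw_add saw_diff saw_rmult[of "\<lambda>r. r"] cont_add cont_diff cont_mult cont_r)
  qed
  then have "\<forall>r \<theta> z. R1 \<le> r \<and> r \<le> R2 \<longrightarrow> (let x = (r, \<theta> :: real, z :: real) in
        r * saw (DM 0) x + saw (M 0) x + saw (DM 3) x - saw (M 4) x + r * saw (DM 6) x = 0 \<and>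
        r * saw (DM 1) x + saw (M 1) x + saw (DM 4) x + saw (M 3) x + r * saw (DM 7) x = 0 \<and>
        r * saw (DM 2) x + saw (M 2) x + saw (DM 5) x + r * saw (DM 8) x = 0)"
    unfolding Let_def by (metis S_iff fst_conv)
  moreover have "\<forall>k<3. has_dr (saw (M k)) (saw (DM k))"
    "\<forall>k\<in>{3,4,5}. has_dt (saw (M k)) (saw (DM k))"
    "\<forall>k\<in>{6,7,8}. has_dz (saw (M k)) (saw (DM k))"
    using M cM unfolding divfree_def by (auto intro!: has_dr_saw has_dt_saw has_dz_saw)
  ultimately show ?thesis using cM unfolding divfree_def by auto
qed


section \<open>A horizontal field with prescribed divergence\<close>

text \<open>The local data that the corrector bound consumes. Radial and axial derivatives are
  absent on purpose: from a bound on \<open>u\<close> the sawtooth average yields bounds for angular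
  derivatives only.\<close>

definition amp :: "field \<Rightarrow> field \<Rightarrow> cyl \<Rightarrow> real" where
  "amp w wt x = (w 0 x)\<^sup>2 + (w 1 x)\<^sup>2 + (w 2 x)\<^sup>2 + (wt 1 x)\<^sup>2 + (wt 2 x)\<^sup>2"

definition corr_sq :: "field \<Rightarrow> field \<Rightarrow> field \<Rightarrow> field \<Rightarrow> cyl \<Rightarrow> real" where
  "corr_sq W Wr Wt Wz x = (\<Sum>k<9. (grad W Wr Wt Wz k x)\<^sup>2) + (\<Sum>i<3. (W i x)\<^sup>2)"

lemma per_rad_int: "per f \<Longrightarrow> per (rad_int f)"
  unfolding per_def theta_periodic_def rad_int_def
  by (auto intro!: integral_cong)

lemma per_rad_prim: "per f \<Longrightarrow> per (rad_prim f)"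
  unfolding per_def theta_periodic_def rad_prim_def
  by (auto intro!: integral_cong)

lemma rad_prim_add:
  assumes "cont f" "cont g" "x \<in> S" shows "rad_prim (\<lambda>x. f x + g x) x = rad_prim f x + rad_prim g x"
proof -
  obtain r \<theta> z where x: "x = (r, \<theta>, z)" by (cases x)
  with assms have r: "r \<le> R2" by (auto simp: S_iff)
  show ?thesis
    unfolding x rad_prim_def prod.case
    by (intro integral_add integrable_continuous_real line_integrable(5)[OF _ r] assms)
qed

lemma rad_prim_dr:
  assumes "cont X" "cont X'" "has_dr X X'" "\<And>\<theta> z. X (R1, \<theta>, z) = 0" "x \<in> S"
  shows "rad_prim X' x = X x"
proof -
  obtain r \<theta> z where x: "x = (r, \<theta>, z)" by (cases x)
  with assms have r: "R1 \<le> r" "r \<le> R2" by (auto simp: S_iff)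
  have "((\<lambda>s. X' (s, \<theta>, z)) has_integral X (r, \<theta>, z) - X (R1, \<theta>, z)) {R1..r}"
    by (rule fundamental_theorem_of_calculus_interior)
      (use r has_drD[OF assms(3)] in \<open>auto intro!: line_integrable(5) assms
        simp: has_real_derivative_iff_has_vector_derivative[symmetric]\<close>)
  then show ?thesis using assms by (simp add: rad_prim_def x integral_unique)
qed

lemma rad_prim_zero:
  assumes "\<And>x. x \<in> S \<Longrightarrow> f x = 0" "x \<in> S" shows "rad_prim f x = 0"
proof -
  obtain r \<theta> z where x: "x = (r, \<theta>, z)" by (cases x)
  with assms have r: "r \<le> R2" by (auto simp: S_iff)
  have "integral {R1..r} (\<lambda>s. f (s, \<theta>, z)) = integral {R1..r} (\<lambda>s. 0)"
    by (rule integral_cong) (use r in \<open>auto intro!: assms simp: S_iff\<close>)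
  then show ?thesis by (simp add: rad_prim_def x)
qed

lemma abs_mult_le: "\<bar>a::real\<bar> \<le> A \<Longrightarrow> \<bar>b\<bar> \<le> B \<Longrightarrow> \<bar>a * b\<bar> \<le> A * B"
  by (simp add: abs_mult mult_mono')

lemma abs_add_le: "\<bar>a::real\<bar> \<le> A \<Longrightarrow> \<bar>b\<bar> \<le> B \<Longrightarrow> \<bar>a + b\<bar> \<le> A + B"
  by linarith

lemma abs_diff_le: "\<bar>a::real\<bar> \<le> A \<Longrightarrow> \<bar>b\<bar> \<le> B \<Longrightarrow> \<bar>a - b\<bar> \<le> A + B"
  by linarith

lemma per_dt:
  assumes d: "has_dt f ft" and p: "per f" shows "per ft"
  unfolding per_def theta_periodic_def
proof (intro allI impI)
  fix r \<theta> z assume r: "R1 \<le> r \<and> r \<le> R2"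
  have "((\<lambda>s. f (r, s + 2 * pi, z)) has_real_derivative ft (r, \<theta> + 2 * pi, z)) (at \<theta>)"
    using has_dtD[OF d, of r z "\<theta> + 2 * pi"] r by (simp add: DERIV_shift)
  moreover have "(\<lambda>s. f (r, s + 2 * pi, z)) = (\<lambda>s. f (r, s, z))"
    using p r by (auto simp: per_def theta_periodic_def)
  ultimately have "((\<lambda>s. f (r, s, z)) has_real_derivative ft (r, \<theta> + 2 * pi, z)) (at \<theta>)"
    by simp
  then show "ft (r, \<theta> + 2 * pi, z) = ft (r, \<theta>, z)"
    using has_dtD[OF d, of r z \<theta>] r DERIV_unique by auto
qed

lemma rad_prim_axial_derivative:
  assumes w: "vfield w wr wt wz" and sol: "solenoidal w wr wt wz" and x: "x \<in> S"
  shows "rad_prim (\<lambda>x. fst x * wz 2 x) x = - (fst x * w 0 x) - rad_prim (wt 1) x"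
proof -
  have w1: "C1 (w i) (wr i) (wt i) (wz i)" "per (w i)" "w i (R1, \<theta>, z) = 0" "w i (R2, \<theta>, z) = 0"
    if "i < 3" for i \<theta> z
    using w that by (auto simp: vfield_def)
  have wc: "cont (w i)" "cont (wr i)" "cont (wt i)" "cont (wz i)" if "i < 3" for i
    using C1_D[OF w1(1)[OF that]] by auto
  have "rad_prim (\<lambda>x. (fst x * wr 0 x + 1 * w 0 x) + (wt 1 x + fst x * wz 2 x)) x = 0"
  proof -
    have "(fst y * wr 0 y + 1 * w 0 y) + (wt 1 y + fst y * wz 2 y) = 0" if y: "y \<in> S" for y
    proof -
      obtain r \<theta> z where yy: "y = (r, \<theta>, z)" by (cases y)
      with y have r: "R1 \<le> r" "r \<le> R2" by (auto simp: S_iff)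
      have "wr 0 y + (wt 1 y + w 0 y) / r + wz 2 y = 0"
        using sol r unfolding solenoidal_def yy Let_def by blast
      then have "r * (wr 0 y + (wt 1 y + w 0 y) / r + wz 2 y) = 0" by simp
      moreover have "r * (wr 0 y + (wt 1 y + w 0 y) / r + wz 2 y) =
          (r * wr 0 y + 1 * w 0 y) + (wt 1 y + r * wz 2 y)"
        using r R1_pos by (simp add: field_simps)
      ultimately have "(r * wr 0 y + 1 * w 0 y) + (wt 1 y + r * wz 2 y) = 0" by linarith
      then show ?thesis by (simp add: yy)
    qed
    then show ?thesis by (rule rad_prim_zero[OF _ x])
  qed
  moreover have "rad_prim (\<lambda>x. fst x * wr 0 x + 1 * w 0 x) x = fst x * w 0 x"
  proof (rule rad_prim_dr[OF _ _ _ _ x, of "\<lambda>x. fst x * w 0 x"])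
    have "C1 (\<lambda>x. fst x) (\<lambda>x. 1) (\<lambda>x. 0) (\<lambda>x. 0)"
      by (rule C1_radial[of "\<lambda>r. r" "\<lambda>r. 1"]) (auto intro: continuous_intros)
    from C1_D[OF C1_mult[OF this w1(1)[of 0]]]
    show "cont (\<lambda>x. fst x * w 0 x)" "cont (\<lambda>x. fst x * wr 0 x + 1 * w 0 x)"
      "has_dr (\<lambda>x. fst x * w 0 x) (\<lambda>x. fst x * wr 0 x + 1 * w 0 x)" by auto
  qed (use w1(3)[of 0] in auto)
  ultimately show ?thesis
    using x by (simp add: rad_prim_add wc cont_add cont_mult cont_r)
qed

text \<open>The arithmetic of the corrector: \<Gamma> bounds the geometric coefficients and \<sigma>
  the fields. Every expression is at most cubic in \<Gamma>. The factor 4 is dictated by the radial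
  derivative, whose summands are at most \<sigma>, \<Gamma> \<Gamma> \<sigma> and twice \<Gamma>
  \<Gamma> \<Gamma> \<sigma>.\<close>

lemma corrector_aux:
  fixes G fb Gt fbt P pz s1 s2 g0 g1 g2 \<rho> r w0 w2 \<Gamma> \<sigma> :: real
  assumes \<Gamma>: "1 \<le> \<Gamma>" and \<sigma>: "0 \<le> \<sigma>"
    and q: "\<bar>G\<bar> \<le> \<sigma>" "\<bar>fb\<bar> \<le> \<sigma>" "\<bar>Gt\<bar> \<le> \<sigma>" "\<bar>fbt\<bar> \<le> \<sigma>" "\<bar>P\<bar> \<le> \<sigma>" "\<bar>pz\<bar> \<le> \<sigma>" "\<bar>s1\<bar> \<le> \<sigma>" "\<bar>s2\<bar> \<le> \<sigma>"
      "\<bar>w0\<bar> \<le> \<sigma>" "\<bar>w2\<bar> \<le> \<sigma>"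
    and g: "\<bar>g0\<bar> \<le> \<Gamma>" "\<bar>g1\<bar> \<le> \<Gamma>" "\<bar>g2\<bar> \<le> \<Gamma>" "\<bar>\<rho>\<bar> \<le> \<Gamma>"
  defines "W0 \<equiv> \<rho> * (G - g0 * fb)" and "W1 \<equiv> g1 * s1" and "T0 \<equiv> \<rho> * (Gt - g0 * fbt)" and "T1 \<equiv> g1 * fb"
  shows "\<bar>W0\<bar> \<le> 4 * \<Gamma>^3 * \<sigma>" "\<bar>W1\<bar> \<le> 4 * \<Gamma>^3 * \<sigma>"
    "\<bar>w2 - \<rho> * (g1 * fb) - \<rho> * W0\<bar> \<le> 4 * \<Gamma>^3 * \<sigma>"
    "\<bar>g2 * s1\<bar> \<le> 4 * \<Gamma>^3 * \<sigma>"
    "\<bar>\<rho> * (T0 - W1)\<bar> \<le> 4 * \<Gamma>^3 * \<sigma>" "\<bar>\<rho> * (T1 + W0)\<bar> \<le> 4 * \<Gamma>^3 * \<sigma>"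
    "\<bar>- w0 - \<rho> * (P - g0 * pz)\<bar> \<le> 4 * \<Gamma>^3 * \<sigma>" "\<bar>g1 * s2\<bar> \<le> 4 * \<Gamma>^3 * \<sigma>"
proof -
  have p: "\<Gamma> \<le> \<Gamma>^2" "\<Gamma>^2 \<le> \<Gamma>^3" "1 \<le> \<Gamma>^3" "\<Gamma> \<le> \<Gamma>^3"
    using \<Gamma> power_increasing[of 1 2 \<Gamma>] power_increasing[of 2 3 \<Gamma>] power_increasing[of 1 3 \<Gamma>] by auto
  have pm: "\<sigma> \<le> \<Gamma>^3 * \<sigma>" "\<Gamma> * \<sigma> \<le> \<Gamma>^3 * \<sigma>" "\<Gamma>^2 * \<sigma> \<le> \<Gamma>^3 * \<sigma>" "0 \<le> \<Gamma>^3 * \<sigma>"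
    using p \<sigma> mult_right_mono[OF p(3) \<sigma>] by (auto intro: mult_right_mono)
  have e: "\<Gamma> * (\<Gamma> * \<sigma>) = \<Gamma>^2 * \<sigma>" "\<Gamma> * (\<Gamma> * (\<Gamma> * \<sigma>)) = \<Gamma>^3 * \<sigma>"
    by (simp_all add: power2_eq_square power3_eq_cube)
  have w0: "\<bar>W0\<bar> \<le> \<Gamma> * (\<sigma> + \<Gamma> * \<sigma>)" and t0: "\<bar>T0\<bar> \<le> \<Gamma> * (\<sigma> + \<Gamma> * \<sigma>)"
    and w1: "\<bar>W1\<bar> \<le> \<Gamma> * \<sigma>" and t1: "\<bar>T1\<bar> \<le> \<Gamma> * \<sigma>"
    unfolding W0_def T0_def W1_def T1_def by (intro abs_mult_le abs_diff_le q g)+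
  have w02: "\<bar>W0\<bar> \<le> 2 * (\<Gamma>^2 * \<sigma>)" "\<bar>T0\<bar> \<le> 2 * (\<Gamma>^2 * \<sigma>)"
    using w0 t0 e mult_right_mono[OF p(1) \<sigma>] by (auto simp: distrib_left)
  have \<rho>W: "\<bar>\<rho> * W0\<bar> \<le> \<Gamma> * (2 * (\<Gamma>^2 * \<sigma>))" by (intro abs_mult_le w02 g)
  have \<rho>W': "\<bar>\<rho> * W0\<bar> \<le> 2 * (\<Gamma>^3 * \<sigma>)" using \<rho>W by (simp add: power2_eq_square power3_eq_cube)
  have \<rho>T: "\<bar>\<rho> * T0\<bar> \<le> \<Gamma> * (2 * (\<Gamma>^2 * \<sigma>))" by (intro abs_mult_le w02 g)
  have \<rho>T': "\<bar>\<rho> * T0\<bar> \<le> 2 * (\<Gamma>^3 * \<sigma>)" using \<rho>T by (simp add: power2_eq_square power3_eq_cube)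
  have \<rho>1: "\<bar>\<rho> * W1\<bar> \<le> \<Gamma> * (\<Gamma> * \<sigma>)" "\<bar>\<rho> * T1\<bar> \<le> \<Gamma> * (\<Gamma> * \<sigma>)" by (intro abs_mult_le w1 t1 g)+
  have \<rho>P: "\<bar>\<rho> * (P - g0 * pz)\<bar> \<le> \<Gamma> * (\<sigma> + \<Gamma> * \<sigma>)" by (intro abs_mult_le abs_diff_le q g)
  show "\<bar>W0\<bar> \<le> 4 * \<Gamma>^3 * \<sigma>" "\<bar>W1\<bar> \<le> 4 * \<Gamma>^3 * \<sigma>"
    using w02 w1 pm by linarith+
  show "\<bar>w2 - \<rho> * (g1 * fb) - \<rho> * W0\<bar> \<le> 4 * \<Gamma>^3 * \<sigma>"
    using abs_diff_le[OF abs_diff_le[OF q(10) \<rho>1(2)[unfolded T1_def]] \<rho>W'] pm(1,3,4)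
    unfolding e mult.assoc by linarith
  have "\<bar>g2 * s1\<bar> \<le> \<Gamma> * \<sigma>" "\<bar>g1 * s2\<bar> \<le> \<Gamma> * \<sigma>" by (intro abs_mult_le g q)+
  then show "\<bar>g2 * s1\<bar> \<le> 4 * \<Gamma>^3 * \<sigma>" "\<bar>g1 * s2\<bar> \<le> 4 * \<Gamma>^3 * \<sigma>" using pm by linarith+
  show "\<bar>\<rho> * (T0 - W1)\<bar> \<le> 4 * \<Gamma>^3 * \<sigma>"
    using abs_diff_le[OF \<rho>T' \<rho>1(1)] pm(3,4) unfolding e right_diff_distrib[symmetric] mult.assoc by linarith
  show "\<bar>\<rho> * (T1 + W0)\<bar> \<le> 4 * \<Gamma>^3 * \<sigma>"
    using abs_add_le[OF \<rho>1(2) \<rho>W'] pm(3,4) unfolding e distrib_left[of \<rho> T1 W0] mult.assoc by linarith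
  show "\<bar>- w0 - \<rho> * (P - g0 * pz)\<bar> \<le> 4 * \<Gamma>^3 * \<sigma>"
    using \<rho>P q(9) pm unfolding distrib_left e by linarith
qed

text \<open>On each cross section one has to solve \<open>\<partial>\<^sub>r (r W 0) +
  \<partial>\<^sub>\<theta> (W 1) = f\<close> with \<open>f = r w 2\<close>. The radial primitive
  \<open>G\<close> of \<open>f\<close> vanishes at the inner wall but equals \<open>fb\<close> at
  the outer one. Subtracting \<open>g0 fb\<close>, with \<open>g0\<close> rising from 0 to 1,
  repairs the boundary value and leaves the defect \<open>g1 fb\<close>. By the flux condition
  \<open>fb\<close> has zero angular mean, so it has a periodic angular primitive; \<open>g1\<close>
  times that primitive is \<open>W 1\<close>.\<close>

lemma corrector:
  obtains K where "0 \<le> K"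
    "\<And>w wr wt wz. vfield w wr wt wz \<Longrightarrow> solenoidal w wr wt wz \<Longrightarrow>
      (\<And>x. x \<in> S \<Longrightarrow> ang_int (rad_int (\<lambda>x. fst x * w 2 x)) x = 0) \<Longrightarrow>
      \<exists>W Wr Wt Wz. vfield W Wr Wt Wz \<and> (\<forall>x. W 2 x = 0 \<and> Wz 2 x = 0) \<and>
        (\<forall>r \<theta> z. R1 \<le> r \<and> r \<le> R2 \<longrightarrow> Wr 0 (r, \<theta>, z) + (Wt 1 (r, \<theta>, z) + W 0 (r, \<theta>, z)) / r = w 2 (r, \<theta>, z)) \<and>
        (\<forall>x\<in>S. corr_sq W Wr Wt Wz x \<le> K * (amp w wt x + rad_int (amp w wt) x + ang_int (rad_int (amp w wt)) x))"
proof
  define L where "L = R2 - R1"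
  have L: "0 < L" using R1_less_R2 by (simp add: L_def)
  define \<Gamma> where "\<Gamma> = 5 + 6 / L + 18 / L\<^sup>2 + 1 / R1"
  define K0 where "K0 = 1 + L * (1 + R2\<^sup>2) * (1 + 8 * pi ^ 3)"
  have \<Gamma>: "1 \<le> \<Gamma>" "0 \<le> 6 / L" "0 \<le> 18 / L\<^sup>2" "0 \<le> 1 / R1" using L R1_pos by (auto simp: \<Gamma>_def add_nonneg_nonneg)
  have "1 \<le> 1 + 8 * pi ^ 3" by simp
  moreover have LR: "0 \<le> L * (1 + R2\<^sup>2)" using L by simp
  ultimately have K0': "L * (1 + R2\<^sup>2) \<le> K0"
    unfolding K0_def using mult_left_mono[of 1 "1 + 8 * pi ^ 3" "L * (1 + R2\<^sup>2)"] by simp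
  have K0pi: "8 * pi ^ 3 * (L * (1 + R2\<^sup>2)) \<le> K0" using LR unfolding K0_def by (simp add: algebra_simps)
  have K01: "1 \<le> K0" unfolding K0_def using LR by simp
  have K0L: "L * R2\<^sup>2 \<le> K0" "L \<le> K0" using K0' L by (simp_all add: distrib_left) (smt (verit) mult_nonneg_nonneg zero_le_power2)+
  have K0pi': "8 * pi ^ 3 * (L * R2\<^sup>2) \<le> K0" "8 * pi ^ 3 * L \<le> K0"
  proof -
    have "0 \<le> 8 * pi ^ 3 * (L * R2\<^sup>2)" "0 \<le> 8 * pi ^ 3 * L" using L by auto
    moreover have "8 * pi ^ 3 * (L * (1 + R2\<^sup>2)) = 8 * pi ^ 3 * L + 8 * pi ^ 3 * (L * R2\<^sup>2)"
      by (simp add: distrib_left)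
    ultimately show "8 * pi ^ 3 * (L * R2\<^sup>2) \<le> K0" "8 * pi ^ 3 * L \<le> K0" using K0pi by linarith+
  qed
  \<comment> \<open>Twelve counts all entries of the gradient together with the components of the
    field; each of those that occur is bounded through \<open>corrector_aux\<close>.\<close>
  define K where "K = 12 * (4 * \<Gamma> ^ 3)\<^sup>2 * K0"
  show "0 \<le> K" using K01 by (simp add: K_def)
  fix w wr wt wz
  assume w: "vfield w wr wt wz" and sol: "solenoidal w wr wt wz"
    and flux: "\<And>x. x \<in> S \<Longrightarrow> ang_int (rad_int (\<lambda>x. fst x * w 2 x)) x = 0"
  have w1: "C1 (w i) (wr i) (wt i) (wz i)" "per (w i)" "w i (R1, \<theta>, z) = 0" "w i (R2, \<theta>, z) = 0"
    if "i < 3" for i \<theta> z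
    using w that by (auto simp: vfield_def)
  have wc: "cont (w i)" "cont (wr i)" "cont (wt i)" "cont (wz i)" if "i < 3" for i
    using C1_D[OF w1(1)[OF that]] by auto
  define f where "f = (\<lambda>x. fst x * w 2 x)"
  have fC1: "C1 f (\<lambda>x. fst x * wr 2 x + 1 * w 2 x) (\<lambda>x. fst x * wt 2 x) (\<lambda>x. fst x * wz 2 x)"
  proof -
    have "C1 (\<lambda>x. fst x) (\<lambda>x. 1) (\<lambda>x. 0) (\<lambda>x. 0)"
      by (rule C1_radial[of "\<lambda>r. r" "\<lambda>r. 1"]) (auto intro: continuous_intros)
    from C1_mult[OF this w1(1)[of 2]] show ?thesis by (simp add: f_def)
  qed
  define G where "G = rad_prim f"
  define fb where "fb = rad_int f"
  define Gt where "Gt = rad_prim (\<lambda>x. fst x * wt 2 x)"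
  define fbt where "fbt = rad_int (\<lambda>x. fst x * wt 2 x)"
  define P where "P = rad_prim (wt 1)"
  define pz where "pz = rad_int (wt 1)"
  have cf: "cont f" "cont (\<lambda>x. fst x * wt 2 x)" "cont (\<lambda>x. fst x * wz 2 x)" using C1_D[OF fC1] by auto
  have cP: "cont P" "cont pz" using wc(3)[of 1] by (auto simp: P_def pz_def)
  have Gz: "rad_prim (\<lambda>x. fst x * wz 2 x) x = - (fst x * w 0 x) - P x" if "x \<in> S" for x
    unfolding P_def by (rule rad_prim_axial_derivative[OF w sol that])
  have GC1: "C1 G f Gt (\<lambda>x. - (fst x * w 0 x) - P x)"
    by (rule C1_cong[OF C1_rad_prim[OF fC1, folded G_def Gt_def]]) (auto simp: Gz S_iff Gt_def)
  have fbC1: "C1 fb (\<lambda>x. 0) fbt (\<lambda>x. - pz x)"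
  proof (rule C1_cong[OF C1_rad_int[OF fC1, folded fb_def fbt_def]])
    fix r \<theta> z
    \<comment> \<open>At r = R2 the term r \<open>w 0\<close> drops out, because \<open>w 0\<close>
      vanishes on the outer wall as well.\<close>
    show "rad_int (\<lambda>x. fst x * wz 2 x) (r, \<theta>, z) = - pz (r, \<theta>, z)"
      using Gz[of "(R2, \<theta>, z)"] R1_less_R2 w1(4)[of 0]
      by (simp add: rad_int_eq pz_def P_def S_iff)
  qed (auto simp: fbt_def)
  have pf: "per f" using w1(2)[of 2] by (simp add: f_def per_def theta_periodic_def)
  have pfb: "per fb" using pf by (simp add: fb_def per_rad_int)
  have pG: "per G" using pf by (simp add: G_def per_rad_prim)
  \<comment> \<open>The place where zero flux is used: without the angular mean of
    \<open>fb\<close>, the sawtooth average divided by 2\<pi> is an angular primitive of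
    \<open>fb\<close>.\<close>
  have sfb: "saw fbt x = 2 * pi * fb x" if "x \<in> S" for x
    using saw_dt[OF fbC1 pfb] flux[OF that] that by (cases x) (auto simp: S_iff fb_def f_def)
  have fbS: "C1 (\<lambda>x. 1 / (2 * pi) * saw fb x) (\<lambda>x. 0) fb (\<lambda>x. - (1 / (2 * pi) * saw pz x))"
  proof -
    have "C1 (\<lambda>x. 1 / (2 * pi) * saw fb x) (\<lambda>x. 1 / (2 * pi) * saw (\<lambda>x. 0) x + 0 * saw fb x)
      (\<lambda>x. 1 / (2 * pi) * saw fbt x + 0 * saw fb x) (\<lambda>x. 1 / (2 * pi) * saw (\<lambda>x. - pz x) x + 0 * saw fb x)"
      by (rule C1_mult[OF C1_const C1_saw[OF fbC1]])
    then show ?thesis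
      by (rule C1_cong) (auto simp: sfb S_iff saw_uminus saw_zero[of "\<lambda>x. 0"])
  qed
  \<comment> \<open>\<open>g0\<close> is the cubic smoothstep across the gap. Its derivative
    \<open>g1\<close> vanishes at both walls, which is what makes \<open>W 1\<close> vanish
    there.\<close>
  define \<xi> where "\<xi> = (\<lambda>r::real. (r - R1) / L)"
  define g0 where "g0 = (\<lambda>r. 3 * (\<xi> r)\<^sup>2 - 2 * (\<xi> r) ^ 3)"
  define g1 where "g1 = (\<lambda>r. 6 * \<xi> r * (1 - \<xi> r) / L)"
  define g2 where "g2 = (\<lambda>r. (6 - 12 * \<xi> r) / L\<^sup>2)"
  have \<xi>D: "(\<xi> has_real_derivative 1 / L) (at r)" for r
    unfolding \<xi>_def using L by (auto intro!: derivative_eq_intros)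
  have g0D: "(g0 has_real_derivative g1 r) (at r)" for r
    unfolding g0_def g1_def
    by (rule derivative_eq_intros \<xi>D refl)+ (use L in \<open>simp add: field_simps power2_eq_square\<close>)
  have g1D: "(g1 has_real_derivative g2 r) (at r)" for r
    unfolding g1_def g2_def
    by (rule derivative_eq_intros \<xi>D refl)+ (use L in \<open>auto simp add: field_simps power2_eq_square\<close>)
  have gc: "continuous_on A g0" "continuous_on A g1" "continuous_on A g2" for A
  proof -
    have "L \<noteq> 0" "L\<^sup>2 \<noteq> 0" using L by auto
    then show "continuous_on A g0" "continuous_on A g1" "continuous_on A g2"
      unfolding g0_def g1_def g2_def \<xi>_def by (auto intro!: continuous_intros)
  qed
  have g0C1: "C1 (\<lambda>x. g0 (fst x)) (\<lambda>x. g1 (fst x)) (\<lambda>x. 0) (\<lambda>x. 0)"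
    and g1C1: "C1 (\<lambda>x. g1 (fst x)) (\<lambda>x. g2 (fst x)) (\<lambda>x. 0) (\<lambda>x. 0)"
    by (rule C1_radial gc g0D g1D)+
  have \<rho>C1: "C1 (\<lambda>x. 1 / fst x) (\<lambda>x. - (1 / (fst x)\<^sup>2)) (\<lambda>x. 0) (\<lambda>x. 0)"
  proof (rule C1_radial[of "\<lambda>r. 1 / r" "\<lambda>r. - (1 / r\<^sup>2)"])
    show "continuous_on {R1..R2} (\<lambda>r. 1 / r)" "continuous_on {R1..R2} (\<lambda>r. - (1 / r\<^sup>2))"
      using R1_pos by (auto intro!: continuous_intros)
    show "((\<lambda>r. 1 / r) has_real_derivative - (1 / r\<^sup>2)) (at r)" if "R1 < r" for r
      using that R1_pos by (auto intro!: derivative_eq_intros simp: power2_eq_square)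
  qed
  \<comment> \<open>By incompressibility \<open>\<partial>\<^sub>z G\<close> and \<open>\<partial>\<^sub>z fb\<close> involve only \<open>w 0\<close> and \<open>\<partial>\<^sub>\<theta> (w 1)\<close>, so no \<open>z\<close>-derivative of
    \<open>w\<close> enters the bound on \<open>W\<close>.\<close>
  define W0 where "W0 = (\<lambda>x. 1 / fst x * (G x - g0 (fst x) * fb x))"
  define W0r where "W0r = (\<lambda>x. w 2 x - 1 / fst x * (g1 (fst x) * fb x) - 1 / fst x * W0 x)"
  define W0t where "W0t = (\<lambda>x. 1 / fst x * (Gt x - g0 (fst x) * fbt x))"
  define W0z where "W0z = (\<lambda>x. - w 0 x - 1 / fst x * (P x - g0 (fst x) * pz x))"
  have W0C1: "C1 W0 W0r W0t W0z"
    unfolding W0_def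
    by (rule C1_cong[OF C1_mult[OF \<rho>C1 C1_diff[OF GC1 C1_mult[OF g0C1 fbC1]]]])
      (use R1_pos in \<open>auto simp: W0r_def W0t_def W0z_def W0_def f_def field_simps power2_eq_square\<close>)
  define W1 where "W1 = (\<lambda>x. g1 (fst x) * (1 / (2 * pi) * saw fb x))"
  define W1r where "W1r = (\<lambda>x. g2 (fst x) * (1 / (2 * pi) * saw fb x))"
  define W1t where "W1t = (\<lambda>x. g1 (fst x) * fb x)"
  define W1z where "W1z = (\<lambda>x. g1 (fst x) * (- (1 / (2 * pi) * saw pz x)))"
  have W1C1: "C1 W1 W1r W1t W1z"
    unfolding W1_def
    by (rule C1_cong[OF C1_mult[OF g1C1 fbS]]) (auto simp: W1r_def W1t_def W1z_def)
  define sel where "sel = (\<lambda>(a :: cyl \<Rightarrow> real) b (i::nat). if i = 0 then a else if i = 1 then b else (\<lambda>x. 0))"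
  have i3: "i = 0 \<or> i = 1 \<or> i = 2" if "i < 3" for i :: nat using that by auto
  have vW: "vfield (sel W0 W1) (sel W0r W1r) (sel W0t W1t) (sel W0z W1z)"
    unfolding vfield_def
  proof (intro allI impI conjI)
    fix i :: nat assume i: "i < 3"
    show "C1 (sel W0 W1 i) (sel W0r W1r i) (sel W0t W1t i) (sel W0z W1z i)"
      using i3[OF i] W0C1 W1C1 C1_const[of 0] by (auto simp: sel_def)
    have "per W0" using pG pfb by (simp add: W0_def per_def theta_periodic_def)
    moreover have "per W1" using per_saw[OF pfb] by (simp add: W1_def per_def theta_periodic_def)
    ultimately show "per (sel W0 W1 i)"
      using i3[OF i] by (auto simp: sel_def per_def theta_periodic_def)
    have \<xi>01: "\<xi> R1 = 0" "\<xi> R2 = 1" using L by (auto simp: \<xi>_def L_def)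
    show "sel W0 W1 i (R1, \<theta>, z) = 0" "sel W0 W1 i (R2, \<theta>, z) = 0" for \<theta> z
      using i3[OF i] by (auto simp: sel_def W0_def W1_def G_def fb_def rad_int_eq rad_prim_def g0_def g1_def \<xi>01)
  qed
  have "W0r x + (W1t x + W0 x) / fst x = w 2 x" for x
    by (simp add: W0r_def W1t_def add_divide_distrib)
  then have dW: "\<forall>r \<theta> z. R1 \<le> r \<and> r \<le> R2 \<longrightarrow> sel W0r W1r 0 (r, \<theta>, z) +
      (sel W0t W1t 1 (r, \<theta>, z) + sel W0 W1 0 (r, \<theta>, z)) / r = w 2 (r, \<theta>, z)"
    unfolding sel_def by (simp, metis fst_conv)
  have bW: "corr_sq (sel W0 W1) (sel W0r W1r) (sel W0t W1t) (sel W0z W1z) x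
      \<le> K * (amp w wt x + rad_int (amp w wt) x + ang_int (rad_int (amp w wt)) x)" if x: "x \<in> S" for x
  proof -
    define a where "a = amp w wt"
    have ca: "cont a" unfolding a_def amp_def by (intro cont_add cont_power wc) auto
    have a0: "0 \<le> a x" for x by (simp add: a_def amp_def)
    have A0: "0 \<le> rad_int a x" for x by (rule rad_int_nonneg[OF ca a0])
    have AA0: "0 \<le> ang_int (rad_int a) x" by (rule ang_int_nonneg) (use ca A0 x in auto)
    define s where "s = a x + rad_int a x + ang_int (rad_int a) x"
    have s0: "0 \<le> s" "rad_int a x \<le> s" "ang_int (rad_int a) x \<le> s" "a x \<le> s"
      using a0[of x] A0[of x] AA0 by (auto simp: s_def)
    have r: "R1 \<le> fst x" "fst x \<le> R2" using x by (auto simp: closed_slab_def)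
    have rw: "(fst y * b)\<^sup>2 \<le> R2\<^sup>2 * a y" if "y \<in> S" "b\<^sup>2 \<le> a y" for y :: cyl and b
    proof -
      have "(fst y)\<^sup>2 \<le> R2\<^sup>2" using that R1_pos by (intro power_mono) (auto simp: closed_slab_def)
      then show ?thesis using that a0[of y] by (simp add: power_mult_distrib mult_mono)
    qed
    have ab: "(w 2 y)\<^sup>2 \<le> a y" "(wt 2 y)\<^sup>2 \<le> a y" "(wt 1 y)\<^sup>2 \<le> a y" "(w 0 y)\<^sup>2 \<le> a y" for y
      by (simp_all add: a_def amp_def)
    have R: "rad_int (\<lambda>x. (fst x * w 2 x)\<^sup>2) y \<le> R2\<^sup>2 * rad_int a y"
      "rad_int (\<lambda>x. (fst x * wt 2 x)\<^sup>2) y \<le> R2\<^sup>2 * rad_int a y"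
      "rad_int (\<lambda>x. (wt 1 x)\<^sup>2) y \<le> rad_int a y" for y
    proof -
      show "rad_int (\<lambda>x. (fst x * w 2 x)\<^sup>2) y \<le> R2\<^sup>2 * rad_int a y"
        unfolding rad_int_cmult[symmetric]
        by (rule rad_int_mono) (auto intro!: rw ab wc ca)
      show "rad_int (\<lambda>x. (fst x * wt 2 x)\<^sup>2) y \<le> R2\<^sup>2 * rad_int a y"
        unfolding rad_int_cmult[symmetric]
        by (rule rad_int_mono) (auto intro!: rw ab wc ca)
      show "rad_int (\<lambda>x. (wt 1 x)\<^sup>2) y \<le> rad_int a y"
        by (rule rad_int_mono) (auto intro!: ab wc(3) ca simp del: One_nat_def)
    qed
    have toK: "q \<le> K0 * s" if "q \<le> c * b" "c \<le> K0" "0 \<le> b" "b \<le> s" for q c b :: real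
      using that K01 mult_mono[of c K0 b s] by auto
    have Rf: "L * rad_int (\<lambda>x. (f x)\<^sup>2) y \<le> (L * R2\<^sup>2) * rad_int a y"
      "L * rad_int (\<lambda>x. (fst x * wt 2 x)\<^sup>2) y \<le> (L * R2\<^sup>2) * rad_int a y"
      "L * rad_int (\<lambda>x. (wt 1 x)\<^sup>2) y \<le> L * rad_int a y" for y
      using R[of y] L by (auto simp: f_def mult_left_mono mult.assoc)
    have sq: "(G x)\<^sup>2 \<le> K0 * s" "(fb x)\<^sup>2 \<le> K0 * s" "(Gt x)\<^sup>2 \<le> K0 * s" "(fbt x)\<^sup>2 \<le> K0 * s"
      "(P x)\<^sup>2 \<le> K0 * s" "(pz x)\<^sup>2 \<le> K0 * s"
      unfolding G_def fb_def Gt_def fbt_def P_def pz_def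
      using toK[OF order_trans[OF rad_prim_square_le[OF cf(1) x, folded L_def] Rf(1)] K0L(1) A0 s0(2)]
        toK[OF order_trans[OF rad_int_square_le[OF cf(1), folded L_def] Rf(1)] K0L(1) A0 s0(2)]
        toK[OF order_trans[OF rad_prim_square_le[OF cf(2) x, folded L_def] Rf(2)] K0L(1) A0 s0(2)]
        toK[OF order_trans[OF rad_int_square_le[OF cf(2), folded L_def] Rf(2)] K0L(1) A0 s0(2)]
        toK[OF order_trans[OF rad_prim_square_le[OF wc(3)[of 1] x, folded L_def] Rf(3)] K0L(2) A0 s0(2)]
        toK[OF order_trans[OF rad_int_square_le[OF wc(3)[of 1], folded L_def] Rf(3)] K0L(2) A0 s0(2)]
      by simp_all
    have S1: "(saw fb x)\<^sup>2 \<le> (8 * pi ^ 3 * (L * R2\<^sup>2)) * ang_int (rad_int a) x"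
    proof -
      have "(saw fb x)\<^sup>2 \<le> 8 * pi ^ 3 * ang_int (\<lambda>x. (fb x)\<^sup>2) x"
        by (rule saw_square_le[OF _ pfb x]) (use cf in \<open>auto simp: fb_def\<close>)
      also have "ang_int (\<lambda>x. (fb x)\<^sup>2) x \<le> ang_int (\<lambda>x. (L * R2\<^sup>2) * rad_int a x) x"
        by (rule ang_int_mono[OF _ _ _ x])
          (use cf ca in \<open>auto simp: fb_def intro!: order_trans[OF rad_int_square_le[OF cf(1), folded L_def] Rf(1)]\<close>)
      finally show ?thesis by (simp add: ang_int_cmult mult.assoc)
    qed
    have S2: "(saw pz x)\<^sup>2 \<le> (8 * pi ^ 3 * L) * ang_int (rad_int a) x"
    proof -
      have ppz: "per pz"
        unfolding pz_def
      proof (rule per_rad_int)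
        show "per (wt 1)" by (rule per_dt[OF C1_D(6)[OF w1(1)[of 1]] w1(2)[of 1]]) simp_all
      qed
      have "(saw pz x)\<^sup>2 \<le> 8 * pi ^ 3 * ang_int (\<lambda>x. (pz x)\<^sup>2) x"
        by (rule saw_square_le[OF cP(2) ppz x])
      also have "ang_int (\<lambda>x. (pz x)\<^sup>2) x \<le> ang_int (\<lambda>x. L * rad_int a x) x"
      proof (rule ang_int_mono[OF _ _ _ x])
        show "(pz y)\<^sup>2 \<le> L * rad_int a y" for y
          unfolding pz_def using order_trans[OF rad_int_square_le[OF wc(3)[of 1], folded L_def] Rf(3)] by simp
      qed (use cP ca in auto)
      finally show ?thesis by (simp add: ang_int_cmult mult.assoc)
    qed
    have sq2: "(saw fb x)\<^sup>2 \<le> K0 * s" "(saw pz x)\<^sup>2 \<le> K0 * s" "(w 0 x)\<^sup>2 \<le> K0 * s" "(w 2 x)\<^sup>2 \<le> K0 * s"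
      using toK[OF S1 K0pi'(1) AA0 s0(3)] toK[OF S2 K0pi'(2) AA0 s0(3)]
        toK[of "(w 0 x)\<^sup>2" 1 "a x"] toK[of "(w 2 x)\<^sup>2" 1 "a x"] ab[of x] a0[of x] s0 K01 by auto
    define \<sigma> where "\<sigma> = sqrt (K0 * s)"
    have Ks: "0 \<le> K0 * s" using K01 s0 by simp
    have \<sigma>: "0 \<le> \<sigma>" "\<sigma>\<^sup>2 = K0 * s" using Ks by (auto simp: \<sigma>_def)
    have le\<sigma>: "\<bar>q\<bar> \<le> \<sigma>" if "q\<^sup>2 \<le> K0 * s" for q
      using that real_le_rsqrt[of "\<bar>q\<bar>"] by (simp add: \<sigma>_def)
    have half: "\<bar>1 / (2 * pi) * q\<bar> \<le> \<sigma>" if "q\<^sup>2 \<le> K0 * s" for q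
    proof -
      have "\<bar>1 / (2 * pi) * q\<bar> \<le> 1 * \<sigma>"
        by (rule abs_mult_le[OF _ le\<sigma>[OF that]]) (use pi_gt3 in simp)
      then show ?thesis by simp
    qed
    have \<xi>b: "0 \<le> \<xi> (fst x)" "\<xi> (fst x) \<le> 1" using r L by (auto simp: \<xi>_def L_def)
    have gb: "\<bar>g0 (fst x)\<bar> \<le> \<Gamma>" "\<bar>g1 (fst x)\<bar> \<le> \<Gamma>" "\<bar>g2 (fst x)\<bar> \<le> \<Gamma>" "\<bar>1 / fst x\<bar> \<le> \<Gamma>"
    proof -
      have "(\<xi> (fst x))\<^sup>2 \<le> 1" "(\<xi> (fst x)) ^ 3 \<le> 1" using \<xi>b by (auto intro: power_le_one)
      then have "\<bar>g0 (fst x)\<bar> \<le> 5" unfolding g0_def using \<xi>b zero_le_power[OF \<xi>b(1), of 3] zero_le_power[OF \<xi>b(1), of 2] by linarith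
      then show "\<bar>g0 (fst x)\<bar> \<le> \<Gamma>" using \<Gamma> unfolding \<Gamma>_def by linarith
      have "\<bar>\<xi> (fst x) * (1 - \<xi> (fst x))\<bar> \<le> 1 * 1" by (rule abs_mult_le) (use \<xi>b in auto)
      then have "\<bar>g1 (fst x)\<bar> \<le> 6 / L" using L by (simp add: g1_def abs_mult divide_right_mono mult.assoc)
      then show "\<bar>g1 (fst x)\<bar> \<le> \<Gamma>" using \<Gamma> unfolding \<Gamma>_def by linarith
      have "\<bar>6 - 12 * \<xi> (fst x)\<bar> \<le> 18" using \<xi>b by auto
      then have "\<bar>g2 (fst x)\<bar> \<le> 18 / L\<^sup>2" using L by (simp add: g2_def divide_right_mono)
      then show "\<bar>g2 (fst x)\<bar> \<le> \<Gamma>" using \<Gamma> unfolding \<Gamma>_def by linarith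
      have "\<bar>1 / fst x\<bar> \<le> 1 / R1" using r R1_pos by (simp add: frac_le)
      then show "\<bar>1 / fst x\<bar> \<le> \<Gamma>" using \<Gamma> unfolding \<Gamma>_def by linarith
    qed
    note B = corrector_aux[OF \<Gamma>(1) \<sigma>(1) le\<sigma>[OF sq(1)] le\<sigma>[OF sq(2)] le\<sigma>[OF sq(3)] le\<sigma>[OF sq(4)]
        le\<sigma>[OF sq(5)] le\<sigma>[OF sq(6)] half[OF sq2(1)] half[OF sq2(2)] le\<sigma>[OF sq2(3)] le\<sigma>[OF sq2(4)] gb]
    define c where "c = 4 * \<Gamma>^3 * \<sigma>"
    have c2: "q\<^sup>2 \<le> c\<^sup>2" if "\<bar>q\<bar> \<le> c" for q using that by (simp add: abs_le_square_iff[symmetric] abs_of_nonneg order_trans[OF abs_ge_zero])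
    have c00: "0 \<le> c\<^sup>2" by simp
    have "corr_sq (sel W0 W1) (sel W0r W1r) (sel W0t W1t) (sel W0z W1z) x =
      (W0r x)\<^sup>2 + (W1r x)\<^sup>2 + (1 / fst x * (W0t x - W1 x))\<^sup>2 + (1 / fst x * (W1t x + W0 x))\<^sup>2 +
      (W0z x)\<^sup>2 + (W1z x)\<^sup>2 + (W0 x)\<^sup>2 + (W1 x)\<^sup>2"
      by (simp add: corr_sq_def sum_lt_9 sum_lt_3 grad_def sel_def)
    also have "\<dots> \<le> c\<^sup>2 + c\<^sup>2 + c\<^sup>2 + c\<^sup>2 + c\<^sup>2 + c\<^sup>2 + c\<^sup>2 + c\<^sup>2"
    proof (intro add_mono c2)
      show "\<bar>W0r x\<bar> \<le> c" using B(3) by (simp add: W0r_def W0_def c_def)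
      show "\<bar>W1r x\<bar> \<le> c" using B(4) by (simp add: W1r_def c_def)
      show "\<bar>1 / fst x * (W0t x - W1 x)\<bar> \<le> c" using B(5) unfolding W0t_def W1_def c_def .
      show "\<bar>1 / fst x * (W1t x + W0 x)\<bar> \<le> c" using B(6) unfolding W1t_def W0_def c_def .
      show "\<bar>W0z x\<bar> \<le> c" using B(7) unfolding W0z_def c_def .
      show "\<bar>W1z x\<bar> \<le> c" using B(8) by (simp add: W1z_def c_def)
      show "\<bar>W0 x\<bar> \<le> c" using B(1) unfolding W0_def c_def .
      show "\<bar>W1 x\<bar> \<le> c" using B(2) unfolding W1_def c_def .
    qed
    also have "\<dots> \<le> 12 * c\<^sup>2" using c00 by simp
    also have "\<dots> = K * s" by (simp add: c_def K_def power_mult_distrib \<sigma>(2) mult_ac)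
    finally show ?thesis by (simp add: s_def a_def)
  qed
  show "\<exists>W Wr Wt Wz. vfield W Wr Wt Wz \<and> (\<forall>x. W 2 x = 0 \<and> Wz 2 x = 0) \<and>
        (\<forall>r \<theta> z. R1 \<le> r \<and> r \<le> R2 \<longrightarrow> Wr 0 (r, \<theta>, z) + (Wt 1 (r, \<theta>, z) + W 0 (r, \<theta>, z)) / r = w 2 (r, \<theta>, z)) \<and>
        (\<forall>x\<in>S. corr_sq W Wr Wt Wz x \<le> K * (amp w wt x + rad_int (amp w wt) x + ang_int (rad_int (amp w wt)) x))"
  proof (intro exI conjI)
    show "\<forall>x. sel W0 W1 2 x = 0 \<and> sel W0z W1z 2 x = 0" by (simp add: sel_def)
  qed (use vW dW bW in blast)+
qed

end

section \<open>The weighted energy estimate\<close>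

definition om :: "real \<Rightarrow> real \<Rightarrow> real" where "om \<kappa> z = 1 / (1 + (\<kappa> * z)\<^sup>2)"
definition om1 :: "real \<Rightarrow> real \<Rightarrow> real" where "om1 \<kappa> z = - 2 * \<kappa>\<^sup>2 * z * (om \<kappa> z)\<^sup>2"
definition om2 :: "real \<Rightarrow> real \<Rightarrow> real" where
  "om2 \<kappa> z = - 2 * \<kappa>\<^sup>2 * (om \<kappa> z)\<^sup>2 + 8 * \<kappa> ^ 4 * z\<^sup>2 * (om \<kappa> z) ^ 3"

lemma om_pos: "0 < om \<kappa> z" and om_le_1: "om \<kappa> z \<le> 1"
proof -
  have "0 < 1 + (\<kappa> * z)\<^sup>2" by (simp add: add_pos_nonneg)
  then show "0 < om \<kappa> z" "om \<kappa> z \<le> 1" by (simp_all add: om_def)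
qed

lemma om_deriv: "(om \<kappa> has_real_derivative om1 \<kappa> z) (at z)"
proof -
  have n: "1 + (\<kappa> * z)\<^sup>2 \<noteq> 0" by (simp add: add_pos_nonneg less_imp_neq[symmetric])
  have "((\<lambda>z. 1 / (1 + (\<kappa> * z)\<^sup>2)) has_real_derivative om1 \<kappa> z) (at z)"
    unfolding om1_def om_def
    by (rule derivative_eq_intros refl n)+ (simp add: power2_eq_square divide_simps)
  then show ?thesis by (simp add: om_def[abs_def])
qed

lemma om1_deriv: "(om1 \<kappa> has_real_derivative om2 \<kappa> z) (at z)"
proof -
  have "((\<lambda>z. - 2 * \<kappa>\<^sup>2 * z * (om \<kappa> z)\<^sup>2) has_real_derivative
      - 2 * \<kappa>\<^sup>2 * z * (2 * om \<kappa> z * om1 \<kappa> z) + - 2 * \<kappa>\<^sup>2 * (om \<kappa> z)\<^sup>2) (at z)"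
    by (rule derivative_eq_intros om_deriv refl)+ simp
  then show ?thesis
    by (simp add: om1_def[abs_def] om2_def power2_eq_square power3_eq_cube power4_eq_xxxx algebra_simps)
qed

lemma om_continuous: "continuous_on A (om \<kappa>)" "continuous_on A (om1 \<kappa>)" "continuous_on A (om2 \<kappa>)"
proof -
  show 1: "continuous_on A (om \<kappa>)" by (rule DERIV_continuous_on[OF has_field_derivative_at_within[OF om_deriv]])
  show "continuous_on A (om1 \<kappa>)" by (rule DERIV_continuous_on[OF has_field_derivative_at_within[OF om1_deriv]])
  show "continuous_on A (om2 \<kappa>)" unfolding om2_def[abs_def] by (intro continuous_intros 1)
qed

text \<open>With u = \<kappa> z this is the inequality 2\<bar>u\<bar> \<le> 1 + u u. The relative
  size \<kappa> of the derivative is the small factor that is absorbed later.\<close>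

lemma om1_bound:
  assumes "0 \<le> \<kappa>" shows "\<bar>om1 \<kappa> z\<bar> \<le> \<kappa> * om \<kappa> z"
proof -
  let ?u = "\<kappa> * z"
  have "0 \<le> (\<bar>?u\<bar> - 1)\<^sup>2" by simp
  then have "2 * \<bar>?u\<bar> \<le> 1 + ?u\<^sup>2" by (simp add: power2_diff)
  then have "2 * \<bar>?u\<bar> * om \<kappa> z \<le> 1"
    by (simp add: om_def divide_le_eq add_pos_nonneg)
  then have "\<kappa> * om \<kappa> z * (2 * \<bar>?u\<bar> * om \<kappa> z) \<le> \<kappa> * om \<kappa> z * 1"
    using assms om_pos[of \<kappa> z] by (intro mult_left_mono) auto
  moreover have "\<bar>om1 \<kappa> z\<bar> = \<kappa> * om \<kappa> z * (2 * \<bar>?u\<bar> * om \<kappa> z)"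
    using assms om_pos[of \<kappa> z] by (simp add: om1_def abs_mult power2_eq_square mult_ac)
  ultimately show ?thesis by simp
qed

text \<open>Dividing by the square of \<kappa> \<open>om \<kappa> z\<close> leaves 8 v - 2, where v
  is the square of \<kappa> z times the weight and lies between 0 and 1.\<close>

lemma om2_bound: "\<bar>om2 \<kappa> z\<bar> \<le> 6 * \<kappa>\<^sup>2 * (om \<kappa> z)\<^sup>2"
proof -
  let ?u = "(\<kappa> * z)\<^sup>2 * om \<kappa> z"
  have u: "0 \<le> ?u" "?u \<le> 1"
    using om_pos[of \<kappa> z] by (auto simp: om_def divide_le_eq add_pos_nonneg)
  have "om2 \<kappa> z = (\<kappa>\<^sup>2 * (om \<kappa> z)\<^sup>2) * (8 * ?u - 2)"
    by (simp add: om2_def power2_eq_square power3_eq_cube power4_eq_xxxx algebra_simps)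
  also have "\<bar>\<dots>\<bar> \<le> (\<kappa>\<^sup>2 * (om \<kappa> z)\<^sup>2) * 6"
    unfolding abs_mult[of "\<kappa>\<^sup>2 * (om \<kappa> z)\<^sup>2"] by (rule mult_mono) (use u in auto)
  finally show ?thesis by simp
qed

lemma om_antimono:
  assumes "\<bar>z\<bar> \<le> N" shows "om \<kappa> N \<le> om \<kappa> z"
proof -
  have "(\<kappa> * z)\<^sup>2 \<le> (\<kappa> * N)\<^sup>2"
    unfolding power_mult_distrib using assms power_mono[of "\<bar>z\<bar>" N 2] by (intro mult_left_mono) auto
  then show ?thesis by (simp add: om_def frac_le add_pos_nonneg)
qed

text \<open>Completing the square: with b = \<nu> t t g, c = \<nu> Y and e = t t E, the difference
  of the two sides times \<nu> is half the square of b + c - e plus 3/2 of the squares of c and e,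
  as long as the last term carries t. That term alone is then enlarged to the weight
  \<open>o'\<close>. In the application \<open>t ^ 4 * g + t\<^sup>2 * Y\<close> is a gradient entry
  of the test field and \<open>Y\<close> its cutoff error.\<close>

lemma pointwise_energy:
  fixes \<nu> t o' g E Y :: real
  assumes \<nu>: "0 < \<nu>" and t: "0 \<le> t" "t \<le> o'"
  shows "\<nu> / 2 * (t ^ 4 * g\<^sup>2) - 2 * \<nu> * Y\<^sup>2 - 2 / \<nu> * (o' ^ 4 * E\<^sup>2) \<le> (\<nu> * g - E) * (t ^ 4 * g + t\<^sup>2 * Y)"
proof -
  define a where "a = t\<^sup>2 * g"
  define e where "e = E * t\<^sup>2"
  define b where "b = \<nu> * a"
  define c where "c = \<nu> * Y"
  have t4: "t ^ 4 = t\<^sup>2 * t\<^sup>2" by (simp add: power4_eq_xxxx power2_eq_square)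
  have "0 \<le> (b + c - e)\<^sup>2 / 2 + 3 / 2 * c\<^sup>2 + 3 / 2 * e\<^sup>2" by simp
  also have "\<dots> = \<nu> * ((\<nu> * g - E) * (t ^ 4 * g + t\<^sup>2 * Y) - (\<nu> / 2 * (t ^ 4 * g\<^sup>2) - 2 * \<nu> * Y\<^sup>2 - 2 / \<nu> * e\<^sup>2))"
    using \<nu> unfolding t4 by (simp add: a_def b_def c_def e_def field_simps power2_eq_square)
  finally have "\<nu> / 2 * (t ^ 4 * g\<^sup>2) - 2 * \<nu> * Y\<^sup>2 - 2 / \<nu> * e\<^sup>2 \<le> (\<nu> * g - E) * (t ^ 4 * g + t\<^sup>2 * Y)"
    using \<nu> by (simp add: zero_le_mult_iff)
  moreover have "2 / \<nu> * e\<^sup>2 \<le> 2 / \<nu> * (o' ^ 4 * E\<^sup>2)"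
  proof -
    have "e\<^sup>2 = t ^ 4 * E\<^sup>2" by (simp add: e_def power_mult_distrib flip: power_mult)
    also have "\<dots> \<le> o' ^ 4 * E\<^sup>2" by (intro mult_right_mono power_mono t) auto
    finally show ?thesis using \<nu> by (intro mult_left_mono) auto
  qed
  ultimately show ?thesis by linarith
qed

lemma sq_sum3_le: "((a::real) + b + c)\<^sup>2 \<le> 3 * (a\<^sup>2 + b\<^sup>2 + c\<^sup>2)"
proof -
  have "0 \<le> (a - b)\<^sup>2 + (b - c)\<^sup>2 + (a - c)\<^sup>2" by simp
  then show ?thesis by (simp add: power2_eq_square algebra_simps)
qed

context annulus begin

text \<open>The components are bounded by the Poincare inequality. The angular derivatives are r
  times the gradient entries 3, 4, 5, up to the frame terms \<open>w 1\<close> and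
  \<open>w 0\<close>. The bound for \<open>wt 0\<close> is separate because \<open>amp\<close> does
  not contain it, while recovering all components of \<open>u\<close> needs it.\<close>

lemma amp_le_grad:
  assumes w: "vfield w wr wt wz" and x: "x \<in> S"
  defines "y \<equiv> \<lambda>x. \<Sum>k<9. (grad w wr wt wz k x)\<^sup>2"
  shows "amp w wt x \<le> 5 * (R2 - R1) * rad_int y x + 4 * R2\<^sup>2 * y x"
    and "(wt 0 x)\<^sup>2 \<le> 2 * (R2 - R1) * rad_int y x + 2 * R2\<^sup>2 * y x"
    and "(\<Sum>i<3. (w i x)\<^sup>2) \<le> 3 * (R2 - R1) * rad_int y x"
proof -
  have v: "C1 (w i) (wr i) (wt i) (wz i)" "w i (R1, \<theta>, z) = 0" if "i < 3" for i \<theta> z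
    using w that by (auto simp: vfield_def)
  have cy: "cont y" unfolding y_def by (intro cont_sum cont_power cont_grad[OF w]) auto
  have gy: "(grad w wr wt wz k x)\<^sup>2 \<le> y x" if "k < 9" for k x
    unfolding y_def by (rule member_le_sum) (use that in auto)
  have L: "0 \<le> R2 - R1" using R1_less_R2 by simp
  have p': "(w i x)\<^sup>2 \<le> (R2 - R1) * rad_int y x" if "i < 3" for i
  proof -
    have "(w i x)\<^sup>2 \<le> (R2 - R1) * rad_int (\<lambda>x. (wr i x)\<^sup>2) x"
      by (rule poincare[OF v(1)[OF that] v(2)[OF that] x])
    also have "rad_int (\<lambda>x. (wr i x)\<^sup>2) x \<le> rad_int y x"
    proof (rule rad_int_mono)
      show "(wr i z)\<^sup>2 \<le> y z" for z using gy[of i z] that by (simp add: grad_def)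
    qed (use C1_D[OF v(1)[OF that]] cy in auto)
    finally show ?thesis using L by (simp add: mult_left_mono)
  qed
  have p: "(w 0 x)\<^sup>2 \<le> (R2 - R1) * rad_int y x" "(w 1 x)\<^sup>2 \<le> (R2 - R1) * rad_int y x"
    "(w 2 x)\<^sup>2 \<le> (R2 - R1) * rad_int y x"
    by (rule p'; simp)+
  have r: "0 < fst x" "fst x \<le> R2" using x R1_pos by (auto simp: closed_slab_def)
  have r2: "(fst x)\<^sup>2 \<le> R2\<^sup>2" using r by (intro power_mono) auto
  have y0: "0 \<le> y x" by (simp add: y_def sum_nonneg)
  have rg: "(fst x * grad w wr wt wz k x)\<^sup>2 \<le> R2\<^sup>2 * y x" if "k < 9" for k
    using mult_mono[OF r2 gy[OF that, of x]] by (simp add: power_mult_distrib)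
  have rg3: "(fst x * grad w wr wt wz 3 x)\<^sup>2 \<le> R2\<^sup>2 * y x"
    and rg4: "(fst x * grad w wr wt wz 4 x)\<^sup>2 \<le> R2\<^sup>2 * y x"
    by (rule rg; simp)+
  have e: "wt 0 x = fst x * grad w wr wt wz 3 x + w 1 x"
    "wt 1 x = fst x * grad w wr wt wz 4 x - w 0 x"
    "wt 2 x = fst x * grad w wr wt wz 5 x"
    using r by (simp_all add: grad_def)
  have q: "((a::real) + b)\<^sup>2 \<le> 2 * a\<^sup>2 + 2 * b\<^sup>2" "((a::real) - b)\<^sup>2 \<le> 2 * a\<^sup>2 + 2 * b\<^sup>2" for a b
    using zero_le_power2[of "a - b"] zero_le_power2[of "a + b"] by (simp_all add: power2_eq_square algebra_simps)
  show "(\<Sum>i<3. (w i x)\<^sup>2) \<le> 3 * (R2 - R1) * rad_int y x"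
    using p unfolding sum_lt_3 by linarith
  show "(wt 0 x)\<^sup>2 \<le> 2 * (R2 - R1) * rad_int y x + 2 * R2\<^sup>2 * y x"
    unfolding e(1) using q(1)[of "fst x * grad w wr wt wz 3 x" "w 1 x"] rg3 p(2) by linarith
  have "(wt 1 x)\<^sup>2 \<le> 2 * R2\<^sup>2 * y x + 2 * (R2 - R1) * rad_int y x"
    unfolding e(2) using q(2)[of "fst x * grad w wr wt wz 4 x" "w 0 x"] rg4 p(1) by linarith
  moreover have "(wt 2 x)\<^sup>2 \<le> R2\<^sup>2 * y x"
    unfolding e(3) by (rule rg) simp
  moreover have "0 \<le> R2\<^sup>2 * y x" using y0 by simp
  ultimately show "amp w wt x \<le> 5 * (R2 - R1) * rad_int y x + 4 * R2\<^sup>2 * y x"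
    using p unfolding amp_def by linarith
qed

lemma bint_axial_rad_int:
  assumes "cont f" "continuous_on UNIV g"
  shows "bint N (\<lambda>x. g (snd (snd x)) * rad_int f x) = (R2 - R1) * bint N (\<lambda>x. g (snd (snd x)) * f x)"
  unfolding rad_int_axial_mult[symmetric] by (rule bint_rad_int) (use assms in auto)

lemma bint_axial_ang_int:
  assumes "cont f" "continuous_on UNIV g"
  shows "bint N (\<lambda>x. g (snd (snd x)) * ang_int f x) = 2 * pi * bint N (\<lambda>x. g (snd (snd x)) * f x)"
  unfolding ang_int_axial_mult[symmetric] by (rule bint_ang_int) (use assms in auto)

text \<open>The divergence of \<phi> w is \<phi>' \<open>w 2\<close>, and the horizontal divergence
  of \<phi>' \<open>W\<close> cancels it. As \<open>W\<close> has no axial component, \<phi>'' does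
  not enter the divergence.\<close>

lemma cutoff_field:
  assumes w: "vfield w wr wt wz" and sol: "solenoidal w wr wt wz" and W: "vfield W Wr Wt Wz"
    and W2: "\<And>x. W 2 x = 0" "\<And>x. Wz 2 x = 0"
    and div: "\<And>r \<theta> z. R1 \<le> r \<Longrightarrow> r \<le> R2 \<Longrightarrow> Wr 0 (r, \<theta>, z) + (Wt 1 (r, \<theta>, z) + W 0 (r, \<theta>, z)) / r = w 2 (r, \<theta>, z)"
    and \<phi>: "\<And>z. (\<phi> has_real_derivative \<phi>1 z) (at z)" "\<And>z. (\<phi>1 has_real_derivative \<phi>2 z) (at z)"
      "continuous_on UNIV \<phi>2"
  defines "\<psi> \<equiv> \<lambda>i x. \<phi> (snd (snd x)) * w i x - \<phi>1 (snd (snd x)) * W i x"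
    and "\<psi>r \<equiv> \<lambda>i x. \<phi> (snd (snd x)) * wr i x - \<phi>1 (snd (snd x)) * Wr i x"
    and "\<psi>t \<equiv> \<lambda>i x. \<phi> (snd (snd x)) * wt i x - \<phi>1 (snd (snd x)) * Wt i x"
    and "\<psi>z \<equiv> \<lambda>i x. (\<phi> (snd (snd x)) * wz i x + \<phi>1 (snd (snd x)) * w i x) -
      (\<phi>1 (snd (snd x)) * Wz i x + \<phi>2 (snd (snd x)) * W i x)"
  shows "vfield \<psi> \<psi>r \<psi>t \<psi>z" "solenoidal \<psi> \<psi>r \<psi>t \<psi>z"
proof -
  have c1: "continuous_on UNIV \<phi>1" using \<phi>(2) DERIV_continuous_on by blast
  show "vfield \<psi> \<psi>r \<psi>t \<psi>z"
    unfolding vfield_def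
  proof (intro allI impI conjI)
    fix i :: nat assume i: "i < 3"
    have wi: "C1 (w i) (wr i) (wt i) (wz i)" "C1 (W i) (Wr i) (Wt i) (Wz i)" "per (w i)" "per (W i)"
      using w W i by (auto simp: vfield_def)
    show "C1 (\<psi> i) (\<psi>r i) (\<psi>t i) (\<psi>z i)"
      unfolding \<psi>_def
      by (rule C1_cong[OF C1_diff[OF C1_mult[OF C1_axial[OF c1 \<phi>(1)] wi(1)] C1_mult[OF C1_axial[OF \<phi>(3) \<phi>(2)] wi(2)]]])
        (auto simp: \<psi>r_def \<psi>t_def \<psi>z_def)
    show "per (\<psi> i)" using wi(3,4) by (simp add: \<psi>_def per_def theta_periodic_def)
    show "\<psi> i (R1, \<theta>, z) = 0" "\<psi> i (R2, \<theta>, z) = 0" for \<theta> z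
      using w W i by (auto simp: \<psi>_def vfield_def)
  qed
  show "solenoidal \<psi> \<psi>r \<psi>t \<psi>z"
    unfolding solenoidal_def Let_def
  proof (intro allI impI)
    fix r \<theta> z :: real assume r: "R1 \<le> r \<and> r \<le> R2"
    let ?x = "(r, \<theta>, z)"
    have "wr 0 ?x + (wt 1 ?x + w 0 ?x) / r + wz 2 ?x = 0" using sol r unfolding solenoidal_def Let_def by blast
    moreover have "Wr 0 ?x + (Wt 1 ?x + W 0 ?x) / r = w 2 ?x" using div r by blast
    moreover have "\<psi>r 0 ?x + (\<psi>t 1 ?x + \<psi> 0 ?x) / r + \<psi>z 2 ?x =
      \<phi> z * (wr 0 ?x + (wt 1 ?x + w 0 ?x) / r + wz 2 ?x) - \<phi>1 z * (Wr 0 ?x + (Wt 1 ?x + W 0 ?x) / r - w 2 ?x)"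
      unfolding \<psi>_def \<psi>r_def \<psi>t_def \<psi>z_def using W2
      by (simp add: algebra_simps add_divide_distrib diff_divide_distrib)
    ultimately show "\<psi>r 0 ?x + (\<psi>t 1 ?x + \<psi> 0 ?x) / r + \<psi>z 2 ?x = 0" by simp
  qed
qed

text \<open>\<open>E\<close> stands for the averaged nonlinear tensor; the identity is assumed for
  solenoidal tests only, so no pressure occurs in it. The constants are fixed before the field,
  \<open>M\<close> and \<open>N\<close>. The last summand is the price for a cutoff that vanishes at
  the ends.\<close>

lemma energy_estimate:
  assumes \<nu>: "0 < \<nu>"
  obtains \<kappa> C where "0 < \<kappa>" "0 \<le> C"
    "\<And>w wr wt wz E M N. vfield w wr wt wz \<Longrightarrow> solenoidal w wr wt wz \<Longrightarrow>
      (\<And>x. x \<in> S \<Longrightarrow> ang_int (rad_int (\<lambda>x. fst x * w 2 x)) x = 0) \<Longrightarrow>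
      (\<And>k. k < 9 \<Longrightarrow> cont (E k)) \<Longrightarrow>
      (\<And>x. x \<in> S \<Longrightarrow> amp w wt x \<le> M) \<Longrightarrow> 0 \<le> N \<Longrightarrow>
      (\<And>\<psi> \<psi>r \<psi>t \<psi>z. vfield \<psi> \<psi>r \<psi>t \<psi>z \<Longrightarrow> solenoidal \<psi> \<psi>r \<psi>t \<psi>z \<Longrightarrow>
        (\<And>i r \<theta>. i < 3 \<Longrightarrow> \<psi> i (r, \<theta>, N) = 0 \<and> \<psi> i (r, \<theta>, -N) = 0) \<Longrightarrow>
        bint N (\<lambda>x. fst x * (\<Sum>k<9. (\<nu> * grad w wr wt wz k x - E k x) * grad \<psi> \<psi>r \<psi>t \<psi>z k x)) = 0) \<Longrightarrow>
      bint N (\<lambda>x. (om \<kappa> (snd (snd x)) - om \<kappa> N) ^ 4 * (\<Sum>k<9. (grad w wr wt wz k x)\<^sup>2)) \<le>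
        C * (bint N (\<lambda>x. om \<kappa> (snd (snd x)) ^ 4 * (\<Sum>k<9. (E k x)\<^sup>2)) + M * N * om \<kappa> N)"
proof -
  obtain K where K: "0 \<le> K" and corr:
    "\<And>w wr wt wz. vfield w wr wt wz \<Longrightarrow> solenoidal w wr wt wz \<Longrightarrow>
      (\<And>x. x \<in> S \<Longrightarrow> ang_int (rad_int (\<lambda>x. fst x * w 2 x)) x = 0) \<Longrightarrow>
      \<exists>W Wr Wt Wz. vfield W Wr Wt Wz \<and> (\<forall>x. W 2 x = 0 \<and> Wz 2 x = 0) \<and>
        (\<forall>r \<theta> z. R1 \<le> r \<and> r \<le> R2 \<longrightarrow> Wr 0 (r, \<theta>, z) + (Wt 1 (r, \<theta>, z) + W 0 (r, \<theta>, z)) / r = w 2 (r, \<theta>, z)) \<and>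
        (\<forall>x\<in>S. corr_sq W Wr Wt Wz x \<le> K * (amp w wt x + rad_int (amp w wt) x + ang_int (rad_int (amp w wt)) x))"
    using corrector by blast
  define L where "L = R2 - R1"
  have L: "0 < L" using R1_less_R2 by (simp add: L_def)
  \<comment> \<open>\<open>K1\<close> is the corrector bound after integration: under an axial
    weight the radial and angular averages of \<open>amp\<close> cost the factors L and 2\<pi> L,
    and the final 1 is for \<open>amp\<close> itself. \<open>K2\<close> is the integrated form of
    \<open>amp_le_grad\<close>. \<open>D\<close> collects the coefficient of \<kappa> in the cutoff
    error, and \<kappa> is chosen so that \<kappa> D is at most R1 \<nu> / 4, half of the coercive
    coefficient.\<close>
  define K1 where "K1 = K * (1 + L + 2 * pi * L) + 1"
  define K2 where "K2 = 5 * L\<^sup>2 + 4 * R2\<^sup>2"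
  define D where "D = R2 * (2 * \<nu> * 3888) * K1 * K2"
  define \<kappa> where "\<kappa> = (R1 * \<nu> / 4) / (D + R1 * \<nu> / 4)"
  define C where "C = 4 / (R1 * \<nu>) * (R2 * (2 * \<nu> * 3888) * K1 * (16 * pi * L) + 2 * R2 / \<nu>)"
  have R2: "0 < R2" using R1_pos R1_less_R2 by simp
  have K1: "0 \<le> K1" using K L by (simp add: K1_def)
  have K2: "0 \<le> K2" by (simp add: K2_def)
  have D: "0 \<le> D" using R2 \<nu> K1 K2 by (simp add: D_def)
  have R1n: "0 < R1 * \<nu> / 4" using R1_pos \<nu> by simp
  have \<kappa>: "0 < \<kappa>" "\<kappa> \<le> 1" "\<kappa> * D \<le> R1 * \<nu> / 4"
  proof -
    show "0 < \<kappa>" "\<kappa> \<le> 1" using D R1n unfolding \<kappa>_def by (auto intro!: divide_pos_pos add_nonneg_pos)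
    have "D / (D + R1 * \<nu> / 4) \<le> 1" using D R1n by simp
    then have "(R1 * \<nu> / 4) * (D / (D + R1 * \<nu> / 4)) \<le> (R1 * \<nu> / 4) * 1"
      using R1n by (intro mult_left_mono) auto
    then show "\<kappa> * D \<le> R1 * \<nu> / 4" by (simp add: \<kappa>_def)
  qed
  have C: "0 \<le> C" unfolding C_def using R2 \<nu> K1 L R1_pos by simp
  show ?thesis
  proof (rule that[OF \<kappa>(1) C])
    fix w wr wt wz and E :: field and M N :: real
    assume w: "vfield w wr wt wz" and sol: "solenoidal w wr wt wz"
      and flux: "\<And>x. x \<in> S \<Longrightarrow> ang_int (rad_int (\<lambda>x. fst x * w 2 x)) x = 0"
      and cE: "\<And>k. k < 9 \<Longrightarrow> cont (E k)" and M: "\<And>x. x \<in> S \<Longrightarrow> amp w wt x \<le> M" and N: "0 \<le> N"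
      and weak: "\<And>\<psi> \<psi>r \<psi>t \<psi>z. vfield \<psi> \<psi>r \<psi>t \<psi>z \<Longrightarrow> solenoidal \<psi> \<psi>r \<psi>t \<psi>z \<Longrightarrow>
        (\<And>i r \<theta>. i < 3 \<Longrightarrow> \<psi> i (r, \<theta>, N) = 0 \<and> \<psi> i (r, \<theta>, -N) = 0) \<Longrightarrow>
        bint N (\<lambda>x. fst x * (\<Sum>k<9. (\<nu> * grad w wr wt wz k x - E k x) * grad \<psi> \<psi>r \<psi>t \<psi>z k x)) = 0"
    obtain W Wr Wt Wz where W: "vfield W Wr Wt Wz" and W2: "\<And>x. W 2 x = 0" "\<And>x. Wz 2 x = 0"
      and div: "\<And>r \<theta> z. R1 \<le> r \<Longrightarrow> r \<le> R2 \<Longrightarrow> Wr 0 (r, \<theta>, z) + (Wt 1 (r, \<theta>, z) + W 0 (r, \<theta>, z)) / r = w 2 (r, \<theta>, z)"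
      and bnd: "\<And>x. x \<in> S \<Longrightarrow> corr_sq W Wr Wt Wz x \<le> K * (amp w wt x + rad_int (amp w wt) x + ang_int (rad_int (amp w wt)) x)"
      using corr[OF w sol flux] by blast
    \<comment> \<open>\<open>t\<close> vanishes at \<open>\<plusminus>N\<close>, and its fourth power still leaves a factor \<open>t\<^sup>2\<close> in \<open>\<phi>''\<close>.\<close>
    define m where "m = om \<kappa> N"
    define t where "t = (\<lambda>z. om \<kappa> z - m)"
    define y1 where "y1 = (\<lambda>z. 4 * t z * om1 \<kappa> z)"
    define y2 where "y2 = (\<lambda>z. 12 * (om1 \<kappa> z)\<^sup>2 + 4 * t z * om2 \<kappa> z)"
    define \<phi> where "\<phi> = (\<lambda>z. t z ^ 4)"
    define \<phi>1 where "\<phi>1 = (\<lambda>z. (t z)\<^sup>2 * y1 z)"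
    define \<phi>2 where "\<phi>2 = (\<lambda>z. (t z)\<^sup>2 * y2 z)"
    have tD: "(t has_real_derivative om1 \<kappa> z) (at z)" for z
      unfolding t_def using DERIV_diff[OF om_deriv DERIV_const] by simp
    have \<phi>D: "(\<phi> has_real_derivative \<phi>1 z) (at z)" for z
      unfolding \<phi>_def \<phi>1_def y1_def
      by (rule derivative_eq_intros tD refl)+ (simp add: power2_eq_square power3_eq_cube)
    have \<phi>1D: "(\<phi>1 has_real_derivative \<phi>2 z) (at z)" for z
      unfolding \<phi>1_def \<phi>2_def y1_def y2_def
      by (rule derivative_eq_intros tD om1_deriv refl)+ (simp add: power2_eq_square power3_eq_cube algebra_simps)
    have ct: "continuous_on UNIV t" unfolding t_def by (intro continuous_intros om_continuous)
    have c\<phi>2: "continuous_on UNIV \<phi>2" unfolding \<phi>2_def y2_def by (intro continuous_intros om_continuous ct)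
    have cy: "continuous_on UNIV y1" "continuous_on UNIV y2"
      unfolding y1_def y2_def by (intro continuous_intros om_continuous ct)+
    define \<psi> where "\<psi> = (\<lambda>i x. \<phi> (snd (snd x)) * w i x - \<phi>1 (snd (snd x)) * W i x)"
    define \<psi>r where "\<psi>r = (\<lambda>i x. \<phi> (snd (snd x)) * wr i x - \<phi>1 (snd (snd x)) * Wr i x)"
    define \<psi>t where "\<psi>t = (\<lambda>i x. \<phi> (snd (snd x)) * wt i x - \<phi>1 (snd (snd x)) * Wt i x)"
    define \<psi>z where "\<psi>z = (\<lambda>i x. (\<phi> (snd (snd x)) * wz i x + \<phi>1 (snd (snd x)) * w i x) -
      (\<phi>1 (snd (snd x)) * Wz i x + \<phi>2 (snd (snd x)) * W i x))"
    note cf = cutoff_field[OF w sol W W2 div \<phi>D \<phi>1D c\<phi>2, folded \<psi>_def \<psi>r_def \<psi>t_def \<psi>z_def]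
    define g where "g = grad w wr wt wz"
    define h where "h = grad W Wr Wt Wz"
    \<comment> \<open>The cutoff error: the gradient of \<psi> is \<open>t ^ 4\<close> times
      \<open>g\<close> plus the square of \<open>t\<close> times \<open>Y\<close>. Only the axial
      entries, from 6 on, contain derivatives that fall on the cutoff itself.\<close>
    define Y where "Y = (\<lambda>k x. (if k < 6 then - (y1 (snd (snd x)) * h k x) else
       - (y1 (snd (snd x)) * h k x) + y1 (snd (snd x)) * w (k - 6) x - y2 (snd (snd x)) * W (k - 6) x))"
    have tN: "t N = 0" "t (-N) = 0" by (auto simp: t_def m_def om_def)
    have g\<psi>: "grad \<psi> \<psi>r \<psi>t \<psi>z k x = t (snd (snd x)) ^ 4 * g k x + (t (snd (snd x)))\<^sup>2 * Y k x" for k x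
    proof -
      consider "k < 3" | "k = 3" | "k = 4" | "k = 5" | "k \<ge> 6" by linarith
      then show ?thesis
        by cases (auto simp: grad_def \<psi>_def \<psi>r_def \<psi>t_def \<psi>z_def g_def h_def Y_def \<phi>_def \<phi>1_def \<phi>2_def
          algebra_simps add_divide_distrib diff_divide_distrib)
    qed
    have cg: "cont (g k)" "cont (h k)" if "k < 9" for k
      using that cont_grad[OF w] cont_grad[OF W] by (auto simp: g_def h_def)
    have cw: "cont (w i)" "cont (wt i)" "cont (W i)" if "i < 3" for i
      using w W that by (auto simp: vfield_def C1_def)
    have cY: "cont (Y k)" if "k < 9" for k
    proof (cases "k < 6")
      case True then show ?thesis using cg[OF that] cy by (auto simp: Y_def)
    next
      case False
      then have "k - 6 < 3" using that by simp
      then show ?thesis using cg[OF that] cw[of "k - 6"] cy False by (auto simp: Y_def)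
    qed
    define yy where "yy = (\<lambda>x. \<Sum>k<9. (g k x)\<^sup>2)"
    define EE where "EE = (\<lambda>x. \<Sum>k<9. (E k x)\<^sup>2)"
    define YY where "YY = (\<lambda>x. \<Sum>k<9. (Y k x)\<^sup>2)"
    have cyy: "cont yy" "cont EE" "cont YY"
      unfolding yy_def EE_def YY_def by (intro cont_sum cont_power cg cE cY; simp)+
    have nn: "0 \<le> yy x" "0 \<le> EE x" "0 \<le> YY x" for x
      by (simp_all add: yy_def EE_def YY_def sum_nonneg)
    have tt: "0 \<le> t z" "t z \<le> om \<kappa> z" if "-N \<le> z" "z \<le> N" for z
      using om_antimono[of z N \<kappa>] that om_pos[of \<kappa> N] by (auto simp: t_def m_def)
    have cT: "cont (\<lambda>x. t (snd (snd x)) ^ 4)" "cont (\<lambda>x. om \<kappa> (snd (snd x)) ^ 4)"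
      by (intro cont_power cont_zz[OF ct] cont_zz[OF om_continuous(1)])+
    define a where "a = amp w wt"
    have ca: "cont a" unfolding a_def amp_def by (intro cont_add cont_power cw) auto
    have a0: "0 \<le> a x" for x by (simp add: a_def amp_def)
    define Ta where "Ta = bint N (\<lambda>x. t (snd (snd x)) ^ 4 * yy x)"
    define F where "F = bint N (\<lambda>x. om \<kappa> (snd (snd x)) ^ 4 * EE x)"
    define A where "A = bint N (\<lambda>x. om \<kappa> (snd (snd x)) ^ 4 * a x)"
    \<comment> \<open>Sum of \<open>pointwise_energy\<close> over the nine entries. The volume
      factor r is replaced by R1 in the coercive part and by R2 in the error part.\<close>
    have step1: "R1 * \<nu> / 2 * Ta \<le> R2 * (2 * \<nu>) * bint N YY + R2 * (2 / \<nu>) * F"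
    proof -
      have "0 = bint N (\<lambda>x. fst x * (\<Sum>k<9. (\<nu> * g k x - E k x) * grad \<psi> \<psi>r \<psi>t \<psi>z k x))"
        unfolding g_def
        by (rule weak[OF cf, symmetric]) (simp_all add: \<psi>_def \<phi>_def \<phi>1_def tN)
      also have "\<dots> \<ge> bint N (\<lambda>x. (R1 * \<nu> / 2) * (t (snd (snd x)) ^ 4 * yy x)
          - ((R2 * (2 * \<nu>)) * YY x + (R2 * (2 / \<nu>)) * (om \<kappa> (snd (snd x)) ^ 4 * EE x)))"
      proof (rule bint_mono)
        show "cont (\<lambda>x. fst x * (\<Sum>k<9. (\<nu> * g k x - E k x) * grad \<psi> \<psi>r \<psi>t \<psi>z k x))"
          by (intro cont_mult cont_r cont_sum cont_diff cont_const cg cE cont_grad[OF cf(1)]) auto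
        show "cont (\<lambda>x. (R1 * \<nu> / 2) * (t (snd (snd x)) ^ 4 * yy x)
          - ((R2 * (2 * \<nu>)) * YY x + (R2 * (2 / \<nu>)) * (om \<kappa> (snd (snd x)) ^ 4 * EE x)))"
          by (intro cont_diff cont_add cont_mult cont_const cT cyy)
        fix r \<theta> z :: real assume r: "R1 \<le> r" "r \<le> R2" and z: "-N \<le> z" "z \<le> N"
        let ?x = "(r, \<theta>, z)"
        have "(\<nu> / 2) * (t z ^ 4 * yy ?x) - (2 * \<nu> * YY ?x + 2 / \<nu> * (om \<kappa> z ^ 4 * EE ?x)) =
           (\<Sum>k<9. \<nu> / 2 * (t z ^ 4 * (g k ?x)\<^sup>2) - 2 * \<nu> * (Y k ?x)\<^sup>2 - 2 / \<nu> * (om \<kappa> z ^ 4 * (E k ?x)\<^sup>2))"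
          by (simp add: yy_def YY_def EE_def sum_distrib_left sum_subtractf)
        also have "\<dots> \<le> (\<Sum>k<9. (\<nu> * g k ?x - E k ?x) * grad \<psi> \<psi>r \<psi>t \<psi>z k ?x)"
          unfolding g\<psi> snd_conv by (intro sum_mono pointwise_energy \<nu> tt z)
        finally have le: "(\<nu> / 2) * (t z ^ 4 * yy ?x) - (2 * \<nu> * YY ?x + 2 / \<nu> * (om \<kappa> z ^ 4 * EE ?x)) \<le>
          (\<Sum>k<9. (\<nu> * g k ?x - E k ?x) * grad \<psi> \<psi>r \<psi>t \<psi>z k ?x)" .
        have n1: "0 \<le> (\<nu> / 2) * (t z ^ 4 * yy ?x)"
          using \<nu> nn tt[OF z] by (intro mult_nonneg_nonneg) auto
        have n2: "0 \<le> 2 * \<nu> * YY ?x + 2 / \<nu> * (om \<kappa> z ^ 4 * EE ?x)"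
          using \<nu> nn om_pos[of \<kappa> z] by (intro add_nonneg_nonneg mult_nonneg_nonneg) auto
        have "R1 * ((\<nu> / 2) * (t z ^ 4 * yy ?x)) - R2 * (2 * \<nu> * YY ?x + 2 / \<nu> * (om \<kappa> z ^ 4 * EE ?x))
          \<le> r * ((\<nu> / 2) * (t z ^ 4 * yy ?x)) - r * (2 * \<nu> * YY ?x + 2 / \<nu> * (om \<kappa> z ^ 4 * EE ?x))"
          by (intro diff_mono mult_right_mono r n1 n2)
        also have "\<dots> \<le> r * (\<Sum>k<9. (\<nu> * g k ?x - E k ?x) * grad \<psi> \<psi>r \<psi>t \<psi>z k ?x)"
          unfolding right_diff_distrib[symmetric] using le r R1_pos by (intro mult_left_mono) auto
        finally show "(R1 * \<nu> / 2) * (t (snd (snd ?x)) ^ 4 * yy ?x)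
          - ((R2 * (2 * \<nu>)) * YY ?x + (R2 * (2 / \<nu>)) * (om \<kappa> (snd (snd ?x)) ^ 4 * EE ?x)) \<le>
          fst ?x * (\<Sum>k<9. (\<nu> * g k ?x - E k ?x) * grad \<psi> \<psi>r \<psi>t \<psi>z k ?x)"
          by (simp add: distrib_left mult.assoc)
      qed
      finally have "bint N (\<lambda>x. (R1 * \<nu> / 2) * (t (snd (snd x)) ^ 4 * yy x)
          - ((R2 * (2 * \<nu>)) * YY x + (R2 * (2 / \<nu>)) * (om \<kappa> (snd (snd x)) ^ 4 * EE x))) \<le> 0" .
      moreover have "bint N (\<lambda>x. (R1 * \<nu> / 2) * (t (snd (snd x)) ^ 4 * yy x)
          - ((R2 * (2 * \<nu>)) * YY x + (R2 * (2 / \<nu>)) * (om \<kappa> (snd (snd x)) ^ 4 * EE x))) =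
          (R1 * \<nu> / 2) * Ta - ((R2 * (2 * \<nu>)) * bint N YY + (R2 * (2 / \<nu>)) * F)"
        unfolding Ta_def F_def
        by (subst bint_diff, (intro cont_add cont_mult cont_const cT cyy)+, subst bint_add,
            (intro cont_mult cont_const cT cyy)+) (simp only: bint_cmult)
      ultimately show ?thesis by simp
    qed
    \<comment> \<open>Both \<open>y1\<close> and \<open>y2\<close> are at most 36 \<kappa> times the
      squared weight: 36 is 12 + 24 from the two summands of \<open>y2\<close>, and \<kappa> \<le> 1
      reduces \<kappa> squared to \<kappa>. Squaring gives 1296, and a sum of three terms in the
      axial entries gives 3888.\<close>
    have YYb: "YY x \<le> 3888 * \<kappa> * (om \<kappa> (snd (snd x)) ^ 4 * (corr_sq W Wr Wt Wz x + a x))"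
      if zz: "-N \<le> snd (snd x)" "snd (snd x) \<le> N" for x
    proof -
      let ?z = "snd (snd x)"
      let ?o = "om \<kappa> ?z"
      have o: "0 < ?o" "?o \<le> 1" by (rule om_pos om_le_1)+
      have o1: "\<bar>om1 \<kappa> ?z\<bar> \<le> \<kappa> * ?o" using om1_bound \<kappa> by simp
      have o2: "\<bar>om2 \<kappa> ?z\<bar> \<le> 6 * \<kappa>\<^sup>2 * ?o\<^sup>2" by (rule om2_bound)
      have \<kappa>2: "\<kappa>\<^sup>2 \<le> \<kappa>" using \<kappa> by (simp add: power2_eq_square mult_left_le)
      have t: "\<bar>t ?z\<bar> \<le> ?o" "\<bar>t ?z\<bar> \<le> 1" using tt[OF zz] o by auto
      have "\<bar>y1 ?z\<bar> \<le> 4 * ?o * (\<kappa> * ?o)"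
        unfolding y1_def by (intro abs_mult_le o1) (use t in auto)
      also have "\<dots> = 4 * (\<kappa> * ?o\<^sup>2)" by (simp add: power2_eq_square)
      also have "\<dots> \<le> 36 * (\<kappa> * ?o\<^sup>2)" using \<kappa> by (intro mult_right_mono) auto
      finally have y1b: "\<bar>y1 ?z\<bar> \<le> 36 * (\<kappa> * ?o\<^sup>2)" .
      have "\<bar>y2 ?z\<bar> \<le> 12 * ((\<kappa> * ?o) * (\<kappa> * ?o)) + 4 * 1 * (6 * \<kappa>\<^sup>2 * ?o\<^sup>2)"
        unfolding y2_def power2_eq_square[of "om1 \<kappa> ?z"]
        by (intro abs_add_le abs_mult_le o1 o2) (use t in auto)
      also have "\<dots> = 36 * (\<kappa>\<^sup>2 * ?o\<^sup>2)" by (simp add: power2_eq_square)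
      also have "\<dots> \<le> 36 * (\<kappa> * ?o\<^sup>2)" using \<kappa>2 by (simp add: mult_right_mono)
      finally have y2b: "\<bar>y2 ?z\<bar> \<le> 36 * (\<kappa> * ?o\<^sup>2)" .
      define c where "c = (36 * (\<kappa> * ?o\<^sup>2))\<^sup>2"
      have c0: "0 \<le> c" by (simp add: c_def)
      have sq: "(y1 ?z)\<^sup>2 \<le> c" "(y2 ?z)\<^sup>2 \<le> c"
        using power_mono[OF y1b abs_ge_zero, of 2] power_mono[OF y2b abs_ge_zero, of 2]
        by (simp_all only: c_def power2_abs)
      have cc: "c \<le> 1296 * \<kappa> * ?o ^ 4"
      proof -
        have "c = 1296 * (\<kappa>\<^sup>2 * ?o ^ 4)" by (simp add: c_def power_mult_distrib flip: power_mult)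
        also have "\<dots> \<le> 1296 * (\<kappa> * ?o ^ 4)" using \<kappa>2 o by (simp add: mult_right_mono)
        finally show ?thesis by simp
      qed
      have m1: "(y1 ?z * b)\<^sup>2 \<le> c * b\<^sup>2" "(y2 ?z * b)\<^sup>2 \<le> c * b\<^sup>2" for b
        using sq by (simp_all add: power_mult_distrib mult_right_mono)
      have YA: "(Y k x)\<^sup>2 \<le> 3 * c * (h k x)\<^sup>2" if "k < 6" for k
      proof -
        have "(Y k x)\<^sup>2 = (y1 ?z * h k x)\<^sup>2" using that by (simp add: Y_def)
        then show ?thesis
          using m1(1)[of "h k x"] mult_nonneg_nonneg[OF c0 zero_le_power2[of "h k x"]] by linarith
      qed
      have YB: "(Y k x)\<^sup>2 \<le> 3 * c * (h k x)\<^sup>2 + 3 * c * (w (k - 6) x)\<^sup>2 + 3 * c * (W (k - 6) x)\<^sup>2" if "\<not> k < 6" for k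
        using sq_sum3_le[of "- (y1 ?z * h k x)" "y1 ?z * w (k - 6) x" "- (y2 ?z * W (k - 6) x)"]
          m1(1)[of "h k x"] m1(1)[of "w (k - 6) x"] m1(2)[of "W (k - 6) x"] that
        by (simp add: Y_def)
      have "YY x \<le> 3 * c * ((\<Sum>k<9. (h k x)\<^sup>2) + (\<Sum>i<3. (W i x)\<^sup>2) + ((w 0 x)\<^sup>2 + (w 1 x)\<^sup>2 + (w 2 x)\<^sup>2))"
        unfolding YY_def sum_lt_9 sum_lt_3
        using YA[of 0] YA[of 1] YA[of 2] YA[of 3] YA[of 4] YA[of 5] YB[of 6] YB[of 7] YB[of 8]
        by (simp add: distrib_left)
      also have "\<dots> \<le> 3 * c * (corr_sq W Wr Wt Wz x + a x)"
        using c0 by (intro mult_left_mono) (auto simp: corr_sq_def h_def a_def amp_def)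
      also have "\<dots> \<le> 3 * (1296 * \<kappa> * ?o ^ 4) * (corr_sq W Wr Wt Wz x + a x)"
        using cc a0[of x] by (intro mult_right_mono mult_left_mono) (auto simp: corr_sq_def sum_nonneg)
      finally show ?thesis by (simp add: mult_ac)
    qed
    \<comment> \<open>The pointwise bound contains averages of \<open>a\<close>. Since the weight
      depends on z only, their weighted integrals are multiples of \<open>A\<close>.\<close>
    have YYi: "bint N YY \<le> 3888 * \<kappa> * (K1 * A)"
    proof -
      have cra: "cont (rad_int a)" "cont (ang_int (rad_int a))" using ca by auto
      have "bint N YY \<le> bint N (\<lambda>x. (3888 * \<kappa>) * (om \<kappa> (snd (snd x)) ^ 4 *
          (K * (a x + rad_int a x + ang_int (rad_int a) x) + a x)))"
      proof (rule bint_mono)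
        show "cont (\<lambda>x. (3888 * \<kappa>) * (om \<kappa> (snd (snd x)) ^ 4 *
          (K * (a x + rad_int a x + ang_int (rad_int a) x) + a x)))"
          by (intro cont_mult cont_add cont_const cT ca cra)
        fix r \<theta> z :: real assume r: "R1 \<le> r" "r \<le> R2" and z: "-N \<le> z" "z \<le> N"
        let ?x = "(r, \<theta>, z)"
        have "YY ?x \<le> 3888 * \<kappa> * (om \<kappa> z ^ 4 * (corr_sq W Wr Wt Wz ?x + a ?x))" using YYb[of ?x] z by simp
        also have "\<dots> \<le> 3888 * \<kappa> * (om \<kappa> z ^ 4 * (K * (a ?x + rad_int a ?x + ang_int (rad_int a) ?x) + a ?x))"
          using bnd[of ?x] r \<kappa> om_pos[of \<kappa> z] by (intro mult_left_mono add_right_mono) (auto simp: a_def S_iff)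
        finally show "YY ?x \<le> 3888 * \<kappa> * (om \<kappa> (snd (snd ?x)) ^ 4 *
          (K * (a ?x + rad_int a ?x + ang_int (rad_int a) ?x) + a ?x))" by simp
      qed (rule cyy)
      also have "\<dots> = 3888 * \<kappa> * bint N (\<lambda>x. K * (om \<kappa> (snd (snd x)) ^ 4 * a x + om \<kappa> (snd (snd x)) ^ 4 * rad_int a x
          + om \<kappa> (snd (snd x)) ^ 4 * ang_int (rad_int a) x) + om \<kappa> (snd (snd x)) ^ 4 * a x)"
        unfolding bint_cmult by (simp add: algebra_simps)
      also have "bint N (\<lambda>x. K * (om \<kappa> (snd (snd x)) ^ 4 * a x + om \<kappa> (snd (snd x)) ^ 4 * rad_int a x
          + om \<kappa> (snd (snd x)) ^ 4 * ang_int (rad_int a) x) + om \<kappa> (snd (snd x)) ^ 4 * a x) =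
          K * (A + L * A + 2 * pi * (L * A)) + A"
      proof -
        have o4: "continuous_on UNIV (\<lambda>z. om \<kappa> z ^ 4)" by (intro continuous_intros om_continuous)
        note b1 = bint_axial_rad_int[OF ca o4, of N, folded L_def A_def]
        note b2 = bint_axial_ang_int[OF cra(1) o4, of N, unfolded b1]
        show ?thesis
          by (subst bint_add, (intro cont_mult cont_add cont_const cT ca cra)+,
              subst bint_cmult, subst bint_add, (intro cont_mult cont_add cont_const cT ca cra)+,
              subst bint_add, (intro cont_mult cont_add cont_const cT ca cra)+)
            (simp only: b1 b2 A_def[symmetric])
      qed
      finally show ?thesis by (simp add: K1_def algebra_simps)
    qed
    \<comment> \<open>The fourth powers of the weight and of \<open>t\<close> differ by
      \<open>m\<close> times a factor that is at most 4, because 0 \<le> t \<le> \<omega> \<le> 1.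
      That excess is paid with the bound \<open>M\<close> over the volume 4\<pi> L N.\<close>
    have Ab: "A \<le> K2 * Ta + 16 * pi * L * (M * N * m)"
    proof -
      have "A \<le> bint N (\<lambda>x. t (snd (snd x)) ^ 4 * a x + 4 * m * M)"
        unfolding A_def
      proof (rule bint_mono)
        fix r \<theta> z :: real assume r: "R1 \<le> r" "r \<le> R2" and z: "-N \<le> z" "z \<le> N"
        let ?x = "(r, \<theta>, z)" and ?o = "om \<kappa> z"
        have o: "0 < ?o" "?o \<le> 1" by (rule om_pos om_le_1)+
        have m0: "0 \<le> m" using om_pos[of \<kappa> N] by (simp add: m_def)
        have "?o ^ 4 - t z ^ 4 = m * ((?o + t z) * (?o\<^sup>2 + (t z)\<^sup>2))"
          by (simp add: t_def power4_eq_xxxx power2_eq_square algebra_simps)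
        also have "\<dots> \<le> m * (2 * 2)"
          using tt[OF z] o m0 power_le_one[of ?o 2] power_le_one[of "t z" 2] by (intro mult_left_mono mult_mono) auto
        finally have "?o ^ 4 \<le> t z ^ 4 + 4 * m" by simp
        then have "?o ^ 4 * a ?x \<le> (t z ^ 4 + 4 * m) * a ?x" using a0 by (rule mult_right_mono)
        also have "\<dots> = t z ^ 4 * a ?x + (4 * m) * a ?x" by (simp add: algebra_simps)
        also have "\<dots> \<le> t z ^ 4 * a ?x + (4 * m) * M"
          using M[of ?x] r m0 by (intro add_left_mono mult_left_mono) (auto simp: a_def S_iff)
        finally show "om \<kappa> (snd (snd ?x)) ^ 4 * a ?x \<le> t (snd (snd ?x)) ^ 4 * a ?x + 4 * m * M" by simp
      qed (intro cont_add cont_mult cont_const cT ca)+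
      also have "\<dots> = bint N (\<lambda>x. t (snd (snd x)) ^ 4 * a x) + 16 * pi * L * (M * N * m)"
        using N by (subst bint_add, (intro cont_mult cont_const cT ca)+) (simp add: bint_const L_def)
      also have "bint N (\<lambda>x. t (snd (snd x)) ^ 4 * a x) \<le>
          bint N (\<lambda>x. (5 * L) * (t (snd (snd x)) ^ 4 * rad_int yy x) + (4 * R2\<^sup>2) * (t (snd (snd x)) ^ 4 * yy x))"
      proof (rule bint_mono)
        show "cont (\<lambda>x. t (snd (snd x)) ^ 4 * a x)" by (intro cont_mult cT ca)
        show "cont (\<lambda>x. (5 * L) * (t (snd (snd x)) ^ 4 * rad_int yy x) + (4 * R2\<^sup>2) * (t (snd (snd x)) ^ 4 * yy x))"
          by (intro cont_add cont_mult cont_const cT cyy cont_rad_int)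
        fix r \<theta> z :: real assume r: "R1 \<le> r" "r \<le> R2"
        let ?x = "(r, \<theta>, z)"
        have "a ?x \<le> 5 * L * rad_int yy ?x + 4 * R2\<^sup>2 * yy ?x"
          using amp_le_grad(1)[OF w, of ?x] r by (simp add: a_def S_iff yy_def[abs_def] g_def L_def)
        then have "t z ^ 4 * a ?x \<le> t z ^ 4 * (5 * L * rad_int yy ?x + 4 * R2\<^sup>2 * yy ?x)"
          by (rule mult_left_mono) simp
        then show "t (snd (snd ?x)) ^ 4 * a ?x \<le>
          (5 * L) * (t (snd (snd ?x)) ^ 4 * rad_int yy ?x) + (4 * R2\<^sup>2) * (t (snd (snd ?x)) ^ 4 * yy ?x)"
          by (simp add: algebra_simps)
      qed
      also have "\<dots> = K2 * Ta"
      proof -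
        have t4: "continuous_on UNIV (\<lambda>z. t z ^ 4)" by (intro continuous_intros ct)
        have "bint N (\<lambda>x. (5 * L) * (t (snd (snd x)) ^ 4 * rad_int yy x) + (4 * R2\<^sup>2) * (t (snd (snd x)) ^ 4 * yy x)) =
            (5 * L) * (L * Ta) + (4 * R2\<^sup>2) * Ta"
          by (subst bint_add, (intro cont_mult cont_const cT cyy cont_rad_int)+)
            (simp only: bint_cmult bint_axial_rad_int[OF cyy(1) t4, folded L_def] Ta_def[symmetric])
        then show ?thesis by (simp add: K2_def power2_eq_square algebra_simps)
      qed
      finally show ?thesis by simp
    qed
    have Ta0: "0 \<le> Ta" unfolding Ta_def
      by (rule bint_nonneg) (auto intro!: cont_mult cT cyy mult_nonneg_nonneg nn)
    have M0: "0 \<le> M" using M[of "(R1, 0, 0)"] a0[of "(R1, 0, 0)"] R1_less_R2 by (simp add: a_def S_iff)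
    have m0: "0 \<le> m" using om_pos[of \<kappa> N] by (simp add: m_def)
    have mm: "0 \<le> M * N * m" using M0 N m0 by simp
    have F0: "0 \<le> F" unfolding F_def
      by (rule bint_nonneg) (auto intro!: cont_mult cT cyy mult_nonneg_nonneg nn)
    have "R1 * \<nu> / 2 * Ta \<le> R2 * (2 * \<nu>) * (3888 * \<kappa> * (K1 * (K2 * Ta + 16 * pi * L * (M * N * m)))) + R2 * (2 / \<nu>) * F"
    proof -
      have "3888 * \<kappa> * (K1 * A) \<le> 3888 * \<kappa> * (K1 * (K2 * Ta + 16 * pi * L * (M * N * m)))"
        using Ab \<kappa> K1 by (intro mult_left_mono) auto
      then have "bint N YY \<le> 3888 * \<kappa> * (K1 * (K2 * Ta + 16 * pi * L * (M * N * m)))" using YYi by linarith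
      then have "R2 * (2 * \<nu>) * bint N YY \<le> R2 * (2 * \<nu>) * (3888 * \<kappa> * (K1 * (K2 * Ta + 16 * pi * L * (M * N * m))))"
        using R2 \<nu> by (intro mult_left_mono) auto
      then show ?thesis using step1 by linarith
    qed
    also have "\<dots> = (\<kappa> * D) * Ta + \<kappa> * (R2 * (2 * \<nu> * 3888) * K1 * (16 * pi * L) * (M * N * m)) + (2 * R2 / \<nu>) * F"
      by (simp add: D_def algebra_simps)
    also have "\<dots> \<le> (R1 * \<nu> / 4) * Ta + 1 * (R2 * (2 * \<nu> * 3888) * K1 * (16 * pi * L) * (M * N * m)) + (2 * R2 / \<nu>) * F"
      using \<kappa> Ta0 F0 mm R2 \<nu> K1 L by (intro add_mono mult_right_mono) auto
    finally have "(R1 * \<nu> / 4) * Ta \<le> R2 * (2 * \<nu> * 3888) * K1 * (16 * pi * L) * (M * N * m) + (2 * R2 / \<nu>) * F"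
      by linarith
    also have "\<dots> \<le> (R2 * (2 * \<nu> * 3888) * K1 * (16 * pi * L) + 2 * R2 / \<nu>) * (F + M * N * m)"
    proof -
      have "0 \<le> R2 * (2 * \<nu> * 3888) * K1 * (16 * pi * L) * F" "0 \<le> 2 * R2 / \<nu> * (M * N * m)"
        using R2 \<nu> K1 L F0 mm by auto
      moreover have "P * b + Q * f \<le> (P + Q) * (f + b)" if "0 \<le> P * f" "0 \<le> Q * b" for P Q b f :: real
        using that by (simp add: algebra_simps)
      ultimately show ?thesis by blast
    qed
    finally have "(4 / (R1 * \<nu>)) * ((R1 * \<nu> / 4) * Ta) \<le> (4 / (R1 * \<nu>)) *
        ((R2 * (2 * \<nu> * 3888) * K1 * (16 * pi * L) + 2 * R2 / \<nu>) * (F + M * N * m))"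
      using R1_pos \<nu> by (intro mult_left_mono) auto
    moreover have "(4 / (R1 * \<nu>)) * ((R1 * \<nu> / 4) * Ta) = Ta" using R1_pos \<nu> by simp
    ultimately have "Ta \<le> C * (F + M * N * m)" unfolding C_def mult.assoc[of "4 / (R1 * \<nu>)"] by simp
    then show "bint N (\<lambda>x. (om \<kappa> (snd (snd x)) - om \<kappa> N) ^ 4 * (\<Sum>k<9. (grad w wr wt wz k x)\<^sup>2)) \<le>
        C * (bint N (\<lambda>x. om \<kappa> (snd (snd x)) ^ 4 * (\<Sum>k<9. (E k x)\<^sup>2)) + M * N * om \<kappa> N)"
      by (simp add: Ta_def F_def t_def m_def yy_def EE_def g_def)
  qed
qed


section \<open>Vanishing of small perturbations\<close>

lemma ang_rad_swap:
  assumes f: "cont f"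
  shows "ang_int (rad_int f) x = rad_int (ang_int f) x"
proof -
  obtain r \<theta> z where x: "x = (r, \<theta>, z)" by (cases x)
  have "integral (cbox 0 (2*pi)) (\<lambda>t. integral (cbox R1 R2) (\<lambda>s. f (s, t, z))) =
      integral (cbox R1 R2) (\<lambda>s. integral (cbox 0 (2*pi)) (\<lambda>t. f (s, t, z)))"
    by (rule integral_swap_continuous, unfold case_prod_unfold, rule cont_compose[OF f])
      (auto simp: cbox_Pair_eq intro!: continuous_intros)
  then show ?thesis by (simp add: x ang_int_def rad_int_def)
qed

lemma rad_int_cong:
  assumes "\<And>x. x \<in> S \<Longrightarrow> f x = g x" shows "rad_int f x = rad_int g x"
  unfolding rad_int_def using assms by (cases x) (auto intro!: integral_cong simp: S_iff)

text \<open>Averaging in \<theta> multiplies the flux by the mass of the kernel, so the corrector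
  can also be built for the averaged field.\<close>

lemma saw_flux:
  assumes f: "cont f" "per f" and 0: "\<And>x. x \<in> S \<Longrightarrow> ang_int (rad_int (\<lambda>x. fst x * f x)) x = 0" and x: "x \<in> S"
  shows "ang_int (rad_int (\<lambda>x. fst x * saw f x)) x = 0"
proof -
  have a: "ang_int (\<lambda>x. fst x * g x) = (\<lambda>y. fst y * ang_int g y)" for g
    by (auto simp: ang_int_def)
  have "ang_int (rad_int (\<lambda>x. fst x * saw f x)) x = rad_int (\<lambda>x. fst x * ang_int (saw f) x) x"
    using f by (subst ang_rad_swap) (auto simp: a)
  also have "\<dots> = rad_int (\<lambda>x. (2 * pi\<^sup>2) * ang_int (\<lambda>x. fst x * f x) x) x"
    by (rule rad_int_cong) (auto simp: a ang_int_saw[OF f] closed_slab_def)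
  also have "\<dots> = 2 * pi\<^sup>2 * ang_int (rad_int (\<lambda>x. fst x * f x)) x"
    using f by (subst ang_rad_swap) (auto simp: rad_int_cmult)
  finally show ?thesis using 0[OF x] by simp
qed

lemma saw_grad:
  assumes u: "vfield u ur ut uz" and x: "x \<in> S" and k: "k < 9"
  shows "grad (\<lambda>i. saw (u i)) (\<lambda>i. saw (ur i)) (\<lambda>i. saw (ut i)) (\<lambda>i. saw (uz i)) k x = saw (grad u ur ut uz k) x"
proof -
  have c: "cont (u i)" "cont (ut i)" if "i < 3" for i using u that by (auto simp: vfield_def C1_def)
  have d: "saw (\<lambda>x. f x / fst x) x = saw f x / fst x" for f
    using saw_rmult[of "\<lambda>r. 1 / r" f x] by simp
  consider "k < 3" | "k = 3" | "k = 4" | "k = 5" | "k \<ge> 6" by linarith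
  then show ?thesis
  proof cases
    case 1
    then have "grad u ur ut uz k = ur k" by (auto simp: grad_def)
    then show ?thesis using 1 by (simp add: grad_def)
  next
    case 2
    then have "grad u ur ut uz k = (\<lambda>x. (ut 0 x - u 1 x) / fst x)" by (auto simp: grad_def)
    then show ?thesis using 2 c x by (simp add: grad_def d saw_diff)
  next
    case 3
    then have "grad u ur ut uz k = (\<lambda>x. (ut 1 x + u 0 x) / fst x)" by (auto simp: grad_def)
    then show ?thesis using 3 c x by (simp add: grad_def d saw_add)
  next
    case 4
    then have "grad u ur ut uz k = (\<lambda>x. ut 2 x / fst x)" by (auto simp: grad_def)
    then show ?thesis using 4 by (simp add: grad_def d)
  next
    case 5
    then have "grad u ur ut uz k = uz (k - 6)" by (auto simp: grad_def)
    then show ?thesis using 5 by (simp add: grad_def)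
  qed
qed

lemma vfield_saw:
  assumes u: "vfield u ur ut uz"
  shows "vfield (\<lambda>i. saw (u i)) (\<lambda>i. saw (ur i)) (\<lambda>i. saw (ut i)) (\<lambda>i. saw (uz i))"
  unfolding vfield_def
proof (intro allI impI conjI)
  fix i :: nat assume i: "i < 3"
  have v: "C1 (u i) (ur i) (ut i) (uz i)" "per (u i)" "u i (R1, \<theta>, z) = 0" "u i (R2, \<theta>, z) = 0" for \<theta> z
    using u i by (auto simp: vfield_def)
  show "C1 (saw (u i)) (saw (ur i)) (saw (ut i)) (saw (uz i))" by (rule C1_saw[OF v(1)])
  show "per (saw (u i))" by (rule per_saw[OF v(2)])
  show "saw (u i) (R1, \<theta>, z) = 0" "saw (u i) (R2, \<theta>, z) = 0" for \<theta> z
    using v(3,4) by (simp_all add: saw_def)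
qed

lemma solenoidal_saw:
  assumes u: "vfield u ur ut uz" and s: "solenoidal u ur ut uz"
  shows "solenoidal (\<lambda>i. saw (u i)) (\<lambda>i. saw (ur i)) (\<lambda>i. saw (ut i)) (\<lambda>i. saw (uz i))"
  unfolding solenoidal_def Let_def
proof (intro allI impI)
  fix r \<theta> z :: real assume r: "R1 \<le> r \<and> r \<le> R2"
  let ?x = "(r, \<theta>, z)"
  have x: "?x \<in> S" using r by (simp add: S_iff)
  have c: "cont (u i)" "cont (ur i)" "cont (ut i)" "cont (uz i)" if "i < 3" for i
    using u that by (auto simp: vfield_def C1_def)
  have "saw (\<lambda>x. ur 0 x + (1 / fst x) * (ut 1 x + u 0 x) + uz 2 x) ?x = 0"
  proof (rule saw_zero[OF _ x])
    show "ur 0 x + (1 / fst x) * (ut 1 x + u 0 x) + uz 2 x = 0" if "x \<in> S" for x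
      using s that unfolding solenoidal_def Let_def by (cases x) (auto simp: S_iff)
  qed
  moreover have "cont (\<lambda>x. (1 / fst x) * (ut 1 x + u 0 x))"
    using cont_divide_r[OF cont_add[OF c(3)[of 1] c(1)[of 0]]] by simp
  ultimately have "saw (ur 0) ?x + 1 / r * (saw (ut 1) ?x + saw (u 0) ?x) + saw (uz 2) ?x = 0"
    using c x by (simp add: saw_add saw_rmult[of "\<lambda>r. 1 / r"] cont_add del: times_divide_eq_left)
  then show "saw (ur 0) ?x + (saw (ut 1) ?x + saw (u 0) ?x) / r + saw (uz 2) ?x = 0" by simp
qed

text \<open>The loop closes because \<open>F\<close> is bounded by \<open>u\<close>, the gradient of
  the average by \<open>F\<close>, and \<open>u\<close> again by that gradient. The bound
  \<open>M\<close> only multiplies a remainder that tends to zero with growing \<open>N\<close>,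
  which is why \<delta> can be chosen independently of it.\<close>

lemma vanishing:
  assumes \<nu>: "0 < \<nu>"
  obtains \<delta> where "0 < \<delta>"
    "\<And>u ur ut uz F q DM M i x. vfield u ur ut uz \<Longrightarrow> solenoidal u ur ut uz \<Longrightarrow>
      (\<And>x. x \<in> S \<Longrightarrow> ang_int (rad_int (\<lambda>x. fst x * u 2 x)) x = 0) \<Longrightarrow>
      (\<And>i x. i < 3 \<Longrightarrow> x \<in> S \<Longrightarrow> \<bar>u i x\<bar> \<le> M) \<Longrightarrow>
      (\<And>k. k < 9 \<Longrightarrow> cont (F k) \<and> per (F k)) \<Longrightarrow> cont q \<Longrightarrow>
      (\<And>x. x \<in> S \<Longrightarrow> (\<Sum>k<9. (F k x)\<^sup>2) \<le> \<delta> * (\<Sum>i<3. (u i x)\<^sup>2)) \<Longrightarrow>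
      divfree (\<lambda>k x. F k x + (if k \<in> {0, 4, 8} then q x else 0) - \<nu> * grad u ur ut uz k x) DM \<Longrightarrow>
      i < 3 \<Longrightarrow> x \<in> S \<Longrightarrow> u i x = 0"
proof -
  obtain \<kappa> C where \<kappa>: "0 < \<kappa>" and C: "0 \<le> C" and energy:
    "\<And>w wr wt wz E M N. vfield w wr wt wz \<Longrightarrow> solenoidal w wr wt wz \<Longrightarrow>
      (\<And>x. x \<in> S \<Longrightarrow> ang_int (rad_int (\<lambda>x. fst x * w 2 x)) x = 0) \<Longrightarrow>
      (\<And>k. k < 9 \<Longrightarrow> cont (E k)) \<Longrightarrow>
      (\<And>x. x \<in> S \<Longrightarrow> amp w wt x \<le> M) \<Longrightarrow> 0 \<le> N \<Longrightarrow>
      (\<And>\<psi> \<psi>r \<psi>t \<psi>z. vfield \<psi> \<psi>r \<psi>t \<psi>z \<Longrightarrow> solenoidal \<psi> \<psi>r \<psi>t \<psi>z \<Longrightarrow>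
        (\<And>i r \<theta>. i < 3 \<Longrightarrow> \<psi> i (r, \<theta>, N) = 0 \<and> \<psi> i (r, \<theta>, -N) = 0) \<Longrightarrow>
        bint N (\<lambda>x. fst x * (\<Sum>k<9. (\<nu> * grad w wr wt wz k x - E k x) * grad \<psi> \<psi>r \<psi>t \<psi>z k x)) = 0) \<Longrightarrow>
      bint N (\<lambda>x. (om \<kappa> (snd (snd x)) - om \<kappa> N) ^ 4 * (\<Sum>k<9. (grad w wr wt wz k x)\<^sup>2)) \<le>
        C * (bint N (\<lambda>x. om \<kappa> (snd (snd x)) ^ 4 * (\<Sum>k<9. (E k x)\<^sup>2)) + M * N * om \<kappa> N)"
    using energy_estimate[OF \<nu>] by blast
  define L where "L = R2 - R1"
  have L: "0 < L" using R1_less_R2 by (simp add: L_def)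
  \<comment> \<open>The cost of recovering \<open>u\<close> from the gradient of \<open>w\<close>: 7
    = 5 + 2 and 6 = 4 + 2 add the two bounds of \<open>amp_le_grad\<close> for the angular
    derivatives, and 12 = 2 \<cdot> 2 \<cdot> 3 comes from two angular integrations and the bound
    for the components.\<close>
  define K3 where "K3 = 7 * L\<^sup>2 + 6 * R2\<^sup>2 + 12 * pi\<^sup>2 * L\<^sup>2"
  have K3: "0 \<le> K3" by (simp add: K3_def)
  \<comment> \<open>Chosen so that half of the weighted integral of \<bar>u\<bar> squared can be
    absorbed. The factor \<open>16 * pi ^ 4\<close> is what \<open>F\<close> costs under the
    average, and the added 1 keeps the denominator positive.\<close>
  define \<delta> where "\<delta> = 1 / (2 * (16 * pi ^ 4) * (K3 * C + 1))"
  have KC: "0 < K3 * C + 1" using K3 C by (simp add: add_nonneg_pos)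
  have \<delta>: "0 < \<delta>" using KC by (simp add: \<delta>_def)
  have \<delta>K: "K3 * C * (16 * pi ^ 4 * \<delta>) \<le> 1 / 2"
  proof -
    have "16 * pi ^ 4 * \<delta> = 1 / (K3 * C + 1) / 2" by (simp add: \<delta>_def divide_simps)
    then have "K3 * C * (16 * pi ^ 4 * \<delta>) = (K3 * C / (K3 * C + 1)) / 2" by simp
    also have "\<dots> \<le> 1 / 2" using KC K3 C by simp
    finally show ?thesis .
  qed
  show ?thesis
  proof (rule that[OF \<delta>])
    fix u ur ut uz F q DM M and i0 :: nat and x0 :: cyl
    assume u: "vfield u ur ut uz" and sol: "solenoidal u ur ut uz"
      and flux: "\<And>x. x \<in> S \<Longrightarrow> ang_int (rad_int (\<lambda>x. fst x * u 2 x)) x = 0"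
      and ub: "\<And>i x. i < 3 \<Longrightarrow> x \<in> S \<Longrightarrow> \<bar>u i x\<bar> \<le> M"
      and F: "\<And>k. k < 9 \<Longrightarrow> cont (F k) \<and> per (F k)" and q: "cont q"
      and Fb: "\<And>x. x \<in> S \<Longrightarrow> (\<Sum>k<9. (F k x)\<^sup>2) \<le> \<delta> * (\<Sum>i<3. (u i x)\<^sup>2)"
      and df: "divfree (\<lambda>k x. F k x + (if k \<in> {0, 4, 8} then q x else 0) - \<nu> * grad u ur ut uz k x) DM"
      and i0: "i0 < 3" and x0: "x0 \<in> S"
    define T where "T = (\<lambda>k x. F k x + (if k \<in> {0, 4, 8} then q x else 0) - \<nu> * grad u ur ut uz k x)"
    define w where "w = (\<lambda>i. saw (u i))"
    define wr where "wr = (\<lambda>i. saw (ur i))"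
    define wt where "wt = (\<lambda>i. saw (ut i))"
    define wz where "wz = (\<lambda>i. saw (uz i))"
    define E where "E = (\<lambda>k. saw (F k))"
    note wdefs = w_def wr_def wt_def wz_def
    have uc: "C1 (u i) (ur i) (ut i) (uz i)" "cont (u i)" "per (u i)" if "i < 3" for i
      using u that by (auto simp: vfield_def C1_def)
    have w: "vfield w wr wt wz" unfolding wdefs by (rule vfield_saw[OF u])
    have wsol: "solenoidal w wr wt wz" unfolding wdefs by (rule solenoidal_saw[OF u sol])
    have wflux: "ang_int (rad_int (\<lambda>x. fst x * w 2 x)) x = 0" if "x \<in> S" for x
      unfolding w_def by (rule saw_flux[OF _ _ flux that]) (use uc[of 2] in auto)
    have wc: "cont (w i)" "cont (wt i)" if "i < 3" for i using w that by (auto simp: vfield_def C1_def)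
    have cE: "cont (E k)" if "k < 9" for k using F[OF that] by (auto simp: E_def)
    have wt_eq: "wt i x = 2 * pi * u i x - ang_int (u i) x" if "i < 3" "x \<in> S" for i x
      using saw_dt[OF uc(1)[OF that(1)] uc(3)[OF that(1)]] that by (cases x) (auto simp: wt_def S_iff)
    define e where "e = (\<lambda>x. \<Sum>i<3. (u i x)\<^sup>2)"
    have ce: "cont e" unfolding e_def by (intro cont_sum cont_power uc) auto
    have e0: "0 \<le> e x" for x by (simp add: e_def sum_nonneg)
    have u2: "(u i x)\<^sup>2 \<le> M\<^sup>2" if "i < 3" "x \<in> S" for i x
      using power_mono[OF ub[OF that] abs_ge_zero, of 2] by simp
    have eM: "e x \<le> 3 * M\<^sup>2" if "x \<in> S" for x
      using u2[of 0 x] u2[of 1 x] u2[of 2 x] that by (simp add: e_def sum_lt_3)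
    have angc: "ang_int (\<lambda>x. c) x = 2 * pi * c" for c x by (cases x) (simp add: ang_int_def)
    have angu: "ang_int (\<lambda>x. (u i x)\<^sup>2) x \<le> 2 * pi * M\<^sup>2" if "i < 3" "x \<in> S" for i x
      using ang_int_mono[of "\<lambda>x. (u i x)\<^sup>2" "\<lambda>x. M\<^sup>2" x] uc(2)[OF that(1)] u2[OF that(1)] that
      by (auto simp: angc)
    define Mb where "Mb = (48 * pi ^ 4 + 32 * pi\<^sup>2) * M\<^sup>2"
    \<comment> \<open>Here the kernel pays off: \<open>wt i\<close> is 2\<pi> \<open>u i\<close>
      minus an angular integral, hence bounded by \<open>M\<close> although nothing is known about
      the angular derivative of \<open>u\<close>.\<close>
    have ampb: "amp w wt x \<le> Mb" if x: "x \<in> S" for x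
    proof -
      have a: "(w i x)\<^sup>2 \<le> 16 * pi ^ 4 * M\<^sup>2" if i: "i < 3" for i
      proof -
        have "(w i x)\<^sup>2 \<le> 8 * pi ^ 3 * ang_int (\<lambda>x. (u i x)\<^sup>2) x"
          unfolding w_def by (rule saw_square_le[OF uc(2,3)[OF i] x])
        also have "\<dots> \<le> 8 * pi ^ 3 * (2 * pi * M\<^sup>2)" by (intro mult_left_mono angu i x) auto
        finally show ?thesis by (simp add: power3_eq_cube power4_eq_xxxx mult_ac)
      qed
      have b: "(wt i x)\<^sup>2 \<le> 16 * pi\<^sup>2 * M\<^sup>2" if i: "i < 3" for i
      proof -
        have "(ang_int (u i) x)\<^sup>2 \<le> 2 * pi * ang_int (\<lambda>x. (u i x)\<^sup>2) x"
          by (rule ang_int_square_le[OF uc(2)[OF i] x])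
        also have "\<dots> \<le> 2 * pi * (2 * pi * M\<^sup>2)" by (intro mult_left_mono angu i x) auto
        finally have 1: "(ang_int (u i) x)\<^sup>2 \<le> 4 * pi\<^sup>2 * M\<^sup>2" by (simp add: power2_eq_square mult_ac)
        have 2: "(2 * pi * u i x)\<^sup>2 \<le> 4 * pi\<^sup>2 * M\<^sup>2"
          using u2[OF i x] by (simp add: power_mult_distrib)
        have "(2 * pi * u i x - ang_int (u i) x)\<^sup>2 \<le> 2 * (2 * pi * u i x)\<^sup>2 + 2 * (ang_int (u i) x)\<^sup>2"
          using zero_le_power2[of "2 * pi * u i x + ang_int (u i) x"] by (simp add: power2_eq_square algebra_simps)
        then show ?thesis using 1 2 unfolding wt_eq[OF i x] by linarith
      qed
      have "amp w wt x \<le> 3 * (16 * pi ^ 4 * M\<^sup>2) + 2 * (16 * pi\<^sup>2 * M\<^sup>2)"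
        unfolding amp_def using a[of 0] a[of 1] a[of 2] b[of 1] b[of 2] by simp
      then show ?thesis by (simp add: Mb_def distrib_right)
    qed
    have Mb0: "0 \<le> Mb" by (simp add: Mb_def)
    \<comment> \<open>The averaged tensor is tested with \<psi>. Its pressure part multiplies the
      sum of the gradient entries 0, 4 and 8, which is the divergence of \<psi>.\<close>
    have weak: "bint N (\<lambda>x. fst x * (\<Sum>k<9. (\<nu> * grad w wr wt wz k x - E k x) * grad \<psi> \<psi>r \<psi>t \<psi>z k x)) = 0"
      if N: "0 \<le> N" and \<psi>: "vfield \<psi> \<psi>r \<psi>t \<psi>z" "solenoidal \<psi> \<psi>r \<psi>t \<psi>z"
        "\<And>i r \<theta>. i < 3 \<Longrightarrow> \<psi> i (r, \<theta>, N) = 0 \<and> \<psi> i (r, \<theta>, -N) = 0" for N \<psi> \<psi>r \<psi>t \<psi>z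
    proof -
      have "bint N (\<lambda>x. fst x * (\<Sum>k<9. saw (T k) x * grad \<psi> \<psi>r \<psi>t \<psi>z k x)) = 0"
        by (rule weak_form[OF divfree_saw[OF df[folded T_def]] \<psi>(1) N \<psi>(3)])
      moreover have "bint N (\<lambda>x. fst x * (\<Sum>k<9. (\<nu> * grad w wr wt wz k x - E k x) * grad \<psi> \<psi>r \<psi>t \<psi>z k x)) =
        bint N (\<lambda>x. (-1) * (fst x * (\<Sum>k<9. saw (T k) x * grad \<psi> \<psi>r \<psi>t \<psi>z k x)))"
      proof (rule bint_cong)
        fix r \<theta> z :: real assume r: "R1 \<le> r" "r \<le> R2"
        let ?x = "(r, \<theta>, z)"
        have x: "?x \<in> S" using r by (simp add: S_iff)
        have sT: "saw (T k) ?x = E k ?x + (if k \<in> {0, 4, 8} then saw q ?x else 0) - \<nu> * grad w wr wt wz k ?x"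
          if k: "k < 9" for k
        proof -
          have cq: "cont (\<lambda>x. if k \<in> {0, 4, 8} then q x else 0)"
            by (cases "k \<in> {0, 4, 8}") (use q in auto)
          have cg: "cont (\<lambda>x. \<nu> * grad u ur ut uz k x)" by (intro cont_mult cont_const cont_grad[OF u k])
          have "saw (T k) ?x = saw (F k) ?x + saw (\<lambda>x. if k \<in> {0, 4, 8} then q x else 0) ?x -
              saw (\<lambda>x. \<nu> * grad u ur ut uz k x) ?x"
            unfolding T_def using F[OF k] cq cg x by (simp add: saw_diff saw_add cont_add)
          also have "saw (\<lambda>x. \<nu> * grad u ur ut uz k x) ?x = \<nu> * grad w wr wt wz k ?x"
            unfolding wdefs saw_grad[OF u x k] by (rule saw_cmult)
          also have "saw (\<lambda>x. if k \<in> {0, 4, 8} then q x else 0) ?x = (if k \<in> {0, 4, 8} then saw q ?x else 0)"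
            by (simp add: saw_def)
          finally show ?thesis by (simp add: E_def)
        qed
        have "\<psi>r 0 ?x + (\<psi>t 1 ?x + \<psi> 0 ?x) / r + \<psi>z 2 ?x = 0"
          using \<psi>(2) r unfolding solenoidal_def Let_def by blast
        then have s0: "grad \<psi> \<psi>r \<psi>t \<psi>z 0 ?x + grad \<psi> \<psi>r \<psi>t \<psi>z 4 ?x + grad \<psi> \<psi>r \<psi>t \<psi>z 8 ?x = 0"
          by (simp add: grad_def)
        have "(\<Sum>k<9. saw (T k) ?x * grad \<psi> \<psi>r \<psi>t \<psi>z k ?x) =
          (\<Sum>k<9. - ((\<nu> * grad w wr wt wz k ?x - E k ?x) * grad \<psi> \<psi>r \<psi>t \<psi>z k ?x)) +
          (\<Sum>k<9. (if k \<in> {0, 4, 8} then saw q ?x else 0) * grad \<psi> \<psi>r \<psi>t \<psi>z k ?x)"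
          unfolding sum.distrib[symmetric] by (rule sum.cong) (auto simp: sT algebra_simps)
        also have "(\<Sum>k<9. (if k \<in> {0, 4, 8} then saw q ?x else 0) * grad \<psi> \<psi>r \<psi>t \<psi>z k ?x) =
           saw q ?x * (grad \<psi> \<psi>r \<psi>t \<psi>z 0 ?x + grad \<psi> \<psi>r \<psi>t \<psi>z 4 ?x + grad \<psi> \<psi>r \<psi>t \<psi>z 8 ?x)"
          unfolding sum_lt_9 by (simp add: algebra_simps)
        finally show "fst ?x * (\<Sum>k<9. (\<nu> * grad w wr wt wz k ?x - E k ?x) * grad \<psi> \<psi>r \<psi>t \<psi>z k ?x) =
          (-1) * (fst ?x * (\<Sum>k<9. saw (T k) ?x * grad \<psi> \<psi>r \<psi>t \<psi>z k ?x))"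
          by (simp add: s0 sum_negf)
      qed
      ultimately show ?thesis unfolding bint_cmult by simp
    qed
    define J where "J = (\<lambda>N. bint N (\<lambda>x. om \<kappa> (snd (snd x)) ^ 4 * e x))"
    define X where "X = K3 * C * Mb + 48 * pi * L * M\<^sup>2"
    have X0: "0 \<le> X" using K3 C Mb0 L by (simp add: X_def)
    have cO: "cont (\<lambda>x. om \<kappa> (snd (snd x)) ^ 4)" by (intro cont_power cont_zz om_continuous)
    have Jle: "J N \<le> 2 * X / (\<kappa>\<^sup>2 * N)" if N: "0 < N" for N
    proof -
      have N0: "0 \<le> N" using N by simp
      define m where "m = om \<kappa> N"
      have m0: "0 \<le> m" using om_pos[of \<kappa> N] by (simp add: m_def)
      define t where "t = (\<lambda>z. om \<kappa> z - m)"
      have ct: "continuous_on UNIV (\<lambda>z. t z ^ 4)" unfolding t_def by (intro continuous_intros om_continuous)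
      have cT: "cont (\<lambda>x. t (snd (snd x)) ^ 4)" by (rule cont_zz[OF ct])
      have tt: "0 \<le> t z" "t z \<le> om \<kappa> z" if "-N \<le> z" "z \<le> N" for z
        using om_antimono[of z N \<kappa>] that om_pos[of \<kappa> N] by (auto simp: t_def m_def)
      define yy where "yy = (\<lambda>x. \<Sum>k<9. (grad w wr wt wz k x)\<^sup>2)"
      have cyy: "cont yy" unfolding yy_def by (intro cont_sum cont_power cont_grad[OF w]) auto
      define Ta where "Ta = bint N (\<lambda>x. t (snd (snd x)) ^ 4 * yy x)"
      define EE where "EE = (\<lambda>x. \<Sum>k<9. (E k x)\<^sup>2)"
      have cEE: "cont EE" unfolding EE_def by (intro cont_sum cont_power cE) auto
      have 1: "Ta \<le> C * (bint N (\<lambda>x. om \<kappa> (snd (snd x)) ^ 4 * EE x) + Mb * N * m)"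
        unfolding Ta_def t_def m_def yy_def EE_def
        by (rule energy[OF w wsol wflux cE ampb N0 weak[OF N0]])
      \<comment> \<open>The sawtooth costs \<open>8 * pi ^ 3\<close> pointwise, and integrating the
        resulting angular integral costs a further 2\<pi>.\<close>
      have 2: "bint N (\<lambda>x. om \<kappa> (snd (snd x)) ^ 4 * EE x) \<le> 16 * pi ^ 4 * \<delta> * J N"
      proof -
        have "bint N (\<lambda>x. om \<kappa> (snd (snd x)) ^ 4 * EE x) \<le>
            bint N (\<lambda>x. (8 * pi ^ 3 * \<delta>) * (om \<kappa> (snd (snd x)) ^ 4 * ang_int e x))"
        proof (rule bint_mono)
          show "cont (\<lambda>x. om \<kappa> (snd (snd x)) ^ 4 * EE x)" by (intro cont_mult cO cEE)
          show "cont (\<lambda>x. (8 * pi ^ 3 * \<delta>) * (om \<kappa> (snd (snd x)) ^ 4 * ang_int e x))"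
            by (intro cont_mult cont_const cO cont_ang_int ce)
          fix r \<theta> z :: real assume r: "R1 \<le> r" "r \<le> R2"
          let ?x = "(r, \<theta>, z)"
          have x: "?x \<in> S" using r by (simp add: S_iff)
          have "EE ?x \<le> (\<Sum>k<9. 8 * pi ^ 3 * ang_int (\<lambda>x. (F k x)\<^sup>2) ?x)"
            unfolding EE_def E_def by (intro sum_mono saw_square_le x) (use F in auto)
          also have "\<dots> = 8 * pi ^ 3 * ang_int (\<lambda>x. \<Sum>k<9. (F k x)\<^sup>2) ?x"
          proof -
            have "ang_int (\<lambda>x. \<Sum>k<9. (F k x)\<^sup>2) ?x = (\<Sum>k<9. ang_int (\<lambda>x. (F k x)\<^sup>2) ?x)"
              unfolding ang_int_def prod.case
              by (rule integral_sum) (use F r in \<open>auto intro!: integrable_continuous_real continuous_intros line_integrable\<close>)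
            then show ?thesis by (simp add: sum_distrib_left)
          qed
          also have "\<dots> \<le> 8 * pi ^ 3 * (\<delta> * ang_int e ?x)"
          proof -
            have "ang_int (\<lambda>x. \<Sum>k<9. (F k x)\<^sup>2) ?x \<le> ang_int (\<lambda>x. \<delta> * e x) ?x"
            proof (rule ang_int_mono[OF _ _ _ x])
              show "cont (\<lambda>x. \<Sum>k<9. (F k x)\<^sup>2)" by (intro cont_sum cont_power) (use F in auto)
              show "cont (\<lambda>x. \<delta> * e x)" by (intro cont_mult cont_const ce)
            qed (use Fb in \<open>simp add: e_def\<close>)
            then show ?thesis by (simp add: ang_int_cmult)
          qed
          finally have "om \<kappa> z ^ 4 * EE ?x \<le> om \<kappa> z ^ 4 * (8 * pi ^ 3 * (\<delta> * ang_int e ?x))"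
            using om_pos[of \<kappa> z] by (intro mult_left_mono) auto
          then show "om \<kappa> (snd (snd ?x)) ^ 4 * EE ?x \<le> (8 * pi ^ 3 * \<delta>) * (om \<kappa> (snd (snd ?x)) ^ 4 * ang_int e ?x)"
            by (simp add: mult_ac)
        qed
        also have "\<dots> = (8 * pi ^ 3 * \<delta>) * (2 * pi * J N)"
        proof -
          have o4: "continuous_on UNIV (\<lambda>z. om \<kappa> z ^ 4)" by (intro continuous_intros om_continuous)
          show ?thesis unfolding bint_cmult J_def using bint_axial_ang_int[OF ce o4, of N] by simp
        qed
        finally show ?thesis by (simp add: power3_eq_cube power4_eq_xxxx mult_ac)
      qed
      have 3: "bint N (\<lambda>x. t (snd (snd x)) ^ 4 * e x) \<le> K3 * Ta"
      proof -
        define ww where "ww = (\<lambda>x. \<Sum>i<3. (w i x)\<^sup>2)"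
        have cww: "cont ww" unfolding ww_def by (intro cont_sum cont_power wc) auto
        have "bint N (\<lambda>x. t (snd (snd x)) ^ 4 * e x) \<le>
          bint N (\<lambda>x. (7 * L) * (t (snd (snd x)) ^ 4 * rad_int yy x) + (6 * R2\<^sup>2) * (t (snd (snd x)) ^ 4 * yy x)
            + (2 * pi) * (t (snd (snd x)) ^ 4 * ang_int ww x))"
        proof (rule bint_mono)
          show "cont (\<lambda>x. t (snd (snd x)) ^ 4 * e x)" by (intro cont_mult cT ce)
          show "cont (\<lambda>x. (7 * L) * (t (snd (snd x)) ^ 4 * rad_int yy x) + (6 * R2\<^sup>2) * (t (snd (snd x)) ^ 4 * yy x)
            + (2 * pi) * (t (snd (snd x)) ^ 4 * ang_int ww x))"
            by (intro cont_add cont_mult cont_const cT cyy cont_rad_int cont_ang_int cww)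
          fix r \<theta> z :: real assume r: "R1 \<le> r" "r \<le> R2"
          let ?x = "(r, \<theta>, z)"
          have x: "?x \<in> S" using r by (simp add: S_iff)
          \<comment> \<open>\<open>wt i\<close> determines \<open>u i\<close> up to the angular
            integral \<open>a\<close>, and the angular integral of \<open>w i\<close> is a known
            multiple of \<open>a\<close>. The numerical factors need no more than 9 \<le> \<pi>
            \<pi>.\<close>
          have ui: "(u i ?x)\<^sup>2 \<le> (wt i ?x)\<^sup>2 + 2 * pi * ang_int (\<lambda>x. (w i x)\<^sup>2) ?x" if i: "i < 3" for i
          proof -
            have aw: "ang_int (w i) ?x = 2 * pi\<^sup>2 * ang_int (u i) ?x"
              unfolding w_def by (rule ang_int_saw[OF uc(2,3)[OF i] r])
            define a where "a = ang_int (u i) ?x"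
            have pg: "9 \<le> pi\<^sup>2" using pi_gt3 power_mono[of 3 pi 2] by simp
            have "(2 * pi * u i ?x)\<^sup>2 \<le> 2 * (wt i ?x)\<^sup>2 + 2 * a\<^sup>2"
              unfolding wt_eq[OF i x] a_def[symmetric]
              using zero_le_power2[of "2 * pi * u i ?x - 2 * a"] by (simp add: power2_eq_square algebra_simps)
            moreover have "4 * (u i ?x)\<^sup>2 \<le> (2 * pi * u i ?x)\<^sup>2"
              using mult_right_mono[of 4 "4 * pi\<^sup>2" "(u i ?x)\<^sup>2"] pg by (simp add: power_mult_distrib)
            moreover have "a\<^sup>2 \<le> (ang_int (w i) ?x)\<^sup>2"
            proof -
              have "1 * 1 \<le> (2 * pi\<^sup>2) * (2 * pi\<^sup>2)" using pg by (intro mult_mono) auto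
              then have "1 * a\<^sup>2 \<le> ((2 * pi\<^sup>2) * (2 * pi\<^sup>2)) * a\<^sup>2" by (intro mult_right_mono) auto
              then show ?thesis unfolding aw a_def[symmetric] by (simp add: power2_eq_square mult_ac)
            qed
            moreover have "(ang_int (w i) ?x)\<^sup>2 \<le> 2 * pi * ang_int (\<lambda>x. (w i x)\<^sup>2) ?x"
              by (rule ang_int_square_le[OF wc(1)[OF i] x])
            moreover have "0 \<le> (wt i ?x)\<^sup>2" "0 \<le> a\<^sup>2" by simp_all
            ultimately show ?thesis by linarith
          qed
          have aww: "ang_int ww ?x = (\<Sum>i<3. ang_int (\<lambda>x. (w i x)\<^sup>2) ?x)"
            unfolding ww_def ang_int_def prod.case
            by (rule integral_sum) (use wc r in \<open>auto intro!: integrable_continuous_real continuous_intros line_integrable\<close>)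
          have "e ?x \<le> (wt 0 ?x)\<^sup>2 + (wt 1 ?x)\<^sup>2 + (wt 2 ?x)\<^sup>2 + 2 * pi * ang_int ww ?x"
            using ui[of 0] ui[of 1] ui[of 2] unfolding aww e_def sum_lt_3 by (simp add: distrib_left)
          moreover have "amp w wt ?x \<le> 5 * L * rad_int yy ?x + 4 * R2\<^sup>2 * yy ?x"
            "(wt 0 ?x)\<^sup>2 \<le> 2 * L * rad_int yy ?x + 2 * R2\<^sup>2 * yy ?x"
            using amp_le_grad(1,2)[OF w x] by (simp_all add: yy_def[abs_def] L_def)
          moreover have "(wt 1 ?x)\<^sup>2 + (wt 2 ?x)\<^sup>2 \<le> amp w wt ?x" by (simp add: amp_def)
          ultimately have "e ?x \<le> 7 * L * rad_int yy ?x + 6 * R2\<^sup>2 * yy ?x + 2 * pi * ang_int ww ?x" by linarith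
          then have "t z ^ 4 * e ?x \<le> t z ^ 4 * (7 * L * rad_int yy ?x + 6 * R2\<^sup>2 * yy ?x + 2 * pi * ang_int ww ?x)"
            by (rule mult_left_mono) simp
          then show "t (snd (snd ?x)) ^ 4 * e ?x \<le> (7 * L) * (t (snd (snd ?x)) ^ 4 * rad_int yy ?x) + (6 * R2\<^sup>2) * (t (snd (snd ?x)) ^ 4 * yy ?x)
            + (2 * pi) * (t (snd (snd ?x)) ^ 4 * ang_int ww ?x)"
            by (simp add: algebra_simps)
        qed
        also have "\<dots> = (7 * L) * (L * Ta) + (6 * R2\<^sup>2) * Ta + (2 * pi) * (2 * pi * bint N (\<lambda>x. t (snd (snd x)) ^ 4 * ww x))"
          by (subst bint_add, (intro cont_add cont_mult cont_const cT cyy cont_rad_int cont_ang_int cww)+,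
              subst bint_add, (intro cont_mult cont_const cT cyy cont_rad_int)+)
            (simp only: bint_cmult bint_axial_rad_int[OF cyy ct, folded L_def] bint_axial_ang_int[OF cww ct] Ta_def[symmetric])
        also have "bint N (\<lambda>x. t (snd (snd x)) ^ 4 * ww x) \<le> bint N (\<lambda>x. (3 * L) * (t (snd (snd x)) ^ 4 * rad_int yy x))"
        proof (rule bint_mono)
          fix r \<theta> z :: real assume r: "R1 \<le> r" "r \<le> R2"
          let ?x = "(r, \<theta>, z)"
          have "ww ?x \<le> 3 * L * rad_int yy ?x"
            using amp_le_grad(3)[OF w, of ?x] r by (simp add: ww_def yy_def[abs_def] L_def S_iff)
          then have "t z ^ 4 * ww ?x \<le> t z ^ 4 * (3 * L * rad_int yy ?x)" by (rule mult_left_mono) simp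
          then show "t (snd (snd ?x)) ^ 4 * ww ?x \<le> (3 * L) * (t (snd (snd ?x)) ^ 4 * rad_int yy ?x)"
            by (simp add: mult_ac)
        qed (intro cont_mult cont_const cT cww cont_rad_int cyy)+
        also have "\<dots> = (3 * L) * (L * Ta)"
          by (simp only: bint_cmult bint_axial_rad_int[OF cyy ct, folded L_def] Ta_def[symmetric])
        finally show ?thesis by (simp add: K3_def power2_eq_square algebra_simps)
      qed
      have 4: "J N \<le> bint N (\<lambda>x. t (snd (snd x)) ^ 4 * e x) + 48 * pi * L * M\<^sup>2 * (N * m)"
      proof -
        have "J N \<le> bint N (\<lambda>x. t (snd (snd x)) ^ 4 * e x + 4 * m * (3 * M\<^sup>2))"
          unfolding J_def
        proof (rule bint_mono)
          fix r \<theta> z :: real assume r: "R1 \<le> r" "r \<le> R2" and z: "-N \<le> z" "z \<le> N"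
          let ?x = "(r, \<theta>, z)" and ?o = "om \<kappa> z"
          have o: "0 < ?o" "?o \<le> 1" by (rule om_pos om_le_1)+
          have "?o ^ 4 - t z ^ 4 = m * ((?o + t z) * (?o\<^sup>2 + (t z)\<^sup>2))"
            by (simp add: t_def power4_eq_xxxx power2_eq_square algebra_simps)
          also have "\<dots> \<le> m * (2 * 2)"
            using tt[OF z] o m0 power_le_one[of ?o 2] power_le_one[of "t z" 2] by (intro mult_left_mono mult_mono) auto
          finally have "?o ^ 4 \<le> t z ^ 4 + 4 * m" by simp
          then have "?o ^ 4 * e ?x \<le> (t z ^ 4 + 4 * m) * e ?x" using e0 by (rule mult_right_mono)
          also have "\<dots> = t z ^ 4 * e ?x + (4 * m) * e ?x" by (simp add: algebra_simps)
          also have "\<dots> \<le> t z ^ 4 * e ?x + (4 * m) * (3 * M\<^sup>2)"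
            using eM[of ?x] r m0 by (intro add_left_mono mult_left_mono) (auto simp: S_iff)
          finally show "om \<kappa> (snd (snd ?x)) ^ 4 * e ?x \<le> t (snd (snd ?x)) ^ 4 * e ?x + 4 * m * (3 * M\<^sup>2)" by simp
        qed (intro cont_add cont_mult cont_const cT cO ce)+
        also have "\<dots> = bint N (\<lambda>x. t (snd (snd x)) ^ 4 * e x) + 48 * pi * L * M\<^sup>2 * (N * m)"
          using N by (subst bint_add, (intro cont_mult cont_const cT ce)+) (simp add: bint_const L_def)
        finally show ?thesis .
      qed
      have J0: "0 \<le> J N" unfolding J_def
        by (rule bint_nonneg) (auto intro!: cont_mult cO ce mult_nonneg_nonneg e0)
      have "Ta \<le> C * (16 * pi ^ 4 * \<delta> * J N + Mb * N * m)"
        using 1 2 C by (meson add_right_mono mult_left_mono order_trans)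
      then have "K3 * Ta \<le> K3 * (C * (16 * pi ^ 4 * \<delta> * J N + Mb * N * m))" using K3 by (rule mult_left_mono)
      also have "\<dots> = (K3 * C * (16 * pi ^ 4 * \<delta>)) * J N + K3 * C * Mb * (N * m)" by (simp add: algebra_simps)
      also have "\<dots> \<le> 1 / 2 * J N + K3 * C * Mb * (N * m)"
        using \<delta>K J0 by (intro add_right_mono mult_right_mono) auto
      finally have "J N \<le> 1 / 2 * J N + X * (N * m)"
        using 3 4 by (simp add: X_def distrib_right)
      then have "J N \<le> 2 * X * (N * m)" by simp
      \<comment> \<open>The inverse-square decay of the weight beats the linear growth of the
        volume.\<close>
      also have "N * m \<le> 1 / (\<kappa>\<^sup>2 * N)"
      proof -
        have "N * m = N / (1 + (\<kappa> * N)\<^sup>2)" by (simp add: m_def om_def)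
        also have "\<dots> \<le> N / (\<kappa> * N)\<^sup>2" using N \<kappa> by (intro divide_left_mono mult_pos_pos) (auto simp: add_pos_nonneg)
        also have "\<dots> = 1 / (\<kappa>\<^sup>2 * N)" using N by (simp add: power2_eq_square)
        finally show ?thesis .
      qed
      finally show ?thesis using X0 by (simp add: mult_left_mono)
    qed
    have Jzero: "J N = 0" if N: "0 < N" for N
    proof -
      have "J N \<le> 0 + \<epsilon>" if \<epsilon>: "0 < \<epsilon>" for \<epsilon>
      proof -
        \<comment> \<open>\<open>J\<close> increases with \<open>N\<close>, so the decaying bound at
          a far larger half-length also bounds the value at \<open>N\<close>.\<close>
        define N' where "N' = max N (2 * X / (\<kappa>\<^sup>2 * \<epsilon>))"
        have N': "0 < N'" "N \<le> N'" "2 * X / (\<kappa>\<^sup>2 * \<epsilon>) \<le> N'" using N by (auto simp: N'_def)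
        have "J N \<le> J N'"
          unfolding J_def using N' by (intro bint_mono_domain cont_mult cO ce mult_nonneg_nonneg e0) auto
        also have "\<dots> \<le> 2 * X / (\<kappa>\<^sup>2 * N')" by (rule Jle[OF N'(1)])
        also have "\<dots> \<le> \<epsilon>"
        proof -
          have "2 * X \<le> N' * (\<kappa>\<^sup>2 * \<epsilon>)" using N'(3) \<kappa> \<epsilon> by (simp add: divide_le_eq)
          then show ?thesis using N'(1) \<kappa> by (simp add: divide_le_eq mult_ac)
        qed
        finally show ?thesis by simp
      qed
      then have "J N \<le> 0" by (rule field_le_epsilon)
      moreover have "0 \<le> J N" unfolding J_def
        by (rule bint_nonneg) (auto intro!: cont_mult cO ce mult_nonneg_nonneg e0)
      ultimately show ?thesis by simp
    qed
    have e_box: "e (r, \<theta>, z) = 0" if "R1 \<le> r" "r \<le> R2" "0 \<le> \<theta>" "\<theta> \<le> 2 * pi" for r \<theta> z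
    proof -
      have "om \<kappa> (snd (snd (r, \<theta>, z))) ^ 4 * e (r, \<theta>, z) = 0"
      proof (rule bint_eq_0D[of "\<lambda>x. om \<kappa> (snd (snd x)) ^ 4 * e x" "\<bar>z\<bar> + 1"])
        show "bint (\<bar>z\<bar> + 1) (\<lambda>x. om \<kappa> (snd (snd x)) ^ 4 * e x) = 0"
          using Jzero[of "\<bar>z\<bar> + 1"] by (simp add: J_def)
        show "cont (\<lambda>x. om \<kappa> (snd (snd x)) ^ 4 * e x)" by (intro cont_mult cO ce)
      qed (use that e0 in auto)
      then show ?thesis using om_pos[of \<kappa> z] by simp
    qed
    obtain r \<theta> z where xx: "x0 = (r, \<theta>, z)" by (cases x0)
    have r: "R1 \<le> r" "r \<le> R2" using x0 by (auto simp: xx S_iff)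
    \<comment> \<open>The box covers a single period of angles. For an arbitrary angle the integral
      of \<open>e\<close> over the period that starts there is still zero, and \<open>e\<close>,
      being continuous and nonnegative, vanishes on it.\<close>
    have "integral {0..2*pi} (\<lambda>s. e (r, \<theta> + s, z)) = ang_int e (r, 0, z)"
    proof (rule ang_int_shift[OF ce _ r])
      show "per e" unfolding e_def per_def theta_periodic_def
        using uc(3) by (auto intro!: sum.cong simp: per_def theta_periodic_def)
    qed
    also have "\<dots> = 0"
    proof -
      have "integral {0..2*pi} (\<lambda>s. e (r, s, z)) = integral {0..2*pi} (\<lambda>s. 0)"
        by (rule integral_cong) (use e_box r in auto)
      then show ?thesis by (simp add: ang_int_def)
    qed
    finally have "\<forall>s\<in>{0..2*pi}. e (r, \<theta> + s, z) = 0"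
      by (subst (asm) integral_eq_0_iff) (use ce r e0 line_integrable(1) in auto)
    then have "e x0 = 0" by (auto simp: xx dest: bspec[of _ _ 0])
    moreover have "(u i0 x0)\<^sup>2 \<le> e x0" unfolding e_def by (rule member_le_sum) (use i0 in auto)
    ultimately show "u i0 x0 = 0" by simp
  qed
qed

end

section \<open>Smooth solutions\<close>

lemma Ck_on_imp_continuous: "Ck_on k S f \<Longrightarrow> continuous_on S f"
proof (cases k)
  case (Suc k')
  assume "Ck_on k S f"
  then show ?thesis
    unfolding Suc Ck_on.simps
    by (meson continuous_on_eq_continuous_within has_derivative_continuous)
qed simp

context annulus begin

text \<open>Carries identities that are known in the open slab, in particular the equations of
  motion, to the walls: the closed radial interval is the closure of the open one.\<close>

lemma cont_zero_closure:
  assumes f: "cont f" and 0: "\<And>r \<theta> z. R1 < r \<Longrightarrow> r < R2 \<Longrightarrow> f (r, \<theta>, z) = 0" and x: "x \<in> S"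
  shows "f x = 0"
proof -
  obtain r \<theta> z where xx: "x = (r, \<theta>, z)" by (cases x)
  with x have r: "r \<in> closure {R1<..<R2}" using R1_less_R2 by (auto simp: S_iff closure_greaterThanLessThan)
  have "continuous_on (closure {R1<..<R2}) (\<lambda>s. f (s, \<theta>, z))"
    using line_integrable(4)[OF f] R1_less_R2 by (simp add: closure_greaterThanLessThan)
  then show ?thesis
    unfolding xx by (rule continuous_constant_on_closure[OF _ _ r]) (use 0 in auto)
qed

text \<open>The derivative within the slab is restricted to coordinate lines. Radial lines are taken
  over the open interval, where a derivative within is two-sided; angular and axial lines never
  leave the slab.\<close>

lemma Ck_on_C1:
  assumes "Ck_on (Suc k) S f"
  obtains fr ft fz where "C1 f fr ft fz" "Ck_on k S fr" "Ck_on k S ft" "Ck_on k S fz"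
proof -
  from assms obtain g where D: "\<And>x. x \<in> S \<Longrightarrow> (f has_derivative (\<lambda>h. \<Sum>b\<in>Basis. (h \<bullet> b) * g b x)) (at x within S)"
    and g: "\<And>b. b \<in> Basis \<Longrightarrow> Ck_on k S (g b)" by auto
  have B: "(Basis :: cyl set) = {(1, 0, 0), (0, 1, 0), (0, 0, 1)}"
    by (auto simp: Basis_prod_def zero_prod_def image_iff)
  have D': "(f has_derivative (\<lambda>h. fst h * g (1, 0, 0) x + (fst (snd h) * g (0, 1, 0) x + snd (snd h) * g (0, 0, 1) x))) (at x within S)"
    if "x \<in> S" for x
    using D[OF that] by (simp add: B inner_prod_def)
  have line: "((\<lambda>s. f (l s)) has_real_derivative d) (at t within A)"
    if l: "(l has_derivative (\<lambda>h. h *\<^sub>R e)) (at t within A)" and A: "l ` A \<subseteq> S" "t \<in> A"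
      and d: "d = fst e * g (1, 0, 0) (l t) + (fst (snd e) * g (0, 1, 0) (l t) + snd (snd e) * g (0, 0, 1) (l t))"
    for l :: "real \<Rightarrow> cyl" and e d t A
  proof -
    have "l t \<in> S" using A by auto
    then have "(f has_derivative (\<lambda>h. fst h * g (1, 0, 0) (l t) + (fst (snd h) * g (0, 1, 0) (l t) + snd (snd h) * g (0, 0, 1) (l t)))) (at (l t) within l ` A)"
      by (rule has_derivative_subset[OF D' A(1)])
    from has_derivative_in_compose[OF l this]
    show ?thesis
      unfolding has_field_derivative_def d
      by (rule has_derivative_eq_rhs) (auto simp: algebra_simps)
  qed
  have "C1 f (g (1, 0, 0)) (g (0, 1, 0)) (g (0, 0, 1))"
  proof (rule C1_I)
    show "cont f" using Ck_on_imp_continuous[OF assms] by (simp add: cont_def)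
    show "cont (g (1, 0, 0))" "cont (g (0, 1, 0))" "cont (g (0, 0, 1))"
      unfolding cont_def by (rule Ck_on_imp_continuous[OF g]; simp add: B)+
    fix r \<theta> z
    {
      assume r: "R1 < r" "r < R2"
      have "((\<lambda>s. f (s, \<theta>, z)) has_real_derivative g (1, 0, 0) (r, \<theta>, z)) (at r within {R1<..<R2})"
        by (rule line[of "\<lambda>s. (s, \<theta>, z)" "(1, 0, 0)"])
          (use r in \<open>auto simp: S_iff zero_prod_def intro!: derivative_eq_intros\<close>)
      then show "((\<lambda>s. f (s, \<theta>, z)) has_real_derivative g (1, 0, 0) (r, \<theta>, z)) (at r)"
        using r at_within_open[of r "{R1<..<R2}"] by simp
    }
    assume r: "R1 \<le> r" "r \<le> R2"
    show "((\<lambda>s. f (r, s, z)) has_real_derivative g (0, 1, 0) (r, \<theta>, z)) (at \<theta>)"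
      by (rule line[of "\<lambda>s. (r, s, z)" "(0, 1, 0)"])
        (use r in \<open>auto simp: S_iff intro!: derivative_eq_intros\<close>)
    show "((\<lambda>s. f (r, \<theta>, s)) has_real_derivative g (0, 0, 1) (r, \<theta>, z)) (at z)"
      by (rule line[of "\<lambda>s. (r, \<theta>, s)" "(0, 0, 1)"])
        (use r in \<open>auto simp: S_iff intro!: derivative_eq_intros\<close>)
  qed
  then show ?thesis using that g by (auto simp: B)
qed

text \<open>In the interior the shifted function has the same radial derivative by uniqueness. At
  the walls \<open>fr\<close> is not given by a two-sided quotient, so periodicity is transported
  there by continuity.\<close>

lemma per_dr:
  assumes f: "C1 f fr ft fz" and p: "per f" shows "per fr"
  unfolding per_def theta_periodic_def
proof (intro allI impI)
  fix r0 \<theta>0 z0 assume r0: "R1 \<le> r0 \<and> r0 \<le> R2"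
  note D = C1_D[OF f]
  have "(\<lambda>x. fr (fst x, fst (snd x) + 2 * pi, snd (snd x)) - fr x) (r0, \<theta>0, z0) = 0"
  proof (rule cont_zero_closure)
    show "cont (\<lambda>x. fr (fst x, fst (snd x) + 2 * pi, snd (snd x)) - fr x)"
    proof (rule cont_diff[OF _ D(2)])
      show "cont (\<lambda>x. fr (fst x, fst (snd x) + 2 * pi, snd (snd x)))"
        unfolding cont_def by (rule cont_compose[OF D(2)]) (auto simp: closed_slab_def intro!: continuous_intros)
    qed
    fix r \<theta> z assume r: "R1 < r" "r < R2"
    have "((\<lambda>s. f (s, \<theta> + 2 * pi, z)) has_real_derivative fr (r, \<theta> + 2 * pi, z)) (at r)"
      by (rule has_drD[OF D(5) r])
    then have "((\<lambda>s. f (s, \<theta>, z)) has_real_derivative fr (r, \<theta> + 2 * pi, z)) (at r)"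
    proof (rule has_field_derivative_transform_within_open[of _ _ _ "{R1<..<R2}"])
      show "f (x, \<theta> + 2 * pi, z) = f (x, \<theta>, z)" if "x \<in> {R1<..<R2}" for x
        using p that by (auto simp: per_def theta_periodic_def)
    qed (use r in auto)
    then show "(\<lambda>x. fr (fst x, fst (snd x) + 2 * pi, snd (snd x)) - fr x) (r, \<theta>, z) = 0"
      using has_drD[OF D(5) r, of \<theta> z] DERIV_unique by auto
  qed (use r0 in \<open>simp add: S_iff\<close>)
  then show "fr (r0, \<theta>0 + 2 * pi, z0) = fr (r0, \<theta>0, z0)" by simp
qed

lemma per_dz:
  assumes f: "C1 f fr ft fz" and p: "per f" shows "per fz"
  unfolding per_def theta_periodic_def
proof (intro allI impI)
  fix r \<theta> z assume r: "R1 \<le> r \<and> r \<le> R2"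
  note D = C1_D[OF f]
  have "(\<lambda>s. f (r, \<theta> + 2 * pi, s)) = (\<lambda>s. f (r, \<theta>, s))"
    using p r by (auto simp: per_def theta_periodic_def)
  then show "fz (r, \<theta> + 2 * pi, z) = fz (r, \<theta>, z)"
    using has_dzD[OF D(7), of r \<theta> z] has_dzD[OF D(7), of r "\<theta> + 2 * pi" z] r DERIV_unique by auto
qed

text \<open>A solution with its derivatives named and its equations valid up to the walls. Only the
  pure second derivatives that form the Laplacian are recorded. Boundary values are left out, so the
  explicit base flow is covered in the same way.\<close>

definition jets :: "real \<Rightarrow> field \<Rightarrow> field \<Rightarrow> field \<Rightarrow> field \<Rightarrow> field \<Rightarrow> field \<Rightarrow> field \<Rightarrow>
    (cyl \<Rightarrow> real) \<Rightarrow> (cyl \<Rightarrow> real) \<Rightarrow> (cyl \<Rightarrow> real) \<Rightarrow> (cyl \<Rightarrow> real) \<Rightarrow> bool" where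
  "jets \<nu> V Vr Vt Vz Vrr Vtt Vzz p pr pt pz \<longleftrightarrow>
     (\<forall>i<3. C1 (V i) (Vr i) (Vt i) (Vz i) \<and> per (V i) \<and>
        cont (Vrr i) \<and> cont (Vtt i) \<and> cont (Vzz i) \<and>
        has_dr (Vr i) (Vrr i) \<and> has_dt (Vt i) (Vtt i) \<and> has_dz (Vz i) (Vzz i)) \<and>
     C1 p pr pt pz \<and> per p \<and>
     (\<forall>x\<in>S. V 0 x * Vr 0 x + V 1 x / fst x * Vt 0 x + V 2 x * Vz 0 x - (V 1 x)\<^sup>2 / fst x + pr x =
          \<nu> * (Vrr 0 x + 1 / fst x * Vr 0 x + 1 / (fst x)\<^sup>2 * Vtt 0 x + Vzz 0 x - 1 / (fst x)\<^sup>2 * V 0 x)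
            - \<nu> * (2 / (fst x)\<^sup>2) * Vt 1 x) \<and>
     (\<forall>x\<in>S. V 0 x * Vr 1 x + V 1 x / fst x * Vt 1 x + V 2 x * Vz 1 x + V 0 x * V 1 x / fst x + 1 / fst x * pt x =
          \<nu> * (Vrr 1 x + 1 / fst x * Vr 1 x + 1 / (fst x)\<^sup>2 * Vtt 1 x + Vzz 1 x - 1 / (fst x)\<^sup>2 * V 1 x)
            + \<nu> * (2 / (fst x)\<^sup>2) * Vt 0 x) \<and>
     (\<forall>x\<in>S. V 0 x * Vr 2 x + V 1 x / fst x * Vt 2 x + V 2 x * Vz 2 x + pz x =
          \<nu> * (Vrr 2 x + 1 / fst x * Vr 2 x + 1 / (fst x)\<^sup>2 * Vtt 2 x + Vzz 2 x)) \<and>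
     solenoidal V Vr Vt Vz"

definition comp3 :: "'a \<Rightarrow> 'a \<Rightarrow> 'a \<Rightarrow> nat \<Rightarrow> 'a" where
  "comp3 a b c i = (if i = 0 then a else if i = 1 then b else c)"

lemma comp3_simps [simp]: "comp3 a b c 0 = a" "comp3 a b c 1 = b" "comp3 a b c (Suc 0) = b" "comp3 a b c 2 = c"
  by (simp_all add: comp3_def)

lemma lt3_cases: "(i::nat) < 3 \<Longrightarrow> P 0 \<Longrightarrow> P 1 \<Longrightarrow> P 2 \<Longrightarrow> P i"
  by (auto simp: less_Suc_eq numeral_3_eq_3 numeral_2_eq_2)

section \<open>From derivatives in the open slab to equations up to the walls\<close>

lemma d_eq:
  assumes f: "C1 f fr ft fz" and r: "R1 < r" "r < R2"
  shows "d_r f (r, \<theta>, z) = fr (r, \<theta>, z)" "d_theta f (r, \<theta>, z) = ft (r, \<theta>, z)" "d_z f (r, \<theta>, z) = fz (r, \<theta>, z)"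
  using has_drD[OF C1_D(5)[OF f] r] has_dtD[OF C1_D(6)[OF f], of r] has_dzD[OF C1_D(7)[OF f], of r] r
  by (auto simp: d_r_def d_theta_def d_z_def intro!: DERIV_imp_deriv)

lemma dd_eq:
  assumes f: "C1 f fr ft fz" and g: "has_dr fr frr" "has_dt ft ftt" "has_dz fz fzz" and r: "R1 < r" "r < R2"
  shows "d_r (d_r f) (r, \<theta>, z) = frr (r, \<theta>, z)" "d_theta (d_theta f) (r, \<theta>, z) = ftt (r, \<theta>, z)"
    "d_z (d_z f) (r, \<theta>, z) = fzz (r, \<theta>, z)"
proof -
  have "((\<lambda>s. d_r f (s, \<theta>, z)) has_real_derivative frr (r, \<theta>, z)) (at r)"
    by (rule has_field_derivative_transform_within_open[OF has_drD[OF g(1) r], of "{R1<..<R2}"])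
      (use r in \<open>auto simp: d_eq[OF f]\<close>)
  then show "d_r (d_r f) (r, \<theta>, z) = frr (r, \<theta>, z)"
    unfolding d_r_def[of "d_r f"] by (simp add: DERIV_imp_deriv)
  have "((\<lambda>s. d_theta f (r, s, z)) has_real_derivative ftt (r, \<theta>, z)) (at \<theta>)"
    using has_dtD[OF g(2), of r z \<theta>] r by (simp add: d_eq[OF f])
  then show "d_theta (d_theta f) (r, \<theta>, z) = ftt (r, \<theta>, z)"
    unfolding d_theta_def[of "d_theta f"] by (simp add: DERIV_imp_deriv)
  have "((\<lambda>s. d_z f (r, \<theta>, s)) has_real_derivative fzz (r, \<theta>, z)) (at z)"
    using has_dzD[OF g(3), of r \<theta> z] r by (simp add: d_eq[OF f])
  then show "d_z (d_z f) (r, \<theta>, z) = fzz (r, \<theta>, z)"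
    unfolding d_z_def[of "d_z f"] by (simp add: DERIV_imp_deriv)
qed

lemma smooth_on_C2:
  assumes "smooth_on S f"
  obtains fr ft fz frr ftt fzz where "C1 f fr ft fz" "cont frr" "cont ftt" "cont fzz"
    "has_dr fr frr" "has_dt ft ftt" "has_dz fz fzz"
proof -
  have "Ck_on (Suc (Suc 0)) S f" using assms unfolding smooth_on_def by blast
  then obtain fr ft fz where 1: "C1 f fr ft fz" "Ck_on (Suc 0) S fr" "Ck_on (Suc 0) S ft" "Ck_on (Suc 0) S fz"
    by (rule Ck_on_C1)
  obtain a1 a2 a3 where 2: "C1 fr a1 a2 a3" using 1(2) by (rule Ck_on_C1)
  obtain b1 b2 b3 where 3: "C1 ft b1 b2 b3" using 1(3) by (rule Ck_on_C1)
  obtain c1 c2 c3 where 4: "C1 fz c1 c2 c3" using 1(4) by (rule Ck_on_C1)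
  show ?thesis using that[OF 1(1), of a1 b2 c3] 2 3 4 by (auto simp: C1_def)
qed

lemma cont_eq_closure:
  assumes "cont f" "cont g" and "\<And>r \<theta> z. R1 < r \<Longrightarrow> r < R2 \<Longrightarrow> f (r, \<theta>, z) = g (r, \<theta>, z)" and x: "x \<in> S"
  shows "f x = g x"
  using cont_zero_closure[OF cont_diff[OF assms(1,2)] _ x] assms(3) by simp

lemma solution_jets:
  assumes sol: "smooth_solution \<nu> R1 R2 \<omega>1 \<omega>2 vr vt vz p"
  obtains Vr Vt Vz Vrr Vtt Vzz pr pt pz where
    "jets \<nu> (comp3 vr vt vz) Vr Vt Vz Vrr Vtt Vzz p pr pt pz"
proof -
  have sm: "smooth_on S vr" "smooth_on S vt" "smooth_on S vz" "smooth_on S p"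
    and pe: "per vr" "per vt" "per vz" "per p"
    and ns: "navier_stokes_cyl \<nu> R1 R2 vr vt vz p"
    using sol by (auto simp: smooth_solution_def per_def)
  obtain a1 a2 a3 a11 a22 a33 where a: "C1 vr a1 a2 a3" "cont a11" "cont a22" "cont a33"
    "has_dr a1 a11" "has_dt a2 a22" "has_dz a3 a33" using smooth_on_C2[OF sm(1)] by blast
  obtain b1 b2 b3 b11 b22 b33 where b: "C1 vt b1 b2 b3" "cont b11" "cont b22" "cont b33"
    "has_dr b1 b11" "has_dt b2 b22" "has_dz b3 b33" using smooth_on_C2[OF sm(2)] by blast
  obtain c1 c2 c3 c11 c22 c33 where c: "C1 vz c1 c2 c3" "cont c11" "cont c22" "cont c33"
    "has_dr c1 c11" "has_dt c2 c22" "has_dz c3 c33" using smooth_on_C2[OF sm(3)] by blast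
  obtain pr pt pz where p: "C1 p pr pt pz"
    using sm(4) Ck_on_C1[of 0 p] unfolding smooth_on_def by blast
  note ac = C1_D(1-4)[OF a(1)] a(2-4) and bc = C1_D(1-4)[OF b(1)] b(2-4)
    and cc = C1_D(1-4)[OF c(1)] c(2-4) and pc = C1_D(1-4)[OF p]
  have rad: "cont (\<lambda>x. 1 / fst x)" "cont (\<lambda>x. 1 / (fst x)\<^sup>2)" "cont (\<lambda>x. 2 / (fst x)\<^sup>2)"
    using R1_pos by (auto intro!: cont_fst continuous_intros)
  have eqs: "vr x * a1 x + vt x / r * a2 x + vz x * a3 x - (vt x)\<^sup>2 / r + pr x =
          \<nu> * (a11 x + 1 / r * a1 x + 1 / r\<^sup>2 * a22 x + a33 x - 1 / r\<^sup>2 * vr x) - \<nu> * (2 / r\<^sup>2) * b2 x \<and>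
        vr x * b1 x + vt x / r * b2 x + vz x * b3 x + vr x * vt x / r + 1 / r * pt x =
          \<nu> * (b11 x + 1 / r * b1 x + 1 / r\<^sup>2 * b22 x + b33 x - 1 / r\<^sup>2 * vt x) + \<nu> * (2 / r\<^sup>2) * a2 x \<and>
        vr x * c1 x + vt x / r * c2 x + vz x * c3 x + pz x =
          \<nu> * (c11 x + 1 / r * c1 x + 1 / r\<^sup>2 * c22 x + c33 x) \<and>
        a1 x + (b2 x + vr x) / r + c3 x = 0"
    if r: "R1 < r" "r < R2" and x: "x = (r, \<theta>, z)" for r \<theta> z x
  proof -
    have r0: "r \<noteq> 0" using r R1_pos by simp
    have "d_r (\<lambda>(s, \<phi>, \<zeta>). s * vr (s, \<phi>, \<zeta>)) (r, \<theta>, z) = r * a1 (r, \<theta>, z) + 1 * vr (r, \<theta>, z)"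
      unfolding d_r_def prod.case
      by (rule DERIV_imp_deriv, rule DERIV_mult', rule DERIV_ident, rule has_drD[OF C1_D(5)[OF a(1)] r])
    then have dv: "1 / r * d_r (\<lambda>(s, \<phi>, \<zeta>). s * vr (s, \<phi>, \<zeta>)) (r, \<theta>, z) = a1 (r, \<theta>, z) + vr (r, \<theta>, z) / r"
      using r0 by (simp add: field_simps)
    from ns[unfolded navier_stokes_cyl_def, rule_format, of r \<theta> z, OF conjI[OF r]]
    show ?thesis
      unfolding Let_def x advect_def cyl_laplacian_def prod.case dv
        d_eq[OF a(1) r] d_eq[OF b(1) r] d_eq[OF c(1) r] d_eq[OF p r]
        dd_eq[OF a(1) a(5-7) r] dd_eq[OF b(1) b(5-7) r] dd_eq[OF c(1) c(5-7) r]
      by (simp add: add_divide_distrib)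
  qed
  have "jets \<nu> (comp3 vr vt vz) (comp3 a1 b1 c1) (comp3 a2 b2 c2) (comp3 a3 b3 c3)
    (comp3 a11 b11 c11) (comp3 a22 b22 c22) (comp3 a33 b33 c33) p pr pt pz"
    unfolding jets_def
  proof (intro conjI ballI)
    show "\<forall>i<3. C1 (comp3 vr vt vz i) (comp3 a1 b1 c1 i) (comp3 a2 b2 c2 i) (comp3 a3 b3 c3 i) \<and>
      per (comp3 vr vt vz i) \<and> cont (comp3 a11 b11 c11 i) \<and> cont (comp3 a22 b22 c22 i) \<and> cont (comp3 a33 b33 c33 i) \<and>
      has_dr (comp3 a1 b1 c1 i) (comp3 a11 b11 c11 i) \<and> has_dt (comp3 a2 b2 c2 i) (comp3 a22 b22 c22 i) \<and>
      has_dz (comp3 a3 b3 c3 i) (comp3 a33 b33 c33 i)"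
      using a b c pe by (auto elim!: lt3_cases)
    show "solenoidal (comp3 vr vt vz) (comp3 a1 b1 c1) (comp3 a2 b2 c2) (comp3 a3 b3 c3)"
      unfolding solenoidal_def Let_def
    proof (intro allI impI)
      fix r \<theta> z assume r: "R1 \<le> r \<and> r \<le> R2"
      have "(\<lambda>x. a1 x + 1 / fst x * (b2 x + vr x) + c3 x) (r, \<theta>, z) = 0"
      proof (rule cont_zero_closure)
        show "cont (\<lambda>x. a1 x + 1 / fst x * (b2 x + vr x) + c3 x)"
          by (intro cont_add cont_mult rad ac bc cc)
      qed (use eqs r in \<open>auto simp: S_iff\<close>)
      then show "comp3 a1 b1 c1 0 (r, \<theta>, z) + (comp3 a2 b2 c2 1 (r, \<theta>, z) + comp3 vr vt vz 0 (r, \<theta>, z)) / r +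
          comp3 a3 b3 c3 2 (r, \<theta>, z) = 0" by simp
    qed
    fix x :: cyl assume x: "x \<in> S"
    have "(\<lambda>x. vr x * a1 x + 1 / fst x * vt x * a2 x + vz x * a3 x - 1 / fst x * (vt x)\<^sup>2 + pr x) x =
       (\<lambda>x. \<nu> * (a11 x + 1 / fst x * a1 x + 1 / (fst x)\<^sup>2 * a22 x + a33 x - 1 / (fst x)\<^sup>2 * vr x) - \<nu> * (2 / (fst x)\<^sup>2) * b2 x) x"
      by (rule cont_eq_closure[OF _ _ _ x], (intro cont_add cont_diff cont_mult cont_power cont_const rad ac bc cc pc)+)
        (use eqs in auto)
    then show "comp3 vr vt vz 0 x * comp3 a1 b1 c1 0 x + comp3 vr vt vz 1 x / fst x * comp3 a2 b2 c2 0 x +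
         comp3 vr vt vz 2 x * comp3 a3 b3 c3 0 x - (comp3 vr vt vz 1 x)\<^sup>2 / fst x + pr x =
         \<nu> * (comp3 a11 b11 c11 0 x + 1 / fst x * comp3 a1 b1 c1 0 x + 1 / (fst x)\<^sup>2 * comp3 a22 b22 c22 0 x +
             comp3 a33 b33 c33 0 x - 1 / (fst x)\<^sup>2 * comp3 vr vt vz 0 x) - \<nu> * (2 / (fst x)\<^sup>2) * comp3 a2 b2 c2 1 x"
      by simp
    have "(\<lambda>x. vr x * b1 x + 1 / fst x * vt x * b2 x + vz x * b3 x + 1 / fst x * (vr x * vt x) + 1 / fst x * pt x) x =
       (\<lambda>x. \<nu> * (b11 x + 1 / fst x * b1 x + 1 / (fst x)\<^sup>2 * b22 x + b33 x - 1 / (fst x)\<^sup>2 * vt x) + \<nu> * (2 / (fst x)\<^sup>2) * a2 x) x"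
      by (rule cont_eq_closure[OF _ _ _ x], (intro cont_add cont_diff cont_mult cont_power cont_const rad ac bc cc pc)+)
        (use eqs in auto)
    then show "comp3 vr vt vz 0 x * comp3 a1 b1 c1 1 x + comp3 vr vt vz 1 x / fst x * comp3 a2 b2 c2 1 x +
         comp3 vr vt vz 2 x * comp3 a3 b3 c3 1 x + comp3 vr vt vz 0 x * comp3 vr vt vz 1 x / fst x + 1 / fst x * pt x =
         \<nu> * (comp3 a11 b11 c11 1 x + 1 / fst x * comp3 a1 b1 c1 1 x + 1 / (fst x)\<^sup>2 * comp3 a22 b22 c22 1 x +
             comp3 a33 b33 c33 1 x - 1 / (fst x)\<^sup>2 * comp3 vr vt vz 1 x) + \<nu> * (2 / (fst x)\<^sup>2) * comp3 a2 b2 c2 0 x"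
      by simp
    have "(\<lambda>x. vr x * c1 x + 1 / fst x * vt x * c2 x + vz x * c3 x + pz x) x =
       (\<lambda>x. \<nu> * (c11 x + 1 / fst x * c1 x + 1 / (fst x)\<^sup>2 * c22 x + c33 x)) x"
      by (rule cont_eq_closure[OF _ _ _ x], (intro cont_add cont_diff cont_mult cont_power cont_const rad ac bc cc pc)+)
        (use eqs in auto)
    then show "comp3 vr vt vz 0 x * comp3 a1 b1 c1 2 x + comp3 vr vt vz 1 x / fst x * comp3 a2 b2 c2 2 x +
         comp3 vr vt vz 2 x * comp3 a3 b3 c3 2 x + pz x =
         \<nu> * (comp3 a11 b11 c11 2 x + 1 / fst x * comp3 a1 b1 c1 2 x + 1 / (fst x)\<^sup>2 * comp3 a22 b22 c22 2 x +
             comp3 a33 b33 c33 2 x)"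
      by simp
  qed (use p pe in auto)
  then show ?thesis by (rule that)
qed

text \<open>The momentum flux: advection, isotropic pressure and viscous part. With the index 3 j +
  i the diagonal entries are 0, 4 and 8.\<close>

definition stress :: "real \<Rightarrow> field \<Rightarrow> field \<Rightarrow> field \<Rightarrow> field \<Rightarrow> (cyl \<Rightarrow> real) \<Rightarrow> nat \<Rightarrow> cyl \<Rightarrow> real" where
  "stress \<nu> V Vr Vt Vz p k x =
     V (k div 3) x * V (k mod 3) x + (if k \<in> {0, 4, 8} then p x else 0) - \<nu> * grad V Vr Vt Vz k x"

text \<open>Conservation form of the equations. Each component of the divergence, times r, is r
  times the residual of the momentum equation plus r \<open>V i\<close> times the divergence of
  \<open>V\<close>; the latter arises when the derivative is moved onto the product of
  velocities.\<close>

lemma jets_divfree: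
  assumes j: "jets \<nu> V Vr Vt Vz Vrr Vtt Vzz p pr pt pz"
  obtains DM where "divfree (stress \<nu> V Vr Vt Vz p) DM"
proof -
  have V: "C1 (V i) (Vr i) (Vt i) (Vz i)" "per (V i)" "cont (Vrr i)" "cont (Vtt i)" "cont (Vzz i)"
    "has_dr (Vr i) (Vrr i)" "has_dt (Vt i) (Vtt i)" "has_dz (Vz i) (Vzz i)" if "i < 3" for i
    using j that unfolding jets_def by blast+
  have p: "C1 p pr pt pz" "per p" using j unfolding jets_def by blast+
  note Vc = C1_D(1-4)[OF V(1)] and Vd = C1_D(5-7)[OF V(1)] and pc = C1_D(1-4)[OF p(1)] and pd = C1_D(5-7)[OF p(1)]
  define DM where "DM = (\<lambda>k x.
     if k < 3 then V 0 x * Vr k x + Vr 0 x * V k x + (if k = 0 then pr x else 0) - \<nu> * Vrr k x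
     else if k = 3 then V 1 x * Vt 0 x + Vt 1 x * V 0 x - \<nu> * ((Vtt 0 x - Vt 1 x) / fst x)
     else if k = 4 then V 1 x * Vt 1 x + Vt 1 x * V 1 x + pt x - \<nu> * ((Vtt 1 x + Vt 0 x) / fst x)
     else if k = 5 then V 1 x * Vt 2 x + Vt 1 x * V 2 x - \<nu> * (Vtt 2 x / fst x)
     else V 2 x * Vz (k - 6) x + Vz 2 x * V (k - 6) x + (if k = 8 then pz x else 0) - \<nu> * Vzz (k - 6) x)"
  let ?M = "stress \<nu> V Vr Vt Vz p"
  have M: "?M 0 = (\<lambda>x. V 0 x * V 0 x + p x - \<nu> * Vr 0 x)" "?M 1 = (\<lambda>x. V 0 x * V 1 x + 0 - \<nu> * Vr 1 x)"
    "?M 2 = (\<lambda>x. V 0 x * V 2 x + 0 - \<nu> * Vr 2 x)"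
    "?M 3 = (\<lambda>x. V 1 x * V 0 x + 0 - \<nu> * ((Vt 0 x - V 1 x) / fst x))"
    "?M 4 = (\<lambda>x. V 1 x * V 1 x + p x - \<nu> * ((Vt 1 x + V 0 x) / fst x))"
    "?M 5 = (\<lambda>x. V 1 x * V 2 x + 0 - \<nu> * (Vt 2 x / fst x))"
    "?M 6 = (\<lambda>x. V 2 x * V 0 x + 0 - \<nu> * Vz 0 x)" "?M 7 = (\<lambda>x. V 2 x * V 1 x + 0 - \<nu> * Vz 1 x)"
    "?M 8 = (\<lambda>x. V 2 x * V 2 x + p x - \<nu> * Vz 2 x)"
    by (auto simp: stress_def grad_def)
  have D: "DM 0 = (\<lambda>x. V 0 x * Vr 0 x + Vr 0 x * V 0 x + pr x - \<nu> * Vrr 0 x)"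
    "DM 1 = (\<lambda>x. V 0 x * Vr 1 x + Vr 0 x * V 1 x + 0 - \<nu> * Vrr 1 x)"
    "DM 2 = (\<lambda>x. V 0 x * Vr 2 x + Vr 0 x * V 2 x + 0 - \<nu> * Vrr 2 x)"
    "DM 3 = (\<lambda>x. V 1 x * Vt 0 x + Vt 1 x * V 0 x + 0 - \<nu> * ((Vtt 0 x - Vt 1 x) / fst x))"
    "DM 4 = (\<lambda>x. V 1 x * Vt 1 x + Vt 1 x * V 1 x + pt x - \<nu> * ((Vtt 1 x + Vt 0 x) / fst x))"
    "DM 5 = (\<lambda>x. V 1 x * Vt 2 x + Vt 1 x * V 2 x + 0 - \<nu> * (Vtt 2 x / fst x))"
    "DM 6 = (\<lambda>x. V 2 x * Vz 0 x + Vz 2 x * V 0 x + 0 - \<nu> * Vzz 0 x)"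
    "DM 7 = (\<lambda>x. V 2 x * Vz 1 x + Vz 2 x * V 1 x + 0 - \<nu> * Vzz 1 x)"
    "DM 8 = (\<lambda>x. V 2 x * Vz 2 x + Vz 2 x * V 2 x + pz x - \<nu> * Vzz 2 x)"
    by (auto simp: DM_def)
  have k9: "P k" if "k < 9" "P 0" "P 1" "P 2" "P 3" "P 4" "P 5" "P 6" "P 7" "P 8" for P and k :: nat
  proof -
    have "k = 0 \<or> k = 1 \<or> k = 2 \<or> k = 3 \<or> k = 4 \<or> k = 5 \<or> k = 6 \<or> k = 7 \<or> k = 8" using that(1) by auto
    then show ?thesis using that by blast
  qed
  have pm: "per (\<lambda>x. f x - g x)" "per (\<lambda>x. f x + g x)" "per (\<lambda>x. f x * g x)" if "per f" "per g" for f g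
    using that by (auto simp: per_def theta_periodic_def)
  have pq: "per (\<lambda>x. f x / fst x)" if "per f" for f
    using that by (auto simp: per_def theta_periodic_def)
  have peV: "per (V i)" "per (Vr i)" "per (Vt i)" "per (Vz i)" if "i < 3" for i
    using V(2)[OF that] per_dr[OF V(1)[OF that] V(2)[OF that]] per_dz[OF V(1)[OF that] V(2)[OF that]] per_dt[OF Vd(2)[OF that] V(2)[OF that]] by auto
  have "divfree ?M DM"
    unfolding divfree_def
  proof (intro conjI allI impI)
    fix k :: nat assume k: "k < 9"
    show "cont (?M k)"
      by (rule k9[OF k]; (unfold M)?; intro cont_add cont_diff cont_mult cont_divide_r cont_const Vc pc; simp)
    show "cont (DM k)"
      by (rule k9[OF k]; (unfold D)?; intro cont_add cont_diff cont_mult cont_divide_r cont_const Vc pc V(3-5); simp)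
    have c0: "per (\<lambda>x. c)" for c :: real by (simp add: per_def theta_periodic_def)
    show "per (?M k)"
      by (rule k9[OF k]; (unfold M)?; intro pm pq c0 peV p(2); simp)
  next
    fix k :: nat assume k: "k < 3"
    have dr: "has_dr (\<lambda>x. f x * g x + q x - \<nu> * h x) (\<lambda>x. f x * g' x + f' x * g x + q' x - \<nu> * h' x)"
      if "has_dr f f'" "has_dr g g'" "has_dr q q'" "has_dr h h'" for f f' g g' q q' h h'
      unfolding has_dr_def by (intro allI impI DERIV_add DERIV_diff DERIV_cmult DERIV_mult' has_drD that; simp)
    have 0: "has_dr (\<lambda>x. 0) (\<lambda>x. 0)" by (simp add: has_dr_def)
    show "has_dr (?M k) (DM k)"
      by (rule lt3_cases[OF k]; unfold M D; intro dr Vd V pd 0; simp)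
  next
    have dt: "has_dt (\<lambda>x. f x * g x + q x - \<nu> * (h x / fst x)) (\<lambda>x. f x * g' x + f' x * g x + q' x - \<nu> * (h' x / fst x))"
      if "has_dt f f'" "has_dt g g'" "has_dt q q'" "has_dt h h'" for f f' g g' q q' h h'
      unfolding has_dt_def fst_conv
      by (intro allI impI DERIV_add DERIV_diff DERIV_cmult DERIV_mult' DERIV_cdivide has_dtD that; simp)
    have 0: "has_dt (\<lambda>x. 0) (\<lambda>x. 0)" by (simp add: has_dt_def)
    have dd: "has_dt (\<lambda>x. f x - g x) (\<lambda>x. f' x - g' x)" "has_dt (\<lambda>x. f x + g x) (\<lambda>x. f' x + g' x)"
      if "has_dt f f'" "has_dt g g'" for f f' g g'
      unfolding has_dt_def by (intro allI impI DERIV_add DERIV_diff has_dtD that; simp)+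
    have "has_dt (?M 3) (DM 3)" "has_dt (?M 4) (DM 4)" "has_dt (?M 5) (DM 5)"
      unfolding M D by (intro dt dd Vd V pd 0; simp)+
    then show "\<forall>k\<in>{3, 4, 5}. has_dt (?M k) (DM k)" by blast
  next
    have dz: "has_dz (\<lambda>x. f x * g x + q x - \<nu> * h x) (\<lambda>x. f x * g' x + f' x * g x + q' x - \<nu> * h' x)"
      if "has_dz f f'" "has_dz g g'" "has_dz q q'" "has_dz h h'" for f f' g g' q q' h h'
      unfolding has_dz_def by (intro allI impI DERIV_add DERIV_diff DERIV_cmult DERIV_mult' has_dzD that; simp)
    have 0: "has_dz (\<lambda>x. 0) (\<lambda>x. 0)" by (simp add: has_dz_def)
    have "has_dz (?M 6) (DM 6)" "has_dz (?M 7) (DM 7)" "has_dz (?M 8) (DM 8)"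
      unfolding M D by (intro dz Vd V pd 0; simp)+
    then show "\<forall>k\<in>{6, 7, 8}. has_dz (?M k) (DM k)" by blast
  next
    fix r \<theta> z :: real assume r: "R1 \<le> r \<and> r \<le> R2"
    define x where "x = (r, \<theta>, z)"
    have x: "x \<in> S" "fst x = r" using r by (auto simp: x_def S_iff)
    have r0: "r \<noteq> 0" using r R1_pos by auto
    have e1: "V 0 x * Vr 0 x + V 1 x / r * Vt 0 x + V 2 x * Vz 0 x - (V 1 x)\<^sup>2 / r + pr x =
          \<nu> * (Vrr 0 x + 1 / r * Vr 0 x + 1 / r\<^sup>2 * Vtt 0 x + Vzz 0 x - 1 / r\<^sup>2 * V 0 x) - \<nu> * (2 / r\<^sup>2) * Vt 1 x"
      and e2: "V 0 x * Vr 1 x + V 1 x / r * Vt 1 x + V 2 x * Vz 1 x + V 0 x * V 1 x / r + 1 / r * pt x =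
          \<nu> * (Vrr 1 x + 1 / r * Vr 1 x + 1 / r\<^sup>2 * Vtt 1 x + Vzz 1 x - 1 / r\<^sup>2 * V 1 x) + \<nu> * (2 / r\<^sup>2) * Vt 0 x"
      and e3: "V 0 x * Vr 2 x + V 1 x / r * Vt 2 x + V 2 x * Vz 2 x + pz x =
          \<nu> * (Vrr 2 x + 1 / r * Vr 2 x + 1 / r\<^sup>2 * Vtt 2 x + Vzz 2 x)"
      using j x unfolding jets_def by metis+
    have dv: "Vr 0 x + (Vt 1 x + V 0 x) / r + Vz 2 x = 0"
      using j r unfolding jets_def solenoidal_def Let_def x_def by blast
    let ?d = "Vr 0 x + (Vt 1 x + V 0 x) / r + Vz 2 x"
    have "r * DM 0 x + ?M 0 x + DM 3 x - ?M 4 x + r * DM 6 x =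
        r * ((V 0 x * Vr 0 x + V 1 x / r * Vt 0 x + V 2 x * Vz 0 x - (V 1 x)\<^sup>2 / r + pr x) -
          (\<nu> * (Vrr 0 x + 1 / r * Vr 0 x + 1 / r\<^sup>2 * Vtt 0 x + Vzz 0 x - 1 / r\<^sup>2 * V 0 x) - \<nu> * (2 / r\<^sup>2) * Vt 1 x)) + r * V 0 x * ?d"
      unfolding M D using r0 by (simp add: x(2) field_simps power2_eq_square)
    then have 1: "r * DM 0 x + ?M 0 x + DM 3 x - ?M 4 x + r * DM 6 x = 0" unfolding e1 dv by simp
    have "r * DM 1 x + ?M 1 x + DM 4 x + ?M 3 x + r * DM 7 x =
        r * ((V 0 x * Vr 1 x + V 1 x / r * Vt 1 x + V 2 x * Vz 1 x + V 0 x * V 1 x / r + 1 / r * pt x) -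
          (\<nu> * (Vrr 1 x + 1 / r * Vr 1 x + 1 / r\<^sup>2 * Vtt 1 x + Vzz 1 x - 1 / r\<^sup>2 * V 1 x) + \<nu> * (2 / r\<^sup>2) * Vt 0 x)) + r * V 1 x * ?d"
      unfolding M D using r0 by (simp add: x(2) field_simps power2_eq_square)
    then have 2: "r * DM 1 x + ?M 1 x + DM 4 x + ?M 3 x + r * DM 7 x = 0" unfolding e2 dv by simp
    have "r * DM 2 x + ?M 2 x + DM 5 x + r * DM 8 x =
        r * ((V 0 x * Vr 2 x + V 1 x / r * Vt 2 x + V 2 x * Vz 2 x + pz x) -
          (\<nu> * (Vrr 2 x + 1 / r * Vr 2 x + 1 / r\<^sup>2 * Vtt 2 x + Vzz 2 x))) + r * V 2 x * ?d"
      unfolding M D using r0 by (simp add: x(2) field_simps power2_eq_square)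
    then have 3: "r * DM 2 x + ?M 2 x + DM 5 x + r * DM 8 x = 0" unfolding e3 dv by simp
    show "let x = (r, \<theta>, z) in
        r * DM 0 x + ?M 0 x + DM 3 x - ?M 4 x + r * DM 6 x = 0 \<and>
        r * DM 1 x + ?M 1 x + DM 4 x + ?M 3 x + r * DM 7 x = 0 \<and>
        r * DM 2 x + ?M 2 x + DM 5 x + r * DM 8 x = 0"
      unfolding Let_def using 1 2 3 by (simp add: x_def)
  qed
  then show ?thesis by (rule that)
qed

lemma divfree_diff:
  assumes "divfree M DM" "divfree M' DM'"
  shows "divfree (\<lambda>k x. M k x - M' k x) (\<lambda>k x. DM k x - DM' k x)"
  unfolding divfree_def
proof (intro conjI allI impI ballI)
  fix k :: nat
  show "cont (\<lambda>x. M k x - M' k x)" "cont (\<lambda>x. DM k x - DM' k x)" if "k < 9"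
    using assms that unfolding divfree_def by auto
  show "per (\<lambda>x. M k x - M' k x)" if "k < 9"
    using assms that unfolding divfree_def per_def theta_periodic_def by auto
  show "has_dr (\<lambda>x. M k x - M' k x) (\<lambda>x. DM k x - DM' k x)" if "k < 3"
  proof -
    have "has_dr (M k) (DM k)" "has_dr (M' k) (DM' k)" using assms that unfolding divfree_def by auto
    then show ?thesis unfolding has_dr_def by (auto intro: DERIV_diff)
  qed
  show "has_dt (\<lambda>x. M k x - M' k x) (\<lambda>x. DM k x - DM' k x)" if "k \<in> {3, 4, 5}"
  proof -
    have "has_dt (M k) (DM k)" "has_dt (M' k) (DM' k)" using assms that unfolding divfree_def by blast+
    then show ?thesis unfolding has_dt_def by (auto intro: DERIV_diff)
  qed
  show "has_dz (\<lambda>x. M k x - M' k x) (\<lambda>x. DM k x - DM' k x)" if "k \<in> {6, 7, 8}"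
  proof -
    have "has_dz (M k) (DM k)" "has_dz (M' k) (DM' k)" using assms that unfolding divfree_def by blast+
    then show ?thesis unfolding has_dz_def by (auto intro: DERIV_diff)
  qed
next
  fix r \<theta> z :: real assume r: "R1 \<le> r \<and> r \<le> R2"
  let ?x = "(r, \<theta>, z)"
  have "r * DM 0 ?x + M 0 ?x + DM 3 ?x - M 4 ?x + r * DM 6 ?x = 0"
        "r * DM 1 ?x + M 1 ?x + DM 4 ?x + M 3 ?x + r * DM 7 ?x = 0"
        "r * DM 2 ?x + M 2 ?x + DM 5 ?x + r * DM 8 ?x = 0"
        "r * DM' 0 ?x + M' 0 ?x + DM' 3 ?x - M' 4 ?x + r * DM' 6 ?x = 0"
        "r * DM' 1 ?x + M' 1 ?x + DM' 4 ?x + M' 3 ?x + r * DM' 7 ?x = 0"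
        "r * DM' 2 ?x + M' 2 ?x + DM' 5 ?x + r * DM' 8 ?x = 0"
    using assms r unfolding divfree_def Let_def by blast+
  then show "let x = ?x in
        r * (DM 0 x - DM' 0 x) + (M 0 x - M' 0 x) + (DM 3 x - DM' 3 x) - (M 4 x - M' 4 x) + r * (DM 6 x - DM' 6 x) = 0 \<and>
        r * (DM 1 x - DM' 1 x) + (M 1 x - M' 1 x) + (DM 4 x - DM' 4 x) + (M 3 x - M' 3 x) + r * (DM 7 x - DM' 7 x) = 0 \<and>
        r * (DM 2 x - DM' 2 x) + (M 2 x - M' 2 x) + (DM 5 x - DM' 5 x) + r * (DM 8 x - DM' 8 x) = 0"
    unfolding Let_def right_diff_distrib by linarith
qed

lemma flux_derivative:
  assumes u: "vfield u ur ut uz" and s: "solenoidal u ur ut uz"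
  shows "((\<lambda>s. ang_int (rad_int (\<lambda>x. fst x * u 2 x)) (R1, 0, s)) has_real_derivative 0) (at z)"
proof -
  have uc: "C1 (u i) (ur i) (ut i) (uz i)" "per (u i)" "u i (R2, \<theta>, z) = 0" if "i < 3" for i \<theta> z
    using u that by (auto simp: vfield_def)
  have "C1 (\<lambda>x. fst x) (\<lambda>x. 1) (\<lambda>x. 0) (\<lambda>x. 0)"
    by (rule C1_radial[of "\<lambda>r. r" "\<lambda>r. 1"]) (auto intro: continuous_intros)
  from C1_mult[OF this uc(1)[of 2]]
  have f: "C1 (\<lambda>x. fst x * u 2 x) (\<lambda>x. fst x * ur 2 x + 1 * u 2 x) (\<lambda>x. fst x * ut 2 x) (\<lambda>x. fst x * uz 2 x)" by simp
  have "rad_int (\<lambda>x. fst x * uz 2 x) x = - rad_int (ut 1) x" for x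
  proof -
    obtain r \<theta> z where x: "x = (r, \<theta>, z)" by (cases x)
    show ?thesis
      using rad_prim_axial_derivative[OF u s, of "(R2, \<theta>, z)"] R1_less_R2 uc(3)[of 0] by (simp add: x rad_int_eq S_iff)
  qed
  then have "rad_int (\<lambda>x. fst x * uz 2 x) = (\<lambda>x. (-1) * rad_int (ut 1) x)" by auto
  then have "ang_int (rad_int (\<lambda>x. fst x * uz 2 x)) (R1, 0, z) = ang_int (\<lambda>x. (-1) * rad_int (ut 1) x) (R1, 0, z)"
    by (simp only:)
  also have "\<dots> = - rad_int (ang_int (ut 1)) (R1, 0, z)"
    unfolding ang_int_cmult using ang_rad_swap[OF C1_D(3)[OF uc(1)[of 1]]] by simp
  also have "rad_int (ang_int (ut 1)) (R1, 0, z) = rad_int (\<lambda>x. 0) (R1, 0, z)"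
  proof (rule rad_int_cong)
    show "ang_int (ut 1) x = 0" if "x \<in> S" for x
      using ang_int_dt_zero[OF C1_D(6)[OF uc(1)[of 1]] uc(2)[of 1]] that by (cases x) (auto simp: S_iff)
  qed
  also have "\<dots> = 0" by (simp add: rad_int_def)
  finally have "ang_int (rad_int (\<lambda>x. fst x * uz 2 x)) (R1, 0, z) = 0" by simp
  then show ?thesis
    using has_dzD[OF ang_int_has_dz[OF C1_rad_int[OF f]], of R1 0 z] R1_less_R2 by simp
qed


section \<open>Pointwise bounds and the base flow\<close>

lemma per_int:
  assumes p: "per f" and r: "R1 \<le> r" "r \<le> R2"
  shows "f (r, \<theta> + 2 * pi * of_int k, z) = f (r, \<theta>, z)"
proof -
  have n: "f (r, \<theta> + 2 * pi * of_nat n, z) = f (r, \<theta>, z)" for n \<theta>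
  proof (induction n)
    case (Suc n)
    have "f (r, (\<theta> + 2 * pi * of_nat n) + 2 * pi, z) = f (r, \<theta> + 2 * pi * of_nat n, z)"
      using p r unfolding per_def theta_periodic_def by blast
    then show ?case using Suc by (simp add: algebra_simps)
  qed simp
  show ?thesis
  proof (cases k)
    case (nonneg m) then show ?thesis using n[of \<theta> m] by simp
  next
    case (neg m)
    then have "of_int k = - 1 - (of_nat m :: real)" by simp
    then have "\<theta> + 2 * pi * of_int k + 2 * pi * of_nat (Suc m) = \<theta>" by (simp only: of_nat_Suc) (simp add: algebra_simps)
    then show ?thesis using n[of "\<theta> + 2 * pi * of_int k" "Suc m"] by metis
  qed
qed

lemma norm_velocity_field:
  "(norm (velocity_field vr vt vz x))\<^sup>2 =
    (let y = (sqrt ((x$1)\<^sup>2 + (x$2)\<^sup>2), Arg (Complex (x$1) (x$2)), x$3) in (vr y)\<^sup>2 + (vt y)\<^sup>2 + (vz y)\<^sup>2)"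
proof -
  have e: "(a * c - b * s)\<^sup>2 + (a * s + b * c)\<^sup>2 + d\<^sup>2 = (a\<^sup>2 + b\<^sup>2) * (s\<^sup>2 + c\<^sup>2) + d\<^sup>2" for a b c d s :: real
    by (simp add: power2_eq_square algebra_simps)
  show ?thesis
    unfolding velocity_field_def Let_def power2_norm_eq_inner inner_vec_def sum_3
    by (simp add: vector_3 e flip: power2_eq_square)
qed

text \<open>The data bound an essential supremum in Cartesian space. Where the angle is continuous,
  the set on which \<open>f\<close> exceeds \<open>C\<close> is open, and it is null, hence empty.
  Continuity up to the boundary and periodicity give the remaining points.\<close>

lemma small_data_bound:
  assumes sd: "small_data C R1 R2 \<omega>1 \<omega>2 vr vt vz" and f: "cont f" "per f"
    and fv: "\<And>y. (f y)\<^sup>2 \<le> (vr y)\<^sup>2 + (vt y)\<^sup>2 + (vz y)\<^sup>2" and x: "x \<in> S"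
  shows "\<bar>f x\<bar> \<le> C"
proof -
  define V where "V = velocity_field vr vt vz"
  define coord where "coord = (\<lambda>x::real^3. (sqrt ((x$1)\<^sup>2 + (x$2)\<^sup>2), Arg (Complex (x$1) (x$2)), x$3))"
  \<comment> \<open>Space slit along the half-plane of angle \<pi>, where \<open>Arg\<close>
    jumps.\<close>
  define D where "D = Omega R1 R2 \<inter> {x. Complex (x$1) (x$2) \<in> - \<real>\<^sub>\<le>\<^sub>0}"
  have cc: "continuous_on A (\<lambda>x::real^3. Complex (x$1) (x$2))" for A
    unfolding Complex_eq by (intro continuous_intros)
  have oOm: "open (Omega R1 R2)"
    unfolding Omega_def by (intro open_Collect_conj open_Collect_less continuous_intros)
  have "open ((\<lambda>x::real^3. Complex (x$1) (x$2)) -` (- \<real>\<^sub>\<le>\<^sub>0))"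
    using closed_nonpos_Reals_complex by (intro open_vimage cc) (simp add: open_Compl)
  then have oD: "open D" unfolding D_def using oOm by (auto simp: vimage_def)
  have fle: "\<bar>f (coord x)\<bar> \<le> norm (V x)" for x
  proof -
    have "(f (coord x))\<^sup>2 \<le> (norm (V x))\<^sup>2"
      using norm_velocity_field[of vr vt vz x] fv[of "coord x"] by (simp add: Let_def V_def coord_def)
    then show ?thesis using abs_le_square_iff[of "f (coord x)" "norm (V x)"] by simp
  qed
  have lt: "Linf_norm (Omega R1 R2) V < ereal C" using sd by (simp add: small_data_def V_def)
  have "AE x in lebesgue_on (Omega R1 R2). ereal (norm (V x)) \<le> Linf_norm (Omega R1 R2) V"
    unfolding Linf_norm_def by (rule esssup_AE)
  then have ae: "AE x in lebesgue_on (Omega R1 R2). ereal (norm (V x)) < ereal C"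
    by (rule eventually_mono) (use lt le_less_trans in blast)
  have "AE x in lebesgue. x \<in> Omega R1 R2 \<longrightarrow> norm (V x) < C"
    using ae oOm by (subst (asm) AE_restrict_space_iff) auto
  then obtain Nn where Nn: "Nn \<in> null_sets lebesgue" "{x. \<not> (x \<in> Omega R1 R2 \<longrightarrow> norm (V x) < C)} \<subseteq> Nn"
    by (auto simp: eventually_ae_filter)
  have cf: "continuous_on D (\<lambda>x. f (coord x))"
    unfolding coord_def
  proof (rule cont_compose[OF f(1)])
    show "continuous_on D (\<lambda>x. Arg (Complex (x$1) (x$2)))"
      by (rule continuous_on_Arg'[OF cc]) (auto simp: D_def)
  qed (auto intro!: continuous_intros simp: D_def Omega_def)
  define B where "B = D \<inter> (\<lambda>x. f (coord x)) -` {y. \<bar>y\<bar> > C}"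
  have "open {y::real. \<bar>y\<bar> > C}" by (intro open_Collect_less continuous_intros)
  then have oB: "open B" unfolding B_def by (rule continuous_open_preimage[OF cf oD])
  have "B \<subseteq> Nn"
  proof
    fix x assume "x \<in> B"
    then have "x \<in> Omega R1 R2" "C < \<bar>f (coord x)\<bar>" by (auto simp: B_def D_def)
    then show "x \<in> Nn" using Nn(2) fle[of x] by auto
  qed
  then have "negligible B" using Nn(1) negligible_iff_null_sets negligible_subset by blast
  then have "B = {}" using open_not_negligible[OF oB] by blast
  then have Db: "\<bar>f (coord x)\<bar> \<le> C" if "x \<in> D" for x using that by (auto simp: B_def not_less)
  have open_b: "\<bar>f (r, \<theta>, z)\<bar> \<le> C" if r: "R1 < r" "r < R2" and \<theta>: "-pi < \<theta>" "\<theta> < pi" for r \<theta> z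
  proof -
    define x :: "real^3" where "x = vector [r * cos \<theta>, r * sin \<theta>, z]"
    have xc: "x$1 = r * cos \<theta>" "x$2 = r * sin \<theta>" "x$3 = z" by (simp_all add: x_def vector_3)
    have r0: "0 < r" using r R1_pos by simp
    have s: "sqrt ((x$1)\<^sup>2 + (x$2)\<^sup>2) = r"
    proof -
      have "(r * cos \<theta>)\<^sup>2 + (r * sin \<theta>)\<^sup>2 = r\<^sup>2 * ((sin \<theta>)\<^sup>2 + (cos \<theta>)\<^sup>2)"
        by (simp only: power_mult_distrib distrib_left add.commute)
      then show ?thesis using r0 by (simp add: xc)
    qed
    have z: "Complex (x$1) (x$2) = rcis r \<theta>" by (simp add: xc complex_eq_iff)
    have A: "Arg (rcis r \<theta>) = \<theta>" using \<theta> r0 by (intro Arg_rcis) auto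
    have co: "coord x = (r, \<theta>, z)" unfolding coord_def s z A by (simp add: xc)
    have "rcis r \<theta> \<notin> \<real>\<^sub>\<le>\<^sub>0"
    proof
      assume "rcis r \<theta> \<in> \<real>\<^sub>\<le>\<^sub>0"
      then have *: "r * sin \<theta> = 0" "r * cos \<theta> \<le> 0" by (auto simp: complex_nonpos_Reals_iff)
      then have "sin \<theta> = 0" using r0 by simp
      then have "\<theta> = 0" using \<theta> by (metis sin_eq_0_pi)
      then show False using * r0 by simp
    qed
    then have "x \<in> D" using r by (simp add: D_def Omega_def s z)
    then show ?thesis using Db[of x] by (simp add: co)
  qed
  obtain r \<theta> z where xx: "x = (r, \<theta>, z)" by (cases x)
  have r: "R1 \<le> r" "r \<le> R2" using x by (auto simp: xx S_iff)
  \<comment> \<open>Rounding moves \<theta> by whole periods into the closed interval from -\<pi> to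
    \<pi>, the closure of the angles already covered.\<close>
  define k where "k = round (\<theta> / (2 * pi))"
  define \<theta>' where "\<theta>' = \<theta> - 2 * pi * of_int k"
  have "\<bar>of_int k - \<theta> / (2 * pi)\<bar> \<le> 1 / 2" unfolding k_def by (rule of_int_round_abs_le)
  then have "\<bar>2 * pi * (of_int k - \<theta> / (2 * pi))\<bar> \<le> 2 * pi * (1 / 2)"
    unfolding abs_mult by (intro mult_mono) auto
  then have \<theta>': "-pi \<le> \<theta>'" "\<theta>' \<le> pi" by (auto simp: \<theta>'_def right_diff_distrib abs_le_iff)
  have fx: "f x = f (r, \<theta>', z)" using per_int[OF f(2) r, of \<theta>' k z] by (simp add: xx \<theta>'_def)
  let ?Q = "{R1<..<R2} \<times> {-pi<..<pi}"
  have cl: "closure ?Q = {R1..R2} \<times> {-pi..pi}"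
    using R1_less_R2 by (simp add: closure_Times closure_greaterThanLessThan)
  have "(\<lambda>y. \<bar>f (fst y, snd y, z)\<bar>) (r, \<theta>') \<le> C"
  proof (rule continuous_le_on_closure[of ?Q "\<lambda>y. \<bar>f (fst y, snd y, z)\<bar>" "(r, \<theta>')" C])
    show "continuous_on (closure ?Q) (\<lambda>y. \<bar>f (fst y, snd y, z)\<bar>)"
      unfolding cl by (intro continuous_on_rabs cont_compose[OF f(1)]) (auto intro!: continuous_intros)
    show "(r, \<theta>') \<in> closure ?Q" unfolding cl using r \<theta>' by auto
  qed (use open_b in auto)
  then show ?thesis by (simp add: fx)
qed

definition \<eta> :: real where "\<eta> = R1 / R2"

text \<open>The axial profile for unit pressure gradient with no slip at either wall;
  \<open>a\<close> times it is the third component of the generalized flow.\<close>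

definition poiseuille :: "real \<Rightarrow> real \<Rightarrow> real" where
  "poiseuille \<nu> r = R1\<^sup>2 / (4 * \<nu>) * ((r / R1)\<^sup>2 - 1 + (1 - \<eta>\<^sup>2) / (\<eta>\<^sup>2 * ln \<eta>) * ln (r / R1))"

definition poiseuille1 :: "real \<Rightarrow> real \<Rightarrow> real" where
  "poiseuille1 \<nu> r = R1\<^sup>2 / (4 * \<nu>) * (2 * r / R1\<^sup>2 + (1 - \<eta>\<^sup>2) / (\<eta>\<^sup>2 * ln \<eta>) * (1 / r))"

definition poiseuille2 :: "real \<Rightarrow> real \<Rightarrow> real" where
  "poiseuille2 \<nu> r = R1\<^sup>2 / (4 * \<nu>) * (2 / R1\<^sup>2 - (1 - \<eta>\<^sup>2) / (\<eta>\<^sup>2 * ln \<eta>) * (1 / r\<^sup>2))"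

lemma eta: "0 < \<eta>" "\<eta> < 1" "ln \<eta> \<noteq> 0" "\<eta>\<^sup>2 < 1"
proof -
  show 1: "0 < \<eta>" "\<eta> < 1" using R1_pos R1_less_R2 by (auto simp: \<eta>_def)
  then show "ln \<eta> \<noteq> 0" using ln_less_zero[of \<eta>] by auto
  show "\<eta>\<^sup>2 < 1" using 1 by (simp add: power_less_one_iff)
qed

lemma poiseuille_deriv:
  assumes "0 < r"
  shows "(poiseuille \<nu> has_real_derivative poiseuille1 \<nu> r) (at r)"
    "(poiseuille1 \<nu> has_real_derivative poiseuille2 \<nu> r) (at r)"
proof -
  define k where "k = (1 - \<eta>\<^sup>2) / (\<eta>\<^sup>2 * ln \<eta>)"
  have "((\<lambda>r. (r / R1)\<^sup>2 - 1 + k * ln (r / R1)) has_real_derivative 2 * r / R1\<^sup>2 + k * (1 / r)) (at r)"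
    using assms R1_pos by (auto intro!: derivative_eq_intros simp: power2_eq_square)
  from DERIV_cmult[OF this, of "R1\<^sup>2 / (4 * \<nu>)"]
  show "(poiseuille \<nu> has_real_derivative poiseuille1 \<nu> r) (at r)"
    by (simp add: poiseuille_def[abs_def] poiseuille1_def k_def)
  have "((\<lambda>r. 2 * r / R1\<^sup>2 + k * (1 / r)) has_real_derivative 2 / R1\<^sup>2 - k * (1 / r\<^sup>2)) (at r)"
    using assms R1_pos by (auto intro!: derivative_eq_intros simp: power2_eq_square)
  from DERIV_cmult[OF this, of "R1\<^sup>2 / (4 * \<nu>)"]
  show "(poiseuille1 \<nu> has_real_derivative poiseuille2 \<nu> r) (at r)"
    by (simp add: poiseuille1_def[abs_def] poiseuille2_def k_def)
qed

lemma poiseuille_ode: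
  assumes "0 < r" "0 < \<nu>" shows "\<nu> * (poiseuille2 \<nu> r + 1 / r * poiseuille1 \<nu> r) = 1"
proof -
  define k where "k = (1 - \<eta>\<^sup>2) / (\<eta>\<^sup>2 * ln \<eta>)"
  show ?thesis
    unfolding poiseuille1_def poiseuille2_def k_def[symmetric] using assms R1_pos
    by (simp add: field_simps power2_eq_square)
qed

lemma poiseuille_bc: "poiseuille \<nu> R1 = 0" "poiseuille \<nu> R2 = 0"
proof -
  show "poiseuille \<nu> R1 = 0" using R1_pos by (simp add: poiseuille_def)
  have R2: "0 < R2" using R1_pos R1_less_R2 by simp
  have l: "ln (R2 / R1) = - ln \<eta>" using R1_pos R2 by (simp add: \<eta>_def ln_div)
  have "(R2 / R1)\<^sup>2 = 1 / \<eta>\<^sup>2" using R1_pos R2 by (simp add: \<eta>_def power_divide)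
  then have "(R2 / R1)\<^sup>2 - 1 + (1 - \<eta>\<^sup>2) / (\<eta>\<^sup>2 * ln \<eta>) * ln (R2 / R1) = 1 / \<eta>\<^sup>2 - 1 - (1 - \<eta>\<^sup>2) / \<eta>\<^sup>2"
    unfolding l using eta by simp
  also have "\<dots> = 0" using eta by (simp add: diff_divide_distrib)
  finally show "poiseuille \<nu> R2 = 0" by (simp add: poiseuille_def)
qed

lemma poiseuille_continuous:
  "continuous_on {R1..R2} (poiseuille \<nu>)" "continuous_on {R1..R2} (poiseuille1 \<nu>)" "continuous_on {R1..R2} (poiseuille2 \<nu>)"
proof -
  have p: "0 < r" if "r \<in> {R1..R2}" for r using that R1_pos by auto
  show "continuous_on {R1..R2} (poiseuille \<nu>)" "continuous_on {R1..R2} (poiseuille1 \<nu>)"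
    by (rule DERIV_continuous_on[OF has_field_derivative_at_within], erule poiseuille_deriv[OF p])+
  show "continuous_on {R1..R2} (poiseuille2 \<nu>)"
    unfolding poiseuille2_def[abs_def] using R1_pos by (intro continuous_intros) auto
qed

text \<open>Integrating \<open>(Z \<cdot> r Z')' = r Z'\<^sup>2 + r Z / \<nu>\<close> shows that a vanishing flux would force \<open>Z' = 0\<close>.\<close>

lemma poiseuille_flux:
  assumes \<nu>: "0 < \<nu>" shows "integral {R1..R2} (\<lambda>r. r * poiseuille \<nu> r) \<noteq> 0"
proof
  assume 0: "integral {R1..R2} (\<lambda>r. r * poiseuille \<nu> r) = 0"
  have c: "continuous_on {R1..R2} (\<lambda>r. r * (poiseuille1 \<nu> r)\<^sup>2)" "continuous_on {R1..R2} (\<lambda>r. r * poiseuille \<nu> r)"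
    by (intro continuous_intros poiseuille_continuous)+
  have "((\<lambda>r. r * (poiseuille1 \<nu> r)\<^sup>2 + (1 / \<nu>) * (r * poiseuille \<nu> r)) has_integral
      poiseuille \<nu> R2 * (R2 * poiseuille1 \<nu> R2) - poiseuille \<nu> R1 * (R1 * poiseuille1 \<nu> R1)) {R1..R2}"
  proof (rule fundamental_theorem_of_calculus)
    fix r assume "r \<in> {R1..R2}"
    then have r: "0 < r" using R1_pos by auto
    have "((\<lambda>r. poiseuille \<nu> r * (r * poiseuille1 \<nu> r)) has_real_derivative
       poiseuille \<nu> r * (r * poiseuille2 \<nu> r + 1 * poiseuille1 \<nu> r) + poiseuille1 \<nu> r * (r * poiseuille1 \<nu> r)) (at r)"
      by (intro DERIV_mult' DERIV_ident poiseuille_deriv r)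
    moreover have "r * poiseuille2 \<nu> r + 1 * poiseuille1 \<nu> r = (1 / \<nu>) * r"
      using poiseuille_ode[OF r \<nu>] r \<nu> by (simp add: field_simps)
    ultimately have "((\<lambda>r. poiseuille \<nu> r * (r * poiseuille1 \<nu> r)) has_real_derivative
       r * (poiseuille1 \<nu> r)\<^sup>2 + (1 / \<nu>) * (r * poiseuille \<nu> r)) (at r)"
      by (simp add: power2_eq_square mult_ac add.commute)
    then show "((\<lambda>r. poiseuille \<nu> r * (r * poiseuille1 \<nu> r)) has_vector_derivative
       r * (poiseuille1 \<nu> r)\<^sup>2 + (1 / \<nu>) * (r * poiseuille \<nu> r)) (at r within {R1..R2})"
      by (simp add: has_field_derivative_at_within has_real_derivative_iff_has_vector_derivative[symmetric])
  qed (use R1_less_R2 in simp)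
  then have "integral {R1..R2} (\<lambda>r. r * (poiseuille1 \<nu> r)\<^sup>2 + (1 / \<nu>) * (r * poiseuille \<nu> r)) = 0"
    by (simp add: poiseuille_bc integral_unique)
  also have "integral {R1..R2} (\<lambda>r. r * (poiseuille1 \<nu> r)\<^sup>2 + (1 / \<nu>) * (r * poiseuille \<nu> r)) =
      integral {R1..R2} (\<lambda>r. r * (poiseuille1 \<nu> r)\<^sup>2) + integral {R1..R2} (\<lambda>r. (1 / \<nu>) * (r * poiseuille \<nu> r))"
    by (rule integral_add; intro integrable_continuous_real continuous_on_mult continuous_on_const c)
  also have "integral {R1..R2} (\<lambda>r. (1 / \<nu>) * (r * poiseuille \<nu> r)) = 0"
    using 0 by simp
  finally have "\<forall>r\<in>{R1..R2}. r * (poiseuille1 \<nu> r)\<^sup>2 = 0"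
    using integral_eq_0_iff[OF c(1) R1_less_R2] R1_pos by simp
  then have "poiseuille1 \<nu> R1 = 0" "poiseuille1 \<nu> R2 = 0" using R1_pos R1_less_R2 by auto
  \<comment> \<open>Multiplied by r, the derivative of the profile is a constant plus a multiple of
    r r, so it takes different values at the two walls and cannot vanish at both.\<close>
  moreover have "r * poiseuille1 \<nu> r = (2 * r\<^sup>2 + R1\<^sup>2 * ((1 - \<eta>\<^sup>2) / (\<eta>\<^sup>2 * ln \<eta>))) / (4 * \<nu>)" if "0 < r" for r
  proof -
    define k where "k = (1 - \<eta>\<^sup>2) / (\<eta>\<^sup>2 * ln \<eta>)"
    show ?thesis
      unfolding poiseuille1_def k_def[symmetric] using that R1_pos \<nu> by (simp add: field_simps power2_eq_square)
  qed
  from this[of R1] this[of R2] have "R1 * poiseuille1 \<nu> R1 - R2 * poiseuille1 \<nu> R2 = (2 * R1\<^sup>2 - 2 * R2\<^sup>2) / (4 * \<nu>)"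
    using R1_pos R1_less_R2 by (simp add: diff_divide_distrib[symmetric])
  ultimately have "R1\<^sup>2 = R2\<^sup>2" using \<nu> by simp
  then show False using R1_pos R1_less_R2 by (simp add: power2_eq_iff)
qed

text \<open>Multiplying out \<open>\<mu> = \<omega>2 / \<omega>1\<close> merges the two cases into
  formulas that are linear in the angular velocities; that linearity is what bounds the base flow by
  the data.\<close>

lemma couette_AB:
  "couette_A R1 R2 \<omega>1 \<omega>2 = (\<omega>2 - \<eta>\<^sup>2 * \<omega>1) / (1 - \<eta>\<^sup>2)"
  "couette_B R1 R2 \<omega>1 \<omega>2 = (\<omega>1 - \<omega>2) / (1 - \<eta>\<^sup>2) * R1\<^sup>2"
  using eta by (auto simp: couette_A_def couette_B_def \<eta>_def[symmetric] Let_def field_simps)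

lemma couette_bc:
  "couette_A R1 R2 \<omega>1 \<omega>2 * R1 + couette_B R1 R2 \<omega>1 \<omega>2 * (1 / R1) = R1 * \<omega>1"
  "couette_A R1 R2 \<omega>1 \<omega>2 * R2 + couette_B R1 R2 \<omega>1 \<omega>2 * (1 / R2) = R2 * \<omega>2"
proof -
  have n: "1 - \<eta>\<^sup>2 \<noteq> 0" using eta by simp
  have "couette_A R1 R2 \<omega>1 \<omega>2 * R1 + couette_B R1 R2 \<omega>1 \<omega>2 * (1 / R1) = R1 * (((\<omega>2 - \<eta>\<^sup>2 * \<omega>1) + (\<omega>1 - \<omega>2)) / (1 - \<eta>\<^sup>2))"
    unfolding couette_AB add_divide_distrib distrib_left using R1_pos by (simp add: power2_eq_square mult_ac)
  also have "(\<omega>2 - \<eta>\<^sup>2 * \<omega>1) + (\<omega>1 - \<omega>2) = \<omega>1 * (1 - \<eta>\<^sup>2)" by (simp add: algebra_simps)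
  finally show "couette_A R1 R2 \<omega>1 \<omega>2 * R1 + couette_B R1 R2 \<omega>1 \<omega>2 * (1 / R1) = R1 * \<omega>1" using n by simp
  have R2: "R2 \<noteq> 0" using R1_pos R1_less_R2 by simp
  have e: "R1\<^sup>2 = \<eta>\<^sup>2 * R2\<^sup>2" using R2 by (simp add: \<eta>_def power_divide)
  have b: "(\<omega>1 - \<omega>2) / (1 - \<eta>\<^sup>2) * R1\<^sup>2 * (1 / R2) = R2 * ((\<omega>1 - \<omega>2) * \<eta>\<^sup>2 / (1 - \<eta>\<^sup>2))"
    unfolding e using R2 by (simp add: power2_eq_square)
  have "couette_A R1 R2 \<omega>1 \<omega>2 * R2 + couette_B R1 R2 \<omega>1 \<omega>2 * (1 / R2) = R2 * (((\<omega>2 - \<eta>\<^sup>2 * \<omega>1) + (\<omega>1 - \<omega>2) * \<eta>\<^sup>2) / (1 - \<eta>\<^sup>2))"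
    unfolding couette_AB add_divide_distrib distrib_left b by simp
  also have "(\<omega>2 - \<eta>\<^sup>2 * \<omega>1) + (\<omega>1 - \<omega>2) * \<eta>\<^sup>2 = \<omega>2 * (1 - \<eta>\<^sup>2)" by (simp add: algebra_simps)
  finally show "couette_A R1 R2 \<omega>1 \<omega>2 * R2 + couette_B R1 R2 \<omega>1 \<omega>2 * (1 / R2) = R2 * \<omega>2" using n by simp
qed

text \<open>The radial part integrates the centrifugal balance, in which the radial pressure
  derivative equals the square of A r + B / r divided by r; the axial part drives the Poiseuille
  component.\<close>

definition base_pressure :: "real \<Rightarrow> real \<Rightarrow> real \<Rightarrow> cyl \<Rightarrow> real" where
  "base_pressure a A B x = a * snd (snd x) + (A\<^sup>2 / 2 * (fst x)\<^sup>2 + 2 * A * B * ln (fst x) - B\<^sup>2 / 2 * (1 / (fst x)\<^sup>2))"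

definition base_V :: "real \<Rightarrow> real \<Rightarrow> real \<Rightarrow> real \<Rightarrow> nat \<Rightarrow> cyl \<Rightarrow> real" where
  "base_V \<nu> A B a = comp3 (\<lambda>x. 0) (\<lambda>x. A * fst x + B * (1 / fst x)) (\<lambda>x. a * poiseuille \<nu> (fst x))"

definition base_Vr :: "real \<Rightarrow> real \<Rightarrow> real \<Rightarrow> real \<Rightarrow> nat \<Rightarrow> cyl \<Rightarrow> real" where
  "base_Vr \<nu> A B a = comp3 (\<lambda>x. 0) (\<lambda>x. A - B * (1 / (fst x)\<^sup>2)) (\<lambda>x. a * poiseuille1 \<nu> (fst x))"

definition base_Vrr :: "real \<Rightarrow> real \<Rightarrow> real \<Rightarrow> real \<Rightarrow> nat \<Rightarrow> cyl \<Rightarrow> real" where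
  "base_Vrr \<nu> A B a = comp3 (\<lambda>x. 0) (\<lambda>x. 2 * B * (1 / (fst x) ^ 3)) (\<lambda>x. a * poiseuille2 \<nu> (fst x))"

definition base_pressure_r :: "real \<Rightarrow> real \<Rightarrow> cyl \<Rightarrow> real" where
  "base_pressure_r A B x = A\<^sup>2 * fst x + 2 * A * B * (1 / fst x) + B\<^sup>2 * (1 / (fst x) ^ 3)"

text \<open>The two flows can be superposed although the equations are nonlinear: without radial
  velocity and without dependence on \<theta> and z, the only nonlinear term left is the centrifugal
  one, which the pressure balances.\<close>

lemma base_jets:
  assumes \<nu>: "0 < \<nu>"
  shows "jets \<nu> (base_V \<nu> A B a) (base_Vr \<nu> A B a) (\<lambda>i x. 0) (\<lambda>i x. 0) (base_Vrr \<nu> A B a) (\<lambda>i x. 0) (\<lambda>i x. 0)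
    (base_pressure a A B) (base_pressure_r A B) (\<lambda>x. 0) (\<lambda>x. a)"
proof -
  have p: "0 < r" if "r \<in> {R1..R2}" for r using that R1_pos by auto
  have d1: "((\<lambda>r. A * r + B * (1 / r)) has_real_derivative A - B * (1 / r\<^sup>2)) (at r)" if "0 < r" for r
    using that by (auto intro!: derivative_eq_intros simp: power2_eq_square)
  have d2: "((\<lambda>r. A - B * (1 / r\<^sup>2)) has_real_derivative 2 * B * (1 / r ^ 3)) (at r)" if "0 < r" for r
    using that by (auto intro!: derivative_eq_intros simp: power2_eq_square power3_eq_cube mult_ac)
  have d3: "((\<lambda>r. A\<^sup>2 / 2 * r\<^sup>2 + 2 * A * B * ln r - B\<^sup>2 / 2 * (1 / r\<^sup>2)) has_real_derivative
      A\<^sup>2 * r + 2 * A * B * (1 / r) + B\<^sup>2 * (1 / r ^ 3)) (at r)" if "0 < r" for r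
    using that by (auto intro!: derivative_eq_intros simp: power2_eq_square power3_eq_cube)
  have cD: "continuous_on {R1..R2} f" if "\<And>r. 0 < r \<Longrightarrow> (f has_real_derivative f' r) (at r)" for f f'
    by (rule DERIV_continuous_on[OF has_field_derivative_at_within]) (erule that[OF p])
  have c3: "continuous_on {R1..R2} (\<lambda>r. 2 * B * (1 / r ^ 3))"
    "continuous_on {R1..R2} (\<lambda>r. A\<^sup>2 * r + 2 * A * B * (1 / r) + B\<^sup>2 * (1 / r ^ 3))"
    using R1_pos by (intro continuous_intros; force)+
  have R: "0 < r" if "R1 < r" for r using that R1_pos by simp
  have z1: "C1 (\<lambda>x. A * fst x + B * (1 / fst x)) (\<lambda>x. A - B * (1 / (fst x)\<^sup>2)) (\<lambda>x. 0) (\<lambda>x. 0)"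
    by (rule C1_radial[OF cD[OF d1] cD[OF d2] d1[OF R]])
  have z2: "C1 (\<lambda>x. A - B * (1 / (fst x)\<^sup>2)) (\<lambda>x. 2 * B * (1 / (fst x) ^ 3)) (\<lambda>x. 0) (\<lambda>x. 0)"
    by (rule C1_radial[OF cD[OF d2] c3(1) d2[OF R]])
  note pc = continuous_on_mult[OF continuous_on_const[of _ a] poiseuille_continuous(1)[of \<nu>]]
    continuous_on_mult[OF continuous_on_const[of _ a] poiseuille_continuous(2)[of \<nu>]]
    continuous_on_mult[OF continuous_on_const[of _ a] poiseuille_continuous(3)[of \<nu>]]
  have q1: "C1 (\<lambda>x. a * poiseuille \<nu> (fst x)) (\<lambda>x. a * poiseuille1 \<nu> (fst x)) (\<lambda>x. 0) (\<lambda>x. 0)"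
    by (rule C1_radial[OF pc(1,2) DERIV_cmult[OF poiseuille_deriv(1)[OF R]]])
  have q2: "C1 (\<lambda>x. a * poiseuille1 \<nu> (fst x)) (\<lambda>x. a * poiseuille2 \<nu> (fst x)) (\<lambda>x. 0) (\<lambda>x. 0)"
    by (rule C1_radial[OF pc(2,3) DERIV_cmult[OF poiseuille_deriv(2)[OF R]]])
  have V: "C1 (base_V \<nu> A B a i) (base_Vr \<nu> A B a i) (\<lambda>x. 0) (\<lambda>x. 0)"
    and Vr: "C1 (base_Vr \<nu> A B a i) (base_Vrr \<nu> A B a i) (\<lambda>x. 0) (\<lambda>x. 0)"
    and pV: "per (base_V \<nu> A B a i)" if "i < 3" for i
  proof -
    show "C1 (base_V \<nu> A B a i) (base_Vr \<nu> A B a i) (\<lambda>x. 0) (\<lambda>x. 0)"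
      unfolding base_V_def base_Vr_def
      by (rule lt3_cases[OF that]; unfold comp3_simps) (rule C1_const z1 q1)+
    show "C1 (base_Vr \<nu> A B a i) (base_Vrr \<nu> A B a i) (\<lambda>x. 0) (\<lambda>x. 0)"
      unfolding base_Vr_def base_Vrr_def
      by (rule lt3_cases[OF that]; unfold comp3_simps) (rule C1_const z2 q2)+
    show "per (base_V \<nu> A B a i)"
      by (rule lt3_cases[OF that]) (simp_all add: base_V_def per_def theta_periodic_def)
  qed
  have z: "has_dt (\<lambda>x. 0) (\<lambda>x. 0)" "has_dz (\<lambda>x. 0) (\<lambda>x. 0)" by (simp_all add: has_dt_def has_dz_def)
  have az: "C1 (\<lambda>x. a * snd (snd x)) (\<lambda>x. 0) (\<lambda>x. 0) (\<lambda>x. a)"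
    by (rule C1_axial[of "\<lambda>z. a" "\<lambda>z. a * z"]) (auto intro!: derivative_eq_intros)
  have P: "C1 (base_pressure a A B) (base_pressure_r A B) (\<lambda>x. 0) (\<lambda>x. a)"
    using C1_add[OF az C1_radial[OF cD[OF d3] c3(2) d3[OF R]]]
    by (simp add: base_pressure_def[abs_def] base_pressure_r_def[abs_def])
  have pP: "per (base_pressure a A B)" by (simp add: per_def theta_periodic_def base_pressure_def)
  have x0: "0 < fst x" if "x \<in> S" for x using that R1_pos by (auto simp: closed_slab_def)
  have e1: "- (A * s + B * (1 / s))\<^sup>2 / s + (A\<^sup>2 * s + 2 * A * B * (1 / s) + B\<^sup>2 * (1 / s ^ 3)) = 0" if "0 < s" for s
    using that by (simp add: field_simps power2_eq_square power3_eq_cube)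
  have e2: "2 * B * (1 / s ^ 3) + 1 / s * (A - B * (1 / s\<^sup>2)) - 1 / s\<^sup>2 * (A * s + B * (1 / s)) = 0" if "0 < s" for s
    using that by (simp add: field_simps power2_eq_square power3_eq_cube)
  have e3: "\<nu> * (a * poiseuille2 \<nu> s + 1 / s * (a * poiseuille1 \<nu> s)) = a" if "0 < s" for s
  proof -
    have "\<nu> * (a * poiseuille2 \<nu> s + 1 / s * (a * poiseuille1 \<nu> s)) =
       a * (\<nu> * (poiseuille2 \<nu> s + 1 / s * poiseuille1 \<nu> s))"
      by (simp add: algebra_simps)
    then show ?thesis unfolding poiseuille_ode[OF that \<nu>] by simp
  qed
  show ?thesis
    unfolding jets_def
  proof (intro conjI allI impI ballI)
    show "solenoidal (base_V \<nu> A B a) (base_Vr \<nu> A B a) (\<lambda>i x. 0) (\<lambda>i x. 0)"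
      by (simp add: solenoidal_def base_V_def base_Vr_def)
    fix x :: cyl assume x: "x \<in> S"
    let ?V = "base_V \<nu> A B a" and ?Vr = "base_Vr \<nu> A B a" and ?Vrr = "base_Vrr \<nu> A B a"
    show "?V 0 x * ?Vr 0 x + ?V 1 x / fst x * 0 + ?V 2 x * 0 - (?V 1 x)\<^sup>2 / fst x + base_pressure_r A B x =
      \<nu> * (?Vrr 0 x + 1 / fst x * ?Vr 0 x + 1 / (fst x)\<^sup>2 * 0 + 0 - 1 / (fst x)\<^sup>2 * ?V 0 x) - \<nu> * (2 / (fst x)\<^sup>2) * 0"
      using e1[OF x0[OF x]] by (simp add: base_V_def base_Vr_def base_Vrr_def base_pressure_r_def)
    show "?V 0 x * ?Vr 1 x + ?V 1 x / fst x * 0 + ?V 2 x * 0 + ?V 0 x * ?V 1 x / fst x + 1 / fst x * 0 =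
      \<nu> * (?Vrr 1 x + 1 / fst x * ?Vr 1 x + 1 / (fst x)\<^sup>2 * 0 + 0 - 1 / (fst x)\<^sup>2 * ?V 1 x) + \<nu> * (2 / (fst x)\<^sup>2) * 0"
      using e2[OF x0[OF x]] by (simp add: base_V_def base_Vr_def base_Vrr_def)
    show "?V 0 x * ?Vr 2 x + ?V 1 x / fst x * 0 + ?V 2 x * 0 + a =
      \<nu> * (?Vrr 2 x + 1 / fst x * ?Vr 2 x + 1 / (fst x)\<^sup>2 * 0 + 0)"
      using e3[OF x0[OF x]] by (simp add: base_V_def base_Vr_def base_Vrr_def)
  qed (use V C1_D[OF Vr] pV z P pP in \<open>auto\<close>)
qed


section \<open>Rigidity\<close>

lemma rad_int_abs_le:
  assumes f: "cont f" and b: "\<And>x. x \<in> S \<Longrightarrow> \<bar>f x\<bar> \<le> c"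
  shows "\<bar>rad_int f x\<bar> \<le> (R2 - R1) * c"
proof -
  have k: "rad_int (\<lambda>x. k) x = (R2 - R1) * k" for k
    using R1_less_R2 by (cases x) (simp add: rad_int_def)
  have "rad_int f x \<le> rad_int (\<lambda>x. c) x" "rad_int (\<lambda>x. - c) x \<le> rad_int f x"
    by (rule rad_int_mono; use f b in \<open>force simp: abs_le_iff\<close>)+
  then show ?thesis unfolding k by (simp add: abs_le_iff)
qed

lemma ang_int_abs_le:
  assumes f: "cont f" and b: "\<And>x. x \<in> S \<Longrightarrow> \<bar>f x\<bar> \<le> c" and x: "x \<in> S"
  shows "\<bar>ang_int f x\<bar> \<le> 2 * pi * c"
proof -
  have k: "ang_int (\<lambda>x. k) x = 2 * pi * k" for k by (cases x) (simp add: ang_int_def)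
  have "ang_int f x \<le> ang_int (\<lambda>x. c) x" "ang_int (\<lambda>x. - c) x \<le> ang_int f x"
    by (rule ang_int_mono[OF _ _ _ x]; use f b in \<open>force simp: abs_le_iff\<close>)+
  then show ?thesis unfolding k by (simp add: abs_le_iff)
qed

text \<open>For an isotropic tensor the off-diagonal derivatives vanish and the frame terms
  \<open>M 0\<close> and \<open>M 4\<close> cancel, so the equations say that the gradient of
  \<open>q\<close> is zero. The derivatives of the diagonal entries 0, 4 and 8 are radial, angular
  and axial, which gives one direction each.\<close>

lemma pressure_constant:
  assumes df: "divfree M DM"
    and M: "\<And>k x. k < 9 \<Longrightarrow> x \<in> S \<Longrightarrow> M k x = (if k \<in> {0, 4, 8} then q x else 0)"
  obtains b where "\<And>r \<theta> z. R1 < r \<Longrightarrow> r < R2 \<Longrightarrow> q (r, \<theta>, z) = b"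
proof -
  have d: "DM 0 (r, \<theta>, z) = 0" "DM 4 (r, \<theta>, z) = 0" "DM 8 (r, \<theta>, z) = 0"
    if r: "R1 < r" "r < R2" for r \<theta> z
  proof -
    have x: "(r, t, s) \<in> S" for t s using r by (simp add: S_iff)
    have dr: "DM k (r, \<theta>, z) = 0" if k: "k \<in> {1, 2}" for k
    proof -
      have h: "has_dr (M k) (DM k)" using df k unfolding divfree_def by auto
      have "((\<lambda>s. 0) has_real_derivative DM k (r, \<theta>, z)) (at r)"
        by (rule has_field_derivative_transform_within_open[OF has_drD[OF h r], of "{R1<..<R2}"])
          (use r k M[of k] in \<open>auto simp: S_iff\<close>)
      then show ?thesis using DERIV_unique DERIV_const by blast
    qed
    have dt: "DM k (r, \<theta>, z) = 0" if k: "k \<in> {3, 5}" for k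
    proof -
      have h: "has_dt (M k) (DM k)" using df k unfolding divfree_def by blast
      have "(\<lambda>s. M k (r, s, z)) = (\<lambda>s. 0)" using k M[of k] x by auto
      then show ?thesis using has_dtD[OF h, of r z \<theta>] r DERIV_unique[OF _ DERIV_const] by fastforce
    qed
    have dz: "DM k (r, \<theta>, z) = 0" if k: "k \<in> {6, 7}" for k
    proof -
      have h: "has_dz (M k) (DM k)" using df k unfolding divfree_def by blast
      have "(\<lambda>s. M k (r, \<theta>, s)) = (\<lambda>s. 0)" using k M[of k] x by auto
      then show ?thesis using has_dzD[OF h, of r \<theta> z] r DERIV_unique[OF _ DERIV_const] by fastforce
    qed
    let ?x = "(r, \<theta>, z)"
    have "R1 \<le> r \<and> r \<le> R2" using r by simp
    then have e: "r * DM 0 ?x + M 0 ?x + DM 3 ?x - M 4 ?x + r * DM 6 ?x = 0"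
        "r * DM 1 ?x + M 1 ?x + DM 4 ?x + M 3 ?x + r * DM 7 ?x = 0"
        "r * DM 2 ?x + M 2 ?x + DM 5 ?x + r * DM 8 ?x = 0"
      using df unfolding divfree_def Let_def by blast+
    have r0: "r \<noteq> 0" using r R1_pos by simp
    show "DM 0 ?x = 0" using e(1) dt[of 3] dz[of 6] M[of 0 ?x] M[of 4 ?x] x r0 by simp
    show "DM 4 ?x = 0" using e(2) dr[of 1] dz[of 7] M[of 1 ?x] M[of 3 ?x] x by simp
    show "DM 8 ?x = 0" using e(3) dr[of 2] dt[of 5] M[of 2 ?x] x r0 by simp
  qed
  define m where "m = (R1 + R2) / 2"
  have m: "R1 < m" "m < R2" using R1_less_R2 by (auto simp: m_def)
  have h: "has_dr (M 0) (DM 0)" "has_dt (M 4) (DM 4)" "has_dz (M 8) (DM 8)"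
    using df unfolding divfree_def by auto
  have "q (r, \<theta>, z) = q (m, 0, 0)" if r: "R1 < r" "r < R2" for r \<theta> z
  proof -
    have x: "(r, t, s) \<in> S" "(m, t, s) \<in> S" for t s using r m by (auto simp: S_iff)
    have "M 4 (r, \<theta>, z) = M 4 (r, 0, z)"
      using DERIV_isconst_all[of "\<lambda>s. M 4 (r, s, z)"] has_dtD[OF h(2), of r z] d(2)[OF r] r by simp
    moreover have "M 8 (r, 0, z) = M 8 (r, 0, 0)"
      using DERIV_isconst_all[of "\<lambda>s. M 8 (r, 0, s)"] has_dzD[OF h(3), of r 0] d(3)[OF r] r by simp
    moreover have "(\<lambda>s. M 0 (s, 0, 0)) r = (\<lambda>s. M 0 (s, 0, 0)) m"
    proof (rule DERIV_isconst3[of R1 R2 r m "\<lambda>s. M 0 (s, 0, 0)"])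
      show "((\<lambda>s. M 0 (s, 0, 0)) has_real_derivative 0) (at y)" if "y \<in> {R1<..<R2}" for y
        using has_drD[OF h(1), of y 0 0] d(1)[of y 0 0] that by simp
    qed (use r m R1_less_R2 in auto)
    ultimately show ?thesis using M[of 0] M[of 4] M[of 8] x by simp
  qed
  then show ?thesis by (rule that)
qed

lemma grad_diff:
  "grad (\<lambda>i x. w i x - w' i x) (\<lambda>i x. wr i x - wr' i x) (\<lambda>i x. wt i x - wt' i x) (\<lambda>i x. wz i x - wz' i x) k x =
    grad w wr wt wz k x - grad w' wr' wt' wz' k x"
  unfolding grad_def by (simp add: diff_divide_distrib add_divide_distrib)

lemma grad_zero:
  assumes u: "vfield u ur ut uz" and 0: "\<And>i x. i < 3 \<Longrightarrow> x \<in> S \<Longrightarrow> u i x = 0" and x: "x \<in> S" and k: "k < 9"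
  shows "grad u ur ut uz k x = 0"
proof -
  have c: "C1 (u i) (ur i) (ut i) (uz i)" if "i < 3" for i using u that by (auto simp: vfield_def)
  have r0: "ur i x = 0" if i: "i < 3" for i
  proof (rule cont_zero_closure[OF C1_D(2)[OF c[OF i]] _ x])
    fix r \<theta> z assume r: "R1 < r" "r < R2"
    have "((\<lambda>s. 0) has_real_derivative ur i (r, \<theta>, z)) (at r)"
      by (rule has_field_derivative_transform_within_open[OF has_drD[OF C1_D(5)[OF c[OF i]] r], of "{R1<..<R2}"])
        (use r i 0 in \<open>auto simp: S_iff\<close>)
    then show "ur i (r, \<theta>, z) = 0" using DERIV_unique DERIV_const by blast
  qed
  obtain r \<theta> z where xx: "x = (r, \<theta>, z)" by (cases x)
  have r: "R1 \<le> r" "r \<le> R2" using x by (auto simp: xx S_iff)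
  have t0: "ut i x = 0" if i: "i < 3" for i
  proof -
    have "(\<lambda>s. u i (r, s, z)) = (\<lambda>s. 0)" using 0[OF i] r by (auto simp: S_iff)
    then show ?thesis
      using has_dtD[OF C1_D(6)[OF c[OF i]] r, of z \<theta>] DERIV_unique[OF _ DERIV_const] xx by fastforce
  qed
  have z0: "uz i x = 0" if i: "i < 3" for i
  proof -
    have "(\<lambda>s. u i (r, \<theta>, s)) = (\<lambda>s. 0)" using 0[OF i] r by (auto simp: S_iff)
    then show ?thesis
      using has_dzD[OF C1_D(7)[OF c[OF i]] r, of \<theta> z] DERIV_unique[OF _ DERIV_const] xx by fastforce
  qed
  show ?thesis using r0 t0 z0 0 x k by (simp add: grad_def)
qed

text \<open>A difference of products is V i u j + u i U j. Among the nine entries each index occurs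
  three times as row and three times as column, which turns the factor 2 into 12.\<close>

lemma velocity_difference_sq:
  fixes V U u :: "nat \<Rightarrow> real"
  assumes "\<And>i. i < 3 \<Longrightarrow> \<bar>V i\<bar> \<le> c" "\<And>i. i < 3 \<Longrightarrow> \<bar>U i\<bar> \<le> c" "\<And>i. i < 3 \<Longrightarrow> u i = V i - U i"
  shows "(\<Sum>k<9. (V (k div 3) * V (k mod 3) - U (k div 3) * U (k mod 3))\<^sup>2) \<le> 12 * c\<^sup>2 * (\<Sum>i<3. (u i)\<^sup>2)"
proof -
  have f: "(V i * V j - U i * U j)\<^sup>2 \<le> 2 * c\<^sup>2 * ((u i)\<^sup>2 + (u j)\<^sup>2)" if "i < 3" "j < 3" for i j
  proof -
    have "V i * V j - U i * U j = V i * u j + u i * U j"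
      by (simp add: assms(3)[OF that(1)] assms(3)[OF that(2)] algebra_simps)
    then have "(V i * V j - U i * U j)\<^sup>2 \<le> 2 * (V i * u j)\<^sup>2 + 2 * (u i * U j)\<^sup>2"
      using zero_le_power2[of "V i * u j - u i * U j"] by (simp add: power2_eq_square algebra_simps)
    moreover have "(V i)\<^sup>2 \<le> c\<^sup>2" "(U j)\<^sup>2 \<le> c\<^sup>2"
      using power_mono[OF assms(1)[OF that(1)] abs_ge_zero, of 2] power_mono[OF assms(2)[OF that(2)] abs_ge_zero, of 2] by simp_all
    then have "(V i * u j)\<^sup>2 \<le> c\<^sup>2 * (u j)\<^sup>2" "(u i * U j)\<^sup>2 \<le> c\<^sup>2 * (u i)\<^sup>2"
      by (simp_all add: power_mult_distrib mult_right_mono mult.commute)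
    ultimately show ?thesis by (simp add: distrib_left)
  qed
  have "(\<Sum>k<9. (V (k div 3) * V (k mod 3) - U (k div 3) * U (k mod 3))\<^sup>2) \<le>
      (\<Sum>k<9. 2 * c\<^sup>2 * ((u (k div 3))\<^sup>2 + (u (k mod 3))\<^sup>2))"
    by (rule sum_mono, rule f) auto
  also have "\<dots> = 12 * c\<^sup>2 * (\<Sum>i<3. (u i)\<^sup>2)"
    unfolding sum_lt_9 sum_lt_3 by (simp add: algebra_simps numeral_2_eq_2)
  finally show ?thesis .
qed

text \<open>The base flow is as small as the data up to the factor \<open>K\<close>. Hence the
  quadratic tensor difference is at most 12 times the square of \<open>K * C\<close> times
  \<bar>u\<bar> squared, which is the form that \<open>vanishing\<close> requires.\<close>

lemma rigidity:
  assumes \<nu>: "0 < \<nu>"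
  obtains C where "0 < C"
    "\<And>\<omega>1 \<omega>2 vr vt vz p. smooth_solution \<nu> R1 R2 \<omega>1 \<omega>2 vr vt vz p \<Longrightarrow> small_data C R1 R2 \<omega>1 \<omega>2 vr vt vz \<Longrightarrow>
      \<exists>a b. generalized_taylor_couette \<nu> R1 R2 \<omega>1 \<omega>2 vr vt vz p a b"
proof -
  obtain \<delta> where \<delta>: "0 < \<delta>" and van:
    "\<And>u ur ut uz F q DM M i x. vfield u ur ut uz \<Longrightarrow> solenoidal u ur ut uz \<Longrightarrow>
      (\<And>x. x \<in> S \<Longrightarrow> ang_int (rad_int (\<lambda>x. fst x * u 2 x)) x = 0) \<Longrightarrow>
      (\<And>i x. i < 3 \<Longrightarrow> x \<in> S \<Longrightarrow> \<bar>u i x\<bar> \<le> M) \<Longrightarrow>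
      (\<And>k. k < 9 \<Longrightarrow> cont (F k) \<and> per (F k)) \<Longrightarrow> cont q \<Longrightarrow>
      (\<And>x. x \<in> S \<Longrightarrow> (\<Sum>k<9. (F k x)\<^sup>2) \<le> \<delta> * (\<Sum>i<3. (u i x)\<^sup>2)) \<Longrightarrow>
      divfree (\<lambda>k x. F k x + (if k \<in> {0, 4, 8} then q x else 0) - \<nu> * grad u ur ut uz k x) DM \<Longrightarrow>
      i < 3 \<Longrightarrow> x \<in> S \<Longrightarrow> u i x = 0"
    using vanishing[OF \<nu>] by blast
  define L where "L = R2 - R1"
  have L: "0 < L" and R2: "0 < R2" using R1_less_R2 R1_pos by (auto simp: L_def)
  define I where "I = integral {R1..R2} (\<lambda>r. r * poiseuille \<nu> r)"
  have I: "I \<noteq> 0" unfolding I_def by (rule poiseuille_flux[OF \<nu>])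
  obtain Z where Z: "\<And>r. R1 \<le> r \<Longrightarrow> r \<le> R2 \<Longrightarrow> \<bar>poiseuille \<nu> r\<bar> \<le> Z"
  proof -
    have "bounded (poiseuille \<nu> ` {R1..R2})"
      by (intro compact_imp_bounded compact_continuous_image poiseuille_continuous) simp
    then obtain c where "\<forall>r\<in>{R1..R2}. \<bar>poiseuille \<nu> r\<bar> \<le> c" by (auto simp: bounded_iff)
    then show ?thesis using that[of c] by auto
  qed
  have Z0: "0 \<le> Z" using Z[of R1] R1_less_R2 by (simp add: order_trans[OF abs_ge_zero])
  \<comment> \<open>\<open>KA * C\<close> bounds A, by linearity in the angular velocities, which
    are at most C / R1 and C / R2. \<open>K\<close> adds up 1 for the flow \<open>v\<close> itself,
    the Couette part and the Poiseuille part.\<close>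
  define KA where "KA = (1 / R1 + 1 / R2) / (1 - \<eta>\<^sup>2)"
  have KA: "0 \<le> KA" using R1_pos R2 eta by (simp add: KA_def)
  define K where "K = 1 + (KA * R2 + KA * R1\<^sup>2 * (1 / R1)) + L * R2 / \<bar>I\<bar> * Z"
  have t: "0 \<le> KA * R2 + KA * R1\<^sup>2 * (1 / R1)" "0 \<le> L * R2 / \<bar>I\<bar> * Z" using KA R1_pos R2 L Z0 by auto
  have K: "0 < K" "1 \<le> K" "KA * R2 + KA * R1\<^sup>2 * (1 / R1) \<le> K" "L * R2 / \<bar>I\<bar> * Z \<le> K" "0 \<le> K"
    using t unfolding K_def by linarith+
  \<comment> \<open>Solves 12 (K C) (K C) = \<delta>.\<close>
  define C where "C = sqrt (\<delta> / 12) / K"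
  have C: "0 < C" using \<delta> K by (simp add: C_def)
  have CK: "12 * (K * C)\<^sup>2 = \<delta>" using K \<delta> by (simp add: C_def)
  show ?thesis
  proof (rule that[OF C])
    fix \<omega>1 \<omega>2 vr vt vz p
    assume sol: "smooth_solution \<nu> R1 R2 \<omega>1 \<omega>2 vr vt vz p" and sd: "small_data C R1 R2 \<omega>1 \<omega>2 vr vt vz"
    obtain Vr Vt Vz Vrr Vtt Vzz pr pt pz where jV: "jets \<nu> (comp3 vr vt vz) Vr Vt Vz Vrr Vtt Vzz p pr pt pz"
      by (rule solution_jets[OF sol])
    define V where "V = comp3 vr vt vz"
    have V: "C1 (V i) (Vr i) (Vt i) (Vz i)" "per (V i)" if "i < 3" for i
      using jV that unfolding jets_def V_def by blast+
    have Vc: "cont (V i)" if "i < 3" for i by (rule C1_D(1)[OF V(1)[OF that]])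
    have Vb: "\<bar>V i x\<bar> \<le> C" if i: "i < 3" and x: "x \<in> S" for i x
    proof (rule small_data_bound[OF sd Vc[OF i] V(2)[OF i] _ x])
      show "(V i y)\<^sup>2 \<le> (vr y)\<^sup>2 + (vt y)\<^sup>2 + (vz y)\<^sup>2" for y
        by (rule lt3_cases[OF i]) (simp_all add: V_def)
    qed
    define A where "A = couette_A R1 R2 \<omega>1 \<omega>2"
    define B where "B = couette_B R1 R2 \<omega>1 \<omega>2"
    have \<omega>: "\<bar>\<omega>1\<bar> \<le> C * (1 / R1)" "\<bar>\<omega>2\<bar> \<le> C * (1 / R2)"
      using sd R1_pos R2 by (auto simp: small_data_def pos_le_divide_eq mult.commute)
    have e2: "0 < 1 - \<eta>\<^sup>2" "\<eta>\<^sup>2 \<le> 1" "0 \<le> \<eta>\<^sup>2" using eta by auto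
    have dC: "(1 / R1 + 1 / R2) * C = C * (1 / R1) + C * (1 / R2)" by (simp add: algebra_simps)
    have Ab: "\<bar>A\<bar> \<le> KA * C"
    proof -
      have "\<bar>\<eta>\<^sup>2 * \<omega>1\<bar> \<le> 1 * \<bar>\<omega>1\<bar>" by (rule abs_mult_le) (use e2 in auto)
      then have "\<bar>\<omega>2 - \<eta>\<^sup>2 * \<omega>1\<bar> \<le> (1 / R1 + 1 / R2) * C" using \<omega> unfolding dC by linarith
      then have "\<bar>\<omega>2 - \<eta>\<^sup>2 * \<omega>1\<bar> / (1 - \<eta>\<^sup>2) \<le> (1 / R1 + 1 / R2) * C / (1 - \<eta>\<^sup>2)"
        using e2 by (intro divide_right_mono) auto
      then show ?thesis using e2 by (simp add: A_def couette_AB KA_def)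
    qed
    have Bb: "\<bar>B\<bar> \<le> KA * R1\<^sup>2 * C"
    proof -
      have "\<bar>\<omega>1 - \<omega>2\<bar> \<le> (1 / R1 + 1 / R2) * C" using \<omega> unfolding dC by linarith
      then have "\<bar>\<omega>1 - \<omega>2\<bar> / (1 - \<eta>\<^sup>2) * R1\<^sup>2 \<le> (1 / R1 + 1 / R2) * C / (1 - \<eta>\<^sup>2) * R1\<^sup>2"
        using e2 by (intro divide_right_mono mult_right_mono) auto
      then show ?thesis using e2 by (simp add: B_def couette_AB KA_def abs_mult mult_ac)
    qed
    define \<Phi> where "\<Phi> = ang_int (rad_int (\<lambda>x. fst x * vz x)) (R1, 0, 0)"
    \<comment> \<open>The pressure gradient is fitted to the flux of \<open>v\<close> through z = 0:
      the axial part of the base flow has flux 2\<pi> a I.\<close>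
    define a where "a = \<Phi> / (2 * pi * I)"
    have cz: "cont (\<lambda>x. fst x * vz x)" using Vc[of 2] by (auto simp: V_def)
    have \<Phi>b: "\<bar>\<Phi>\<bar> \<le> 2 * pi * (L * (R2 * C))"
      unfolding \<Phi>_def L_def
    proof (rule ang_int_abs_le[OF cont_rad_int[OF cz] rad_int_abs_le[OF cz]])
      show "\<bar>fst x * vz x\<bar> \<le> R2 * C" if "x \<in> S" for x
        by (rule abs_mult_le) (use that R1_pos Vb[of 2 x] in \<open>auto simp: V_def closed_slab_def\<close>)
      show "(R1, 0, 0) \<in> S" using R1_less_R2 by (simp add: S_iff)
    qed
    have ab: "\<bar>a\<bar> \<le> L * R2 / \<bar>I\<bar> * C"
    proof -
      have "\<bar>a\<bar> = \<bar>\<Phi>\<bar> / (2 * pi * \<bar>I\<bar>)" by (simp add: a_def abs_mult)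
      also have "\<dots> \<le> 2 * pi * (L * (R2 * C)) / (2 * pi * \<bar>I\<bar>)" by (rule divide_right_mono[OF \<Phi>b]) simp
      finally show ?thesis by simp
    qed
    define U where "U = base_V \<nu> A B a"
    define Ur where "Ur = base_Vr \<nu> A B a"
    define P where "P = base_pressure a A B"
    have jU: "jets \<nu> U Ur (\<lambda>i x. 0) (\<lambda>i x. 0) (base_Vrr \<nu> A B a) (\<lambda>i x. 0) (\<lambda>i x. 0) P (base_pressure_r A B) (\<lambda>x. 0) (\<lambda>x. a)"
      unfolding U_def Ur_def P_def by (rule base_jets[OF \<nu>])
    have U: "C1 (U i) (Ur i) (\<lambda>x. 0) (\<lambda>x. 0)" "per (U i)" if "i < 3" for i
      using jU that unfolding jets_def by blast+
    have Uc: "cont (U i)" if "i < 3" for i by (rule C1_D(1)[OF U(1)[OF that]])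
    have Ub: "\<bar>U i x\<bar> \<le> K * C" if i: "i < 3" and x: "x \<in> S" for i x
    proof -
      have r: "R1 \<le> fst x" "fst x \<le> R2" using x by (auto simp: closed_slab_def)
      show ?thesis
      proof (rule lt3_cases[OF i])
        show "\<bar>U 0 x\<bar> \<le> K * C" using K C by (simp add: U_def base_V_def)
        have "\<bar>A * fst x + B * (1 / fst x)\<bar> \<le> KA * C * R2 + KA * R1\<^sup>2 * C * (1 / R1)"
          using r R1_pos by (intro abs_add_le abs_mult_le Ab Bb) (auto simp: frac_le)
        also have "\<dots> = (KA * R2 + KA * R1\<^sup>2 * (1 / R1)) * C" by (simp add: algebra_simps)
        also have "\<dots> \<le> K * C" using K C by (intro mult_right_mono) auto
        finally show "\<bar>U 1 x\<bar> \<le> K * C" by (simp add: U_def base_V_def)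
        have "\<bar>a * poiseuille \<nu> (fst x)\<bar> \<le> (L * R2 / \<bar>I\<bar> * C) * Z" by (intro abs_mult_le ab Z r)
        also have "\<dots> = (L * R2 / \<bar>I\<bar> * Z) * C" by simp
        also have "\<dots> \<le> K * C" using K C by (intro mult_right_mono) auto
        finally show "\<bar>U 2 x\<bar> \<le> K * C" by (simp add: U_def base_V_def)
      qed
    qed
    have VKb: "\<bar>V i x\<bar> \<le> K * C" if "i < 3" "x \<in> S" for i x
      using Vb[OF that] mult_right_mono[OF K(2), of C] C by linarith
    define u where "u = (\<lambda>i x. V i x - U i x)"
    define ur where "ur = (\<lambda>i x. Vr i x - Ur i x)"
    define ut where "ut = (\<lambda>i x. Vt i x - (0::real))"
    define uz where "uz = (\<lambda>i x. Vz i x - (0::real))"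
    have bcs: "vr (R1, \<theta>, z) = 0 \<and> vr (R2, \<theta>, z) = 0 \<and> vz (R1, \<theta>, z) = 0 \<and> vz (R2, \<theta>, z) = 0 \<and>
        vt (R1, \<theta>, z) = R1 * \<omega>1 \<and> vt (R2, \<theta>, z) = R2 * \<omega>2" for \<theta> z
      using sol by (simp add: smooth_solution_def rotating_bc_def)
    have u: "vfield u ur ut uz"
      unfolding vfield_def
    proof (intro allI impI conjI)
      fix i :: nat assume i: "i < 3"
      show "C1 (u i) (ur i) (ut i) (uz i)"
        unfolding u_def ur_def ut_def uz_def by (rule C1_diff[OF V(1)[OF i] U(1)[OF i]])
      show "per (u i)" using V(2)[OF i] U(2)[OF i] by (simp add: u_def per_def theta_periodic_def)
      show "u i (R1, \<theta>, z) = 0" "u i (R2, \<theta>, z) = 0" for \<theta> z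
        by (rule lt3_cases[OF i]; use bcs[of \<theta> z] couette_bc[of \<omega>1 \<omega>2] poiseuille_bc[of \<nu>] in
          \<open>simp add: u_def V_def U_def base_V_def A_def B_def\<close>)+
    qed
    have us: "solenoidal u ur ut uz"
      unfolding solenoidal_def Let_def
    proof (intro allI impI)
      fix r \<theta> z :: real assume r: "R1 \<le> r \<and> r \<le> R2"
      have "Vr 0 (r, \<theta>, z) + (Vt 1 (r, \<theta>, z) + V 0 (r, \<theta>, z)) / r + Vz 2 (r, \<theta>, z) = 0"
        using jV r unfolding jets_def solenoidal_def Let_def V_def by blast
      moreover have "Ur 0 (r, \<theta>, z) + (0 + U 0 (r, \<theta>, z)) / r + 0 = 0"
        using jU r unfolding jets_def solenoidal_def Let_def by blast
      ultimately show "ur 0 (r, \<theta>, z) + (ut 1 (r, \<theta>, z) + u 0 (r, \<theta>, z)) / r + uz 2 (r, \<theta>, z) = 0"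
        by (simp add: u_def ur_def ut_def uz_def add_divide_distrib diff_divide_distrib)
    qed
    \<comment> \<open>The fit makes the flux of \<open>u\<close> vanish at z = 0, and
      \<open>flux_derivative\<close> carries this to every cross section.\<close>
    have uflux: "ang_int (rad_int (\<lambda>x. fst x * u 2 x)) x = 0" if "x \<in> S" for x
    proof -
      have r1: "rad_int (\<lambda>x. fst x * u 2 x) y = rad_int (\<lambda>x. fst x * vz x) y - a * I" for y
      proof -
        obtain r \<theta> z where y: "y = (r, \<theta>, z)" by (cases y)
        have "integral {R1..R2} (\<lambda>s. s * vz (s, \<theta>, z) - a * (s * poiseuille \<nu> s)) =
          integral {R1..R2} (\<lambda>s. s * vz (s, \<theta>, z)) - integral {R1..R2} (\<lambda>s. a * (s * poiseuille \<nu> s))"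
          by (rule integral_diff; intro integrable_continuous_real continuous_on_mult continuous_on_const
              continuous_on_id poiseuille_continuous)
            (use Vc[of 2] in \<open>simp_all add: V_def line_integrable(4)\<close>)
        moreover have "rad_int (\<lambda>x. fst x * u 2 x) y = integral {R1..R2} (\<lambda>s. s * vz (s, \<theta>, z) - a * (s * poiseuille \<nu> s))"
          unfolding y rad_int_def by (simp add: u_def V_def U_def base_V_def right_diff_distrib mult.left_commute)
        ultimately show ?thesis by (simp add: y rad_int_def I_def)
      qed
      have "ang_int (rad_int (\<lambda>x. fst x * u 2 x)) (R1, 0, 0) =
          integral {0..2*pi} (\<lambda>s. rad_int (\<lambda>x. fst x * vz x) (R1, s, 0) - a * I)"
        by (simp add: ang_int_def r1)
      also have "\<dots> = \<Phi> - 2 * pi * (a * I)"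
        unfolding \<Phi>_def ang_int_def prod.case
        by (subst integral_diff)
          (use R1_less_R2 in \<open>auto intro!: integrable_continuous_real line_integrable(2)[OF cont_rad_int[OF cz]]\<close>)
      also have "\<dots> = 0" using I by (simp add: a_def)
      finally have z: "ang_int (rad_int (\<lambda>x. fst x * u 2 x)) (R1, 0, 0) = 0" .
      obtain r \<theta> z where x: "x = (r, \<theta>, z)" by (cases x)
      have "ang_int (rad_int (\<lambda>x. fst x * u 2 x)) x = (\<lambda>s. ang_int (rad_int (\<lambda>x. fst x * u 2 x)) (R1, 0, s)) z"
        by (simp add: x ang_int_def rad_int_def)
      also have "\<dots> = (\<lambda>s. ang_int (rad_int (\<lambda>x. fst x * u 2 x)) (R1, 0, s)) 0"
        by (rule DERIV_isconst_all[of "\<lambda>s. ang_int (rad_int (\<lambda>x. fst x * u 2 x)) (R1, 0, s)"])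
          (use flux_derivative[OF u us] in blast)
      finally show ?thesis using z by simp
    qed
    define F where "F = (\<lambda>k x. V (k div 3) x * V (k mod 3) x - U (k div 3) x * U (k mod 3) x)"
    define q where "q = (\<lambda>x. p x - P x)"
    obtain D1 where D1: "divfree (stress \<nu> V Vr Vt Vz p) D1" using jets_divfree[OF jV[folded V_def]] by blast
    obtain D2 where D2: "divfree (stress \<nu> U Ur (\<lambda>i x. 0) (\<lambda>i x. 0) P) D2" using jets_divfree[OF jU] by blast
    define DM where "DM = (\<lambda>k x. D1 k x - D2 k x)"
    have "(\<lambda>k x. stress \<nu> V Vr Vt Vz p k x - stress \<nu> U Ur (\<lambda>i x. 0) (\<lambda>i x. 0) P k x) =
       (\<lambda>k x. F k x + (if k \<in> {0, 4, 8} then q x else 0) - \<nu> * grad u ur ut uz k x)"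
      unfolding u_def ur_def ut_def uz_def grad_diff
      by (intro ext) (simp add: stress_def F_def q_def right_diff_distrib)
    then have df: "divfree (\<lambda>k x. F k x + (if k \<in> {0, 4, 8} then q x else 0) - \<nu> * grad u ur ut uz k x) DM"
      using divfree_diff[OF D1 D2] by (simp add: DM_def)
    have u0: "u i x = 0" if "i < 3" "x \<in> S" for i x
    proof (rule van[OF u us uflux _ _ _ _ df that])
      show "\<bar>u i x\<bar> \<le> 2 * (K * C)" if "i < 3" "x \<in> S" for i x
        using abs_diff_le[OF VKb[OF that] Ub[OF that]] unfolding u_def by linarith
      show "cont (F k) \<and> per (F k)" if k: "k < 9" for k
      proof -
        have i: "k div 3 < 3" "k mod 3 < 3" using k by auto
        show ?thesis
          using Vc[OF i(1)] Vc[OF i(2)] Uc[OF i(1)] Uc[OF i(2)] V(2)[OF i(1)] V(2)[OF i(2)] U(2)[OF i(1)] U(2)[OF i(2)]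
          by (auto simp: F_def per_def theta_periodic_def)
      qed
      have "cont p" "cont P" using jV jU unfolding jets_def C1_def by blast+
      then show "cont q" by (auto simp: q_def)
      show "(\<Sum>k<9. (F k x)\<^sup>2) \<le> \<delta> * (\<Sum>i<3. (u i x)\<^sup>2)" if "x \<in> S" for x
        unfolding F_def CK[symmetric]
        by (rule velocity_difference_sq) (use VKb Ub that in \<open>auto simp: u_def\<close>)
    qed
    have VU: "V i x = U i x" if "i < 3" "x \<in> S" for i x using u0[OF that] by (simp add: u_def)
    \<comment> \<open>Once \<open>u\<close> vanishes, only the isotropic part \<open>q\<close> of
      the difference of the tensors is left.\<close>
    obtain b where b: "\<And>r \<theta> z. R1 < r \<Longrightarrow> r < R2 \<Longrightarrow> q (r, \<theta>, z) = b"
    proof (rule pressure_constant[OF df, of q])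
      fix k x assume k: "k < (9::nat)" and x: "x \<in> S"
      have "F k x = 0" unfolding F_def using k x by (simp add: VU)
      then show "F k x + (if k \<in> {0, 4, 8} then q x else 0) - \<nu> * grad u ur ut uz k x = (if k \<in> {0, 4, 8} then q x else 0)"
        using grad_zero[OF u u0 x k] by simp
    qed blast
    have "generalized_taylor_couette \<nu> R1 R2 \<omega>1 \<omega>2 vr vt vz p a b"
      unfolding generalized_taylor_couette_def Let_def A_def[symmetric] B_def[symmetric] \<eta>_def[symmetric]
    proof (intro allI impI)
      fix r \<theta> z :: real assume r: "R1 < r \<and> r < R2"
      then have x: "(r, \<theta>, z) \<in> S" by (simp add: S_iff)
      have "p (r, \<theta>, z) = P (r, \<theta>, z) + b" using b[of r \<theta> z] r by (simp add: q_def)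
      then show "vr (r, \<theta>, z) = 0 \<and> vt (r, \<theta>, z) = A * r + B * (1 / r) \<and>
        vz (r, \<theta>, z) = a / (4 * \<nu>) * R1\<^sup>2 * ((r / R1)\<^sup>2 - 1 + (1 - \<eta>\<^sup>2) / (\<eta>\<^sup>2 * ln \<eta>) * ln (r / R1)) \<and>
        p (r, \<theta>, z) = a * z + b + A\<^sup>2 / 2 * r\<^sup>2 + 2 * A * B * ln r - B\<^sup>2 / 2 * (1 / r\<^sup>2)"
        using VU[of 0, OF _ x] VU[of 1, OF _ x] VU[of 2, OF _ x]
        by (simp add: V_def U_def base_V_def P_def base_pressure_def poiseuille_def)
    qed
    then show "\<exists>a b. generalized_taylor_couette \<nu> R1 R2 \<omega>1 \<omega>2 vr vt vz p a b" by blast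
  qed
qed

end

text \<open>Along a single axial line the pressure is affine in z with slope \<open>a\<close>, and a
  nonconstant affine function is neither bounded nor periodic.\<close>

lemma taylor_couette_pressure_gradient:
  assumes R: "R1 < R2" and g: "generalized_taylor_couette \<nu> R1 R2 \<omega>1 \<omega>2 vr vt vz p a b"
    and p: "bounded_or_z_periodic R1 R2 p"
  shows "a = 0"
proof -
  define m where "m = (R1 + R2) / 2"
  have m: "R1 < m" "m < R2" using R by (auto simp: m_def)
  obtain c where c: "\<And>z. p (m, 0, z) = a * z + c"
  proof -
    have "p (m, 0, z) = a * z + (b + (couette_A R1 R2 \<omega>1 \<omega>2)\<^sup>2 / 2 * m\<^sup>2 +
        2 * couette_A R1 R2 \<omega>1 \<omega>2 * couette_B R1 R2 \<omega>1 \<omega>2 * ln m - (couette_B R1 R2 \<omega>1 \<omega>2)\<^sup>2 / 2 * (1 / m\<^sup>2))" for z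
      using g m unfolding generalized_taylor_couette_def Let_def by (simp add: algebra_simps)
    then show ?thesis by (rule that)
  qed
  from p consider "bounded (p ` slab R1 R2)" | T where "T > 0" "\<And>z. p (m, 0, z + T) = p (m, 0, z)"
    using m unfolding bounded_or_z_periodic_def by blast
  then show ?thesis
  proof cases
    case 1
    then obtain K where K: "\<And>x. x \<in> slab R1 R2 \<Longrightarrow> \<bar>p x\<bar> \<le> K" by (auto simp: bounded_iff)
    have ge: "\<bar>a * z + c\<bar> \<le> K" for z using K[of "(m, 0, z)"] m c by (simp add: slab_def)
    show ?thesis
    proof (rule ccontr)
      assume "a \<noteq> 0"
      then show False using ge[of "(K + 1 - c) / a"] by simp
    qed
  next
    case 2
    then show ?thesis using c[of 0] c[of T] 2(2)[of 0] by simp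
  qed
qed

theorem corollary1p3:
  fixes \<nu> R1 R2 :: real
  assumes "\<nu> > 0" and "0 < R1" and "R1 < R2"
  shows "\<exists>C1>0. \<exists>C2>0. property_P1 \<nu> R1 R2 C1 \<and> property_P2 \<nu> R1 R2 C2 \<and>
    (\<forall>\<omega>1 \<omega>2 vr vt vz p.
       smooth_solution \<nu> R1 R2 \<omega>1 \<omega>2 vr vt vz p \<and>
       small_data (min C1 C2) R1 R2 \<omega>1 \<omega>2 vr vt vz \<longrightarrow>
         (\<forall>f\<in>{vr, vt, vz, p}. axisymmetric R1 R2 f) \<and>
         (\<exists>a b. generalized_taylor_couette \<nu> R1 R2 \<omega>1 \<omega>2 vr vt vz p a b) \<and>
         (bounded_or_z_periodic R1 R2 p \<longrightarrow>
            canonical_taylor_couette R1 R2 \<omega>1 \<omega>2 vr vt vz))"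
proof -
  interpret annulus R1 R2 using assms by unfold_locales
  obtain C where C: "0 < C" and rig: "\<And>\<omega>1 \<omega>2 vr vt vz p. smooth_solution \<nu> R1 R2 \<omega>1 \<omega>2 vr vt vz p \<Longrightarrow>
      small_data C R1 R2 \<omega>1 \<omega>2 vr vt vz \<Longrightarrow> \<exists>a b. generalized_taylor_couette \<nu> R1 R2 \<omega>1 \<omega>2 vr vt vz p a b"
    using rigidity[OF assms(1)] by blast
  have axi: "axisymmetric R1 R2 f" if "generalized_taylor_couette \<nu> R1 R2 \<omega>1 \<omega>2 vr vt vz p a b" "f \<in> {vr, vt, vz, p}"
    for \<omega>1 \<omega>2 vr vt vz p a b f
    using that by (auto simp: axisymmetric_def generalized_taylor_couette_def Let_def)
  have a0: "a = 0 \<and> (\<forall>x\<in>slab R1 R2. vz x = 0)"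
    if "generalized_taylor_couette \<nu> R1 R2 \<omega>1 \<omega>2 vr vt vz p a b" "bounded_or_z_periodic R1 R2 p"
    for \<omega>1 \<omega>2 vr vt vz p a b
    using taylor_couette_pressure_gradient[OF assms(3) that] that(1)
    by (auto simp: generalized_taylor_couette_def Let_def slab_def)
  have can: "canonical_taylor_couette R1 R2 \<omega>1 \<omega>2 vr vt vz"
    if "generalized_taylor_couette \<nu> R1 R2 \<omega>1 \<omega>2 vr vt vz p a b" "bounded_or_z_periodic R1 R2 p"
    for \<omega>1 \<omega>2 vr vt vz p a b
    using a0[OF that] that(1) by (auto simp: canonical_taylor_couette_def generalized_taylor_couette_def Let_def)
  \<comment> \<open>\<open>rig\<close> gives the explicit form for every small solution, and both
    properties are read off from that form; the same \<open>C\<close> therefore serves as both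
    constants.\<close>
  have P1: "property_P1 \<nu> R1 R2 C"
    unfolding property_P1_def using rig a0 by meson
  have dth: "d_theta f x = 0" if "axisymmetric R1 R2 f" "x \<in> slab R1 R2" for f x
  proof -
    obtain r \<theta> z where x: "x = (r, \<theta>, z)" by (cases x)
    have "(\<lambda>s. f (r, s, z)) = (\<lambda>s. f (r, 0, z))" using that by (auto simp: axisymmetric_def x slab_def)
    then show ?thesis by (simp add: x d_theta_def)
  qed
  have P2: "property_P2 \<nu> R1 R2 C"
    unfolding property_P2_def using rig axi dth by meson
  have main: "(\<forall>f\<in>{vr, vt, vz, p}. axisymmetric R1 R2 f) \<and>
      (\<exists>a b. generalized_taylor_couette \<nu> R1 R2 \<omega>1 \<omega>2 vr vt vz p a b) \<and>
      (bounded_or_z_periodic R1 R2 p \<longrightarrow> canonical_taylor_couette R1 R2 \<omega>1 \<omega>2 vr vt vz)"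
    if sol: "smooth_solution \<nu> R1 R2 \<omega>1 \<omega>2 vr vt vz p \<and> small_data (min C C) R1 R2 \<omega>1 \<omega>2 vr vt vz"
    for \<omega>1 \<omega>2 vr vt vz p
  proof -
    obtain a b where g: "generalized_taylor_couette \<nu> R1 R2 \<omega>1 \<omega>2 vr vt vz p a b"
      using rig[of \<omega>1 \<omega>2 vr vt vz p] sol by auto
    show ?thesis using axi[OF g] can[OF g] g by blast
  qed
  show ?thesis
    by (intro exI[of _ C] conjI[OF C] conjI[OF P1] conjI[OF P2] allI impI main)
qed

end
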